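(* Let $\mathcal{G}$ be a finite connected graph with at least two cycles, with edge weights $a$ and vertex potential $b$, and assume that $a_f>0$ for all $f\in E(\mathcal{G})$. Let $\mathcal{T}$ be the universal cover of $\mathcal{G}$ with the induced periodic edge weights and vertex potential, let $A_{\mathcal{T}}$ be the corresponding Jacobi matrix, let $\mu_{A_{\mathcal{T}}}$ be the density of states of $A_{\mathcal{T}}$, and let $\rho_r$ be the right edge (maximum element) of the spectrum of $A_{\mathcal{T}}$. Then $\mu_{A_{\mathcal{T}}}$ is absolutely continuous in a neighborhood of $\rho_r$ and $$\lim_{x\to\rho_r}\frac{d\mu_{A_{\mathcal{T}}}}{dx}(x)=0.$$
   Context: Graphs. A graph $\mathcal{G}$ is locally finite and undirected, with loops and multi-edges allowed. It has a vertex set $V(\mathcal{G})$ and a set $E(\mathcal{G})$ of directed edges; each $f\in E(\mathcal{G})$ has a source $\sigma(f)$ and a target $\tau(f)$ in $V(\mathcal{G})$, and there is an involution $f\mapsto\check f$ on $E(\mathcal{G})$ (edge reversal) with $\sigma(\check f)=\tau(f)$ and $\tau(\check f)=\sigma(f)$. Here $\check f\ne f$ for all $f$ (every loop is a "whole-loop", consisting of two distinct directed edges $f,\check f$ at the same vertex; "half-loops" $\check f=f$ are not allowed). For a vertex $u$, $\sigma(u)=\{f\in E(\mathcal{G}):\sigma(f)=u\}$. Loops, and pairs of parallel edges, count as cycles. Edge weights are a function $a:E(\mathcal{G})\to\mathbb{R}$ with $a_f=a_{\check f}$; a vertex potential is a function $b:V(\mathcal{G})\to\mathbb{R}$. The Jacobi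 matrix $A_{\mathcal{G}}$ is the operator on $\ell^2(V(\mathcal{G}))$ given by $$(A_{\mathcal{G}}\xi)(u)=b_u\,\xi(u)+\sum_{f\in\sigma(u)}a_f\,\xi(\tau(f)).$$ Universal cover. Fix $v_0\in V(\mathcal{G})$, $\mathcal{G}$ finite and connected. A non-backtracking walk starting at $v_0$ is a finite (possibly empty) sequence $f_1,\dots,f_m$ of directed edges with $\sigma(f_1)=v_0$, $\tau(f_i)=\sigma(f_{i+1})$ and $f_{i+1}\neq\check f_i$. The universal cover $\mathcal{T}=\mathcal{T}(\mathcal{G})$ is the tree whose vertices are these walks, two walks being joined by an edge when one is obtained from the other by appending one edge at the end. The covering map $\Xi:\mathcal{T}\to\mathcal{G}$ sends a walk to its end vertex (the empty walk to $v_0$). The edge weights and potential are lifted to $\mathcal{T}$ through $\Xi$: the edge joining a walk $w$ to the walk $wf$ has weight $a_f$ and the vertex $w$ has potential $b_{\Xi(w)}$. $A_{\mathcal{T}}$ is the Jacobi matrix of $\mathcal{T}$ with these lifted coefficients; it is a bounded self-adjoint operator. Density of states. For $u\in V(\mathcal{G})$ choose $\tilde u\in\Xi^{-1}(u)$ and let $\mu_u$ be the spectral measure of $A_{\mathcal{T}}$ at $\tilde u$, i.e. the probability measure on $\mathbb{R}$ with $\int x^k\,d\mu_u(x)=\langle\delta_{\tilde u},A_{\mathcal{T}}^k\delta_{\tilde u}\rangle$ for all $k\ge 0$ (it does not depend on the choice of $\tilde u$). The density of states of $A_{\mathcal{T}}$ is $\mu_{A_{\mathcal{T}}}=\frac{1}{|V(\mathcal{G})|}\sum_{u\in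 V(\mathcal{G})}\mu_u$. *)

theory Defs
  imports
    "HOL-Probability.Probability"
    "Graph_Theory.Graph_Theory"
begin

text \<open>
  A graph is a digraph together with an edge reversal: \<open>bidirected_digraph G arev\<close> says that
  \<open>arev\<close> is an involution without fixed points on the arcs that swaps tail and head. Hence
  multi-edges and whole-loops are allowed and half-loops are not. The locale also asks that
  \<open>arev\<close> is the identity outside the arcs, which is only a convention.
\<close>

text \<open>
  A cycle is identified with its set of edges, closed under reversal. The library's
  \<open>cycle\<close> also holds of the closed walk that goes along an edge and straight back
  (\<open>[e, arev e]\<close>); this is excluded. Loops and pairs of parallel edges remain.
\<close>

definition undirected_cycles :: "('v, 'e) pre_digraph \<Rightarrow> ('e \<Rightarrow> 'e) \<Rightarrow> 'e set set" where
  "undirected_cycles G arev =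
     {set p \<union> arev ` set p | p. pre_digraph.cycle G p \<and> (\<forall>e\<in>set p. arev e \<notin> set p)}"

section \<open>Square-summable functions and bounded operators\<close>

text \<open>Functions on \<open>S\<close> are represented by functions on the whole type that vanish outside \<open>S\<close>.\<close>

definition ell2 :: "'a set \<Rightarrow> ('a \<Rightarrow> complex) set" where
  "ell2 S = {\<xi>. (\<forall>x. x \<notin> S \<longrightarrow> \<xi> x = 0) \<and> (\<lambda>x. (cmod (\<xi> x))\<^sup>2) summable_on S}"

definition ell2_inner :: "'a set \<Rightarrow> ('a \<Rightarrow> complex) \<Rightarrow> ('a \<Rightarrow> complex) \<Rightarrow> complex" where
  "ell2_inner S \<xi> \<eta> = (\<Sum>\<^sub>\<infinity>x\<in>S. cnj (\<xi> x) * \<eta> x)"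

definition ell2_norm :: "'a set \<Rightarrow> ('a \<Rightarrow> complex) \<Rightarrow> real" where
  "ell2_norm S \<xi> = sqrt (\<Sum>\<^sub>\<infinity>x\<in>S. (cmod (\<xi> x))\<^sup>2)"

text \<open>
  \<open>z\<close> is in the resolvent set iff \<open>T - z\<close> has a bounded two-sided inverse \<open>R\<close> on
  \<open>ell2 S\<close>. Linearity of \<open>R\<close> is automatic for linear \<open>T\<close>.
\<close>

definition ell2_resolvent_set ::
    "'a set \<Rightarrow> (('a \<Rightarrow> complex) \<Rightarrow> ('a \<Rightarrow> complex)) \<Rightarrow> complex set" where
  "ell2_resolvent_set S T = {z. \<exists>R C. \<forall>\<xi>\<in>ell2 S.
      R \<xi> \<in> ell2 S \<and> ell2_norm S (R \<xi>) \<le> C * ell2_norm S \<xi> \<and>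
      R (\<lambda>x. T \<xi> x - z * \<xi> x) = \<xi> \<and>
      (\<lambda>x. T (R \<xi>) x - z * R \<xi> x) = \<xi>}"

definition ell2_spectrum ::
    "'a set \<Rightarrow> (('a \<Rightarrow> complex) \<Rightarrow> ('a \<Rightarrow> complex)) \<Rightarrow> complex set" where
  "ell2_spectrum S T = - ell2_resolvent_set S T"

text \<open>
  The spectral measure of \<open>T\<close> at the basis vector of \<open>w\<close>, described by its moments; for
  bounded self-adjoint \<open>T\<close> it exists and is unique.
\<close>

definition is_spectral_measure ::
    "'a set \<Rightarrow> (('a \<Rightarrow> complex) \<Rightarrow> ('a \<Rightarrow> complex)) \<Rightarrow> 'a \<Rightarrow> real measure \<Rightarrow> bool" where
  "is_spectral_measure S T w M \<longleftrightarrow>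
     prob_space M \<and> sets M = sets borel \<and>
     (\<forall>k::nat. integrable M (\<lambda>x. x ^ k) \<and>
        complex_of_real (\<integral>x. x ^ k \<partial>M) =
          ell2_inner S (indicator {w}) ((T ^^ k) (indicator {w})))"

section \<open>Jacobi matrices and the universal cover\<close>

definition jacobi ::
    "('v, 'e) pre_digraph \<Rightarrow> ('e \<Rightarrow> real) \<Rightarrow> ('v \<Rightarrow> real) \<Rightarrow> ('v \<Rightarrow> complex) \<Rightarrow> ('v \<Rightarrow> complex)" where
  "jacobi G a b \<xi> u =
     complex_of_real (b u) * \<xi> u + (\<Sum>f\<in>out_arcs G u. complex_of_real (a f) * \<xi> (head G f))"

definition nb_walks :: "('v, 'e) pre_digraph \<Rightarrow> ('e \<Rightarrow> 'e) \<Rightarrow> 'v \<Rightarrow> 'e list set" where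
  "nb_walks G arev v0 =
     {p. (\<exists>v. pre_digraph.awalk G v0 p v) \<and> successively (\<lambda>e f. f \<noteq> arev e) p}"

definition universal_cover ::
    "('v, 'e) pre_digraph \<Rightarrow> ('e \<Rightarrow> 'e) \<Rightarrow> 'v \<Rightarrow> ('e list, 'e list \<times> 'e list) pre_digraph" where
  "universal_cover G arev v0 =
     \<lparr> verts = nb_walks G arev v0,
       arcs = {(p, q). p \<in> nb_walks G arev v0 \<and> q \<in> nb_walks G arev v0 \<and>
                       (\<exists>f. q = p @ [f] \<or> p = q @ [f])},
       tail = fst, head = snd \<rparr>"

definition cover_map :: "('v, 'e) pre_digraph \<Rightarrow> 'v \<Rightarrow> 'e list \<Rightarrow> 'v" where
  "cover_map G v0 p = last (pre_digraph.awalk_verts G v0 p)"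

text \<open>Both arcs between \<open>p\<close> and \<open>p @ [f]\<close> get the weight of \<open>f\<close>.\<close>

definition lift_weight :: "('e \<Rightarrow> real) \<Rightarrow> 'e list \<times> 'e list \<Rightarrow> real" where
  "lift_weight a = (\<lambda>(p, q). a (last (if length p < length q then q else p)))"

definition lift_potential ::
    "('v, 'e) pre_digraph \<Rightarrow> 'v \<Rightarrow> ('v \<Rightarrow> real) \<Rightarrow> 'e list \<Rightarrow> real" where
  "lift_potential G v0 b p = b (cover_map G v0 p)"

definition cover_jacobi ::
    "('v, 'e) pre_digraph \<Rightarrow> ('e \<Rightarrow> 'e) \<Rightarrow> 'v \<Rightarrow> ('e \<Rightarrow> real) \<Rightarrow> ('v \<Rightarrow> real) \<Rightarrow>
     ('e list \<Rightarrow> complex) \<Rightarrow> ('e list \<Rightarrow> complex)" where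
  "cover_jacobi G arev v0 a b =
     jacobi (universal_cover G arev v0) (lift_weight a) (lift_potential G v0 b)"

definition density_of_states ::
    "('v, 'e) pre_digraph \<Rightarrow> ('v \<Rightarrow> real measure) \<Rightarrow> real measure" where
  "density_of_states G \<mu> =
     measure_of UNIV (sets borel)
       (\<lambda>A. (\<Sum>u\<in>verts G. emeasure (\<mu> u) A) / of_nat (card (verts G)))"

text \<open>The measure \<open>A \<mapsto> M (A \<inter> U)\<close> on the whole line.\<close>

definition cut_measure :: "real measure \<Rightarrow> real set \<Rightarrow> real measure" where
  "cut_measure M U = density M (indicator U)"

end

theory Submission
  imports Defs "HOL-Complex_Analysis.Complex_Analysis" "HOL-Library.Sublist"
begin

text \<open>
For an arc \<open>f\<close> let \<open>h f z\<close> be the Green's function \<open>\<langle>\<delta>, (z - A)\<^sup>-\<^sup>1 \<delta>\<rangle>\<close> at the root of the branch of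
the universal cover that lies beyond a lift of \<open>f\<close>. Removing the root of a branch gives
\<open>h f z = 1 / (z - b (head f) - (\<Sum>g. (a g)\<^sup>2 * h g z))\<close>, where \<open>g\<close> runs over the arcs that can follow
\<open>f\<close> without backtracking, and the Stieltjes transform of the spectral measure over a vertex \<open>u\<close>
is \<open>1 / (z - b u - (\<Sum>g. (a g)\<^sup>2 * h g z))\<close>, where \<open>g\<close> runs over all arcs out of \<open>u\<close>.

The theorem reduces to a single limit: the imaginary parts of these Stieltjes transforms tend to
\<open>0\<close> as \<open>z\<close> tends to \<open>\<rho>\<close> in the upper half-plane. Since an interval of radius \<open>\<eta>\<close> around \<open>x\<close> has
measure at most \<open>2 * \<eta>\<close> times the negative imaginary part at \<open>x + \<i> \<eta>\<close>, the density is then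
bounded by any given \<open>\<epsilon>\<close> close to \<open>\<rho>\<close>, and boundary values of the transforms never have to be
constructed (\<open>interval_measure_le_Im_stieltjes\<close>, \<open>vanishing_density\<close>).

At \<open>\<rho>\<close> itself the recursion has a finite positive solution \<open>m\<close>. The growth rate of the iterates
of the shifted Jacobi matrix belongs to its spectrum (\<open>top_in_spectrum\<close>), so every \<open>x > \<rho>\<close>
admits a positive superharmonic function. These functions bound the iterates of the recursion
started at \<open>0\<close>, which therefore increase to \<open>m\<close> at \<open>\<rho>\<close>. For \<open>Re z \<ge> \<rho>\<close> the complex
iterates are dominated by the real ones, so \<open>h\<close> tends to \<open>m\<close> from that side
(\<open>branch_solution_exists\<close>).

From the other side this is a rigidity argument. Put \<open>s = h / m - 1\<close> and
\<open>Q f g = m f * (a g)\<^sup>2 * m g\<close>; in the limit \<open>s f = (1 + s f) * (\<Sum>g. Q f g * s g)\<close> and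
\<open>Im (s f) \<le> 0\<close>. Let \<open>v > 0\<close> satisfy \<open>Q v \<le> v\<close> on a strongly connected class of arcs. For
\<open>W = v / s\<close> the equation says that \<open>W f + v f\<close> is a harmonic mean of the \<open>W g\<close>. The
inversion maps the half-plane \<open>Im \<ge> t\<close> to a disc, which is strictly convex, so at an arc where
\<open>Im W\<close> is minimal all \<open>W g\<close> are equal to \<open>W f + v f\<close>. Their real part is larger, which is
impossible on a finite set. Hence \<open>0\<close> is the only small solution (\<open>complex_solution_zero\<close>). It
follows that near \<open>\<rho>\<close> the maximum of \<open>cmod s\<close> omits every small positive value, and by
connectedness of half-discs it stays small (\<open>branch_solution_tendsto\<close>).

The two cycles are used to see that \<open>\<rho> - b u - (\<Sum>g. (a g)\<^sup>2 * m g)\<close> does not vanish. If it did,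
then \<open>(a g)\<^sup>2 * m g * m (arev g) = 1\<close> for all arcs, so reversing the arcs inverts \<open>Q\<close>. With
\<open>v\<close> as above and \<open>w\<close> its analogue for the reversed class, \<open>v f / w (arev f)\<close> does not
increase along non-backtracking walks within the class; but two cycles yield an arc with two successors that both
lead back to it, and there the quotient drops strictly (\<open>two_cycles_branching\<close>,
\<open>vertex_denom_pos\<close>).
\<close>

section \<open>Subsequences\<close>

text \<open>
Induction over the index set replaces the diagonal argument. The properties in question are
inherited by subsequences, for instance convergence of the sequence attached to an index.
\<close>

lemma finite_common_subseq:
  fixes P :: "'i \<Rightarrow> (nat \<Rightarrow> nat) \<Rightarrow> bool"
  assumes "finite I"
    and step: "\<And>i (r :: nat \<Rightarrow> nat). i \<in> I \<Longrightarrow> strict_mono r \<Longrightarrow>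
      \<exists>s :: nat \<Rightarrow> nat. strict_mono s \<and> P i (r \<circ> s)"
    and hered: "\<And>i r (s :: nat \<Rightarrow> nat). i \<in> I \<Longrightarrow> P i r \<Longrightarrow> strict_mono s \<Longrightarrow> P i (r \<circ> s)"
  shows "\<exists>r. strict_mono r \<and> (\<forall>i\<in>I. P i r)"
  using assms(1) step hered
proof (induction I rule: finite_induct)
  case empty
  show ?case by (intro exI[of _ id]) (simp add: strict_mono_id)
next
  case (insert i I)
  have "\<exists>r. strict_mono r \<and> (\<forall>j\<in>I. P j r)"
    by (rule insert.IH) (use insert.prems in auto)
  then obtain r where r: "strict_mono r" "\<forall>j\<in>I. P j r" by blast
  obtain s where s: "strict_mono s" "P i (r \<circ> s)"
    using insert.prems(1)[of i r] r(1) by blast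
  have "\<forall>j\<in>I. P j (r \<circ> s)" using insert.prems(2) r(2) s(1) by blast
  then show ?case using r(1) s strict_mono_o by blast
qed

lemma finite_convergent_subseq:
  fixes X :: "nat \<Rightarrow> 'i \<Rightarrow> 'a::heine_borel"
  assumes "finite I" and bnd: "\<And>i. i \<in> I \<Longrightarrow> bounded (range (\<lambda>n. X n i))"
  obtains r l where "strict_mono (r :: nat \<Rightarrow> nat)" "\<And>i. i \<in> I \<Longrightarrow> (\<lambda>n. X (r n) i) \<longlonglongrightarrow> l i"
proof -
  have "\<exists>r :: nat \<Rightarrow> nat. strict_mono r \<and> (\<forall>i\<in>I. \<exists>l. (\<lambda>n. X (r n) i) \<longlonglongrightarrow> l)"
  proof (rule finite_common_subseq[OF assms(1)])
    fix i and r :: "nat \<Rightarrow> nat" assume i: "i \<in> I"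
    have "bounded (range (\<lambda>n. X (r n) i))"
      by (rule bounded_subset[OF bnd[OF i]]) auto
    from bounded_imp_convergent_subsequence[OF this]
    show "\<exists>s. strict_mono s \<and> (\<exists>l. (\<lambda>n. X ((r \<circ> s) n) i) \<longlonglongrightarrow> l)"
      by (auto simp: o_def)
  next
    fix i and r s :: "nat \<Rightarrow> nat"
    assume "\<exists>l. (\<lambda>n. X (r n) i) \<longlonglongrightarrow> l" "strict_mono s"
    then show "\<exists>l. (\<lambda>n. X ((r \<circ> s) n) i) \<longlonglongrightarrow> l"
      using LIMSEQ_subseq_LIMSEQ[of "\<lambda>n. X (r n) i" _ s] by (auto simp only: o_def)
  qed
  then show ?thesis using that by metis
qed

section \<open>The branch recursion\<close>

text \<open>
The fixed points of \<open>\<lambda>h f. inverse (branch_denom N \<alpha> \<beta> z h f)\<close> are the Green's functions of the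
branches at their roots, and the iterates from \<open>0\<close> are those of the branches truncated at
finite depth. The field is left open because the recursion is used at the real point \<open>\<rho>\<close> and at
complex \<open>z\<close>.
\<close>

definition branch_denom ::
    "('e \<Rightarrow> 'e set) \<Rightarrow> ('e \<Rightarrow> real) \<Rightarrow> ('e \<Rightarrow> real) \<Rightarrow> 'a::real_normed_field \<Rightarrow> ('e \<Rightarrow> 'a) \<Rightarrow> 'e \<Rightarrow> 'a" where
  "branch_denom N \<alpha> \<beta> z h f = z - of_real (\<beta> f) - (\<Sum>g\<in>N f. of_real (\<alpha> g) * h g)"

primrec branch_iter ::
    "('e \<Rightarrow> 'e set) \<Rightarrow> ('e \<Rightarrow> real) \<Rightarrow> ('e \<Rightarrow> real) \<Rightarrow> 'a::real_normed_field \<Rightarrow> nat \<Rightarrow> 'e \<Rightarrow> 'a" where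
  "branch_iter N \<alpha> \<beta> z 0 = (\<lambda>_. 0)"
| "branch_iter N \<alpha> \<beta> z (Suc n) = (\<lambda>f. inverse (branch_denom N \<alpha> \<beta> z (branch_iter N \<alpha> \<beta> z n) f))"

text \<open>
Here \<open>N f\<close> are the arcs that may follow \<open>f\<close>, \<open>\<alpha>\<close> the squared weights and \<open>\<beta> f\<close> the potential at
the head of \<open>f\<close>. The last two assumptions say in terms of truncated branches that \<open>\<rho>\<close> is not
below the spectral edge of any branch and that the Green's functions stay finite at \<open>\<rho>\<close>.
\<close>

locale branch_recursion =
  fixes E :: "'e set" and N :: "'e \<Rightarrow> 'e set" and \<alpha> \<beta> :: "'e \<Rightarrow> real" and \<rho> :: real
  assumes finite_E: "finite E"
    and N_subset: "f \<in> E \<Longrightarrow> N f \<subseteq> E"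
    and \<alpha>_pos: "g \<in> E \<Longrightarrow> 0 < \<alpha> g"
    and denom_pos: "f \<in> E \<Longrightarrow> 0 < branch_denom N \<alpha> \<beta> \<rho> (branch_iter N \<alpha> \<beta> \<rho> n) f"
    and iter_bounded: "f \<in> E \<Longrightarrow> \<exists>K. \<forall>n. branch_iter N \<alpha> \<beta> \<rho> n f \<le> K"
begin

abbreviation D :: "'a::real_normed_field \<Rightarrow> ('e \<Rightarrow> 'a) \<Rightarrow> 'e \<Rightarrow> 'a" where
  "D \<equiv> branch_denom N \<alpha> \<beta>"

abbreviation it :: "'a::real_normed_field \<Rightarrow> nat \<Rightarrow> 'e \<Rightarrow> 'a" where
  "it \<equiv> branch_iter N \<alpha> \<beta>"

lemma finite_N: "f \<in> E \<Longrightarrow> finite (N f)"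
  using finite_E N_subset finite_subset by blast

lemma N_E: "f \<in> E \<Longrightarrow> g \<in> N f \<Longrightarrow> g \<in> E"
  using N_subset by blast

lemma denom_diff: "D z h f - D z k f = (\<Sum>g\<in>N f. of_real (\<alpha> g) * (k g - h g))"
  by (simp add: branch_denom_def sum_subtractf right_diff_distrib)

lemma it_nonneg: "f \<in> E \<Longrightarrow> 0 \<le> it \<rho> n f"
  using denom_pos by (cases n) (auto simp: less_imp_le)

lemma it_Suc_pos: "f \<in> E \<Longrightarrow> 0 < it \<rho> (Suc n) f"
  using denom_pos by simp

lemma it_mono: "f \<in> E \<Longrightarrow> it \<rho> n f \<le> it \<rho> (Suc n) f"
proof (induction n arbitrary: f)
  case 0
  then show ?case using it_nonneg[of f "Suc 0"] by simp
next
  case (Suc n)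
  have "0 \<le> (\<Sum>g\<in>N f. \<alpha> g * (it \<rho> (Suc n) g - it \<rho> n g))"
    using Suc.IH N_E[OF Suc.prems] \<alpha>_pos by (intro sum_nonneg) (simp add: less_imp_le)
  then have "D \<rho> (it \<rho> (Suc n)) f \<le> D \<rho> (it \<rho> n) f"
    using denom_diff[of \<rho> "it \<rho> n" f "it \<rho> (Suc n)"] by simp
  then show ?case using denom_pos[OF Suc.prems, of "Suc n"] by (simp add: le_imp_inverse_le)
qed

text \<open>
The minimal positive solution of the recursion at \<open>\<rho>\<close>.
\<close>

definition m :: "'e \<Rightarrow> real" where "m f = lim (\<lambda>n. it \<rho> n f)"

lemma it_tendsto: assumes "f \<in> E" shows "(\<lambda>n. it \<rho> n f) \<longlonglongrightarrow> m f"
proof -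
  obtain K where K: "\<And>n. it \<rho> n f \<le> K" using iter_bounded[OF assms] by blast
  have "incseq (\<lambda>n. it \<rho> n f)" by (rule incseq_SucI) (rule it_mono[OF assms])
  then obtain L where "(\<lambda>n. it \<rho> n f) \<longlonglongrightarrow> L"
    using incseq_convergent[of "\<lambda>n. it \<rho> n f" K] K by blast
  then have "convergent (\<lambda>n. it \<rho> n f)" by (rule convergentI)
  then show ?thesis by (simp add: m_def convergent_LIMSEQ_iff)
qed

lemma it_le_m: assumes "f \<in> E" shows "it \<rho> n f \<le> m f"
  using incseq_le[OF incseq_SucI it_tendsto[OF assms], of n] it_mono[OF assms] by auto

lemma m_pos: "f \<in> E \<Longrightarrow> 0 < m f"
  using it_Suc_pos[of f 0] it_le_m[of f "Suc 0"] by linarith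

lemma D_tendsto: assumes "f \<in> E" shows "(\<lambda>n. D \<rho> (it \<rho> n) f) \<longlonglongrightarrow> D \<rho> m f"
  unfolding branch_denom_def using N_E[OF assms] by (intro tendsto_intros it_tendsto) auto

lemma m_fixed: assumes "f \<in> E" shows "m f * D \<rho> m f = 1"
proof (rule LIMSEQ_unique)
  show "(\<lambda>n. it \<rho> (Suc n) f * D \<rho> (it \<rho> n) f) \<longlonglongrightarrow> m f * D \<rho> m f"
    by (intro tendsto_mult D_tendsto[OF assms] LIMSEQ_Suc[OF it_tendsto[OF assms]])
  show "(\<lambda>n. it \<rho> (Suc n) f * D \<rho> (it \<rho> n) f) \<longlonglongrightarrow> 1"
    using denom_pos[OF assms] by (simp add: less_imp_neq[symmetric])
qed

text \<open>
The relation \<open>R\<close> need not be strongly connected on \<open>E\<close>: arcs that lead into a finite branch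
never come back. Therefore the Perron-Frobenius argument is carried out on each strongly
connected class \<open>scc f\<close>.
\<close>

definition R :: "('e \<times> 'e) set" where "R = {(f, g). f \<in> E \<and> g \<in> N f}"

definition scc :: "'e \<Rightarrow> 'e set" where "scc f = {g. (f, g) \<in> R\<^sup>* \<and> (g, f) \<in> R\<^sup>*}"

text \<open>
The derivative of the recursion at \<open>m\<close>, in the coordinates \<open>h f / m f\<close>.
\<close>

definition Q :: "'e \<Rightarrow> 'e \<Rightarrow> real" where "Q f g = m f * \<alpha> g * m g"

lemma Q_pos: "f \<in> E \<Longrightarrow> g \<in> E \<Longrightarrow> 0 < Q f g"
  by (simp add: Q_def m_pos \<alpha>_pos)

lemma R_reach_E: "(f, g) \<in> R\<^sup>* \<Longrightarrow> f \<in> E \<Longrightarrow> g \<in> E"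
  by (induction rule: rtrancl_induct) (auto simp: R_def N_E)

lemma self_scc: "f \<in> scc f" by (simp add: scc_def)

lemma scc_subset: "f \<in> E \<Longrightarrow> scc f \<subseteq> E"
  by (auto simp: scc_def R_reach_E)

lemma scc_reach: "g \<in> scc f \<Longrightarrow> k \<in> scc f \<Longrightarrow> (g, k) \<in> R\<^sup>*"
  by (auto simp: scc_def intro: rtrancl_trans)

lemma scc_between: "g \<in> scc f \<Longrightarrow> (g, j) \<in> R\<^sup>* \<Longrightarrow> (j, k) \<in> R\<^sup>* \<Longrightarrow> k \<in> scc f \<Longrightarrow> j \<in> scc f"
  by (auto simp: scc_def intro: rtrancl_trans)

text \<open>
The relative errors \<open>s n f = (m f - it \<rho> n f) / m f\<close> decrease in \<open>n\<close> and satisfy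
\<open>s (Suc n) f = (it \<rho> (Suc n) f / m f) * (\<Sum>g\<in>N f. Q f g * s n g)\<close>, where the first factor tends
to \<open>1\<close>. Hence \<open>s n\<close> is almost a supersolution of \<open>Q\<close>, and a limit of the vectors \<open>s n\<close>,
normalised on the class, is an exact one. It is positive everywhere on the class because it is
positive somewhere and positivity spreads against the direction of the arcs. In other words, the
spectral radius of \<open>Q\<close> on the class is at most \<open>1\<close>, with an explicit witness.
\<close>

lemma scc_supersolution:
  assumes f0: "f0 \<in> E"
  obtains v :: "'e \<Rightarrow> real"
  where "\<And>f. f \<in> scc f0 \<Longrightarrow> 0 < v f"
    and "\<And>f. f \<in> scc f0 \<Longrightarrow> (\<Sum>g\<in>N f \<inter> scc f0. Q f g * v g) \<le> v f"
proof (cases "\<forall>f\<in>scc f0. N f \<inter> scc f0 = {}")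
  case True
  \<comment> \<open>A class without an inner arc is a single arc that does not return to itself, and the sums are empty.\<close>
  then show ?thesis using that[of "\<lambda>_. 1"] by simp
next
  case False
  define C where "C = scc f0"
  have CE: "C \<subseteq> E" using scc_subset[OF f0] by (simp add: C_def)
  then have finC: "finite C" using finite_E finite_subset by blast
  have f0C: "f0 \<in> C" by (simp add: C_def self_scc)
  have succ_in_C: "\<exists>g. g \<in> N f \<inter> C" if f: "f \<in> C" for f
  proof -
    obtain p q where pq: "p \<in> C" "q \<in> C" "q \<in> N p" using False by (auto simp: C_def)
    have "(p, q) \<in> R" using pq CE by (auto simp: R_def)
    then have "(f, f) \<in> R\<^sup>+" using scc_reach[of f f0 p] scc_reach[of q f0 f] pq f
      by (auto simp: C_def intro: rtrancl_into_trancl1 trancl_rtrancl_trancl)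
    then obtain g where g: "(f, g) \<in> R" "(g, f) \<in> R\<^sup>*" by (meson tranclD)
    then have "g \<in> C" using scc_between[of f f0 g f] f by (auto simp: C_def)
    then show ?thesis using g by (auto simp: R_def)
  qed
  define s where "s n f = (m f - it \<rho> n f) / m f" for n f
  have s_nonneg: "0 \<le> s n f" if "f \<in> E" for n f
    using that it_le_m m_pos by (simp add: s_def less_imp_le)
  have s_Suc: "s (Suc n) f = it \<rho> (Suc n) f / m f * (\<Sum>g\<in>N f. Q f g * s n g)" if f: "f \<in> E" for n f
  proof -
    have "D \<rho> (it \<rho> n) f - D \<rho> m f = (\<Sum>g\<in>N f. \<alpha> g * (m g - it \<rho> n g))"
      by (simp add: denom_diff)
    also have "\<dots> = (\<Sum>g\<in>N f. \<alpha> g * (m g * s n g))"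
      using m_pos N_E[OF f] by (intro sum.cong) (force simp: s_def)+
    finally have "D \<rho> (it \<rho> n) f - D \<rho> m f = (\<Sum>g\<in>N f. \<alpha> g * m g * s n g)"
      by (simp add: mult.assoc)
    then have 1: "m f * (D \<rho> (it \<rho> n) f - D \<rho> m f) = (\<Sum>g\<in>N f. Q f g * s n g)"
      by (simp add: Q_def sum_distrib_left mult.assoc)
    have 2: "it \<rho> (Suc n) f * D \<rho> (it \<rho> n) f = 1" using denom_pos[OF f, of n] by simp
    have "m f * (D \<rho> (it \<rho> n) f - D \<rho> m f) * it \<rho> (Suc n) f
        = m f * (it \<rho> (Suc n) f * D \<rho> (it \<rho> n) f) - (m f * D \<rho> m f) * it \<rho> (Suc n) f"
      by (simp only: algebra_simps)
    also have "\<dots> = m f - it \<rho> (Suc n) f" by (simp only: 2 m_fixed[OF f])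
    finally show ?thesis using 1 by (simp only: s_def) (simp only: mult.commute times_divide_eq_left)
  qed
  have s_pos: "0 < s n f" if "f \<in> C" for n f
    using that
  proof (induction n arbitrary: f)
    case 0
    then have "m f \<noteq> 0" using m_pos[of f] CE by auto
    then show ?case by (simp add: s_def)
  next
    case (Suc n)
    have fE: "f \<in> E" using Suc.prems CE by auto
    obtain g where g: "g \<in> N f \<inter> C" using succ_in_C[OF Suc.prems] by blast
    have "0 < (\<Sum>g\<in>N f. Q f g * s n g)"
    proof (rule sum_pos2[of _ g])
      show "0 < Q f g * s n g" using g Suc.IH Q_pos fE CE by auto
      show "0 \<le> Q f k * s n k" if "k \<in> N f" for k
        using that fE N_E s_nonneg Q_pos by (simp add: less_imp_le)
    qed (use g finite_N fE in auto)
    then show ?case unfolding s_Suc[OF fE] using it_Suc_pos[OF fE] m_pos[OF fE] by simp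
  qed
  define V where "V n = Max (s n ` C)" for n
  have V: "0 < V n" "\<And>f. f \<in> C \<Longrightarrow> s n f \<le> V n" "\<exists>f\<in>C. s n f = V n" for n
  proof -
    show "s n f \<le> V n" if "f \<in> C" for f using that finC by (simp add: V_def)
    then show "0 < V n" using s_pos[OF f0C, of n] f0C by force
    show "\<exists>f\<in>C. s n f = V n"
      using Max_in[of "s n ` C"] finC f0C unfolding V_def by (metis empty_iff finite_imageI imageE image_is_empty)
  qed
  define u where "u n f = s n f / V n" for n f
  have u: "0 < u n f" "u n f \<le> 1" if "f \<in> C" for n f
    using that s_pos V by (auto simp: u_def)
  have u_super: "it \<rho> (Suc n) f / m f * (\<Sum>g\<in>N f \<inter> C. Q f g * u n g) \<le> u n f" if f: "f \<in> C" for n f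
  proof -
    have fE: "f \<in> E" using f CE by auto
    have "it \<rho> (Suc n) f / m f * (\<Sum>g\<in>N f \<inter> C. Q f g * s n g)
        \<le> it \<rho> (Suc n) f / m f * (\<Sum>g\<in>N f. Q f g * s n g)"
      using it_nonneg[OF fE, of "Suc n"] m_pos[OF fE] fE
      by (intro mult_left_mono sum_mono2 finite_N)
        (auto simp: N_E s_nonneg Q_pos less_imp_le simp del: branch_iter.simps)
    also have "\<dots> = s (Suc n) f" by (simp add: s_Suc[OF fE])
    also have "\<dots> \<le> s n f" using it_mono[OF fE, of n] m_pos[OF fE]
      by (simp add: s_def divide_right_mono del: branch_iter.simps)
    finally have "it \<rho> (Suc n) f / m f * (\<Sum>g\<in>N f \<inter> C. Q f g * s n g) / V n \<le> s n f / V n"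
      using V(1)[of n] by (intro divide_right_mono) auto
    then show ?thesis by (simp add: u_def sum_divide_distrib[symmetric] del: branch_iter.simps)
  qed
  obtain r v where r: "strict_mono r" and v: "\<And>f. f \<in> C \<Longrightarrow> (\<lambda>n. u (r n) f) \<longlonglongrightarrow> v f"
  proof (rule finite_convergent_subseq[OF finC, of u])
    fix f assume "f \<in> C"
    then show "bounded (range (\<lambda>n. u n f))"
      using u by (intro boundedI[of _ 1]) (auto simp: less_imp_le abs_of_pos)
  qed auto
  have v_nonneg: "0 \<le> v f" if "f \<in> C" for f
    using LIMSEQ_le_const[OF v[OF that]] u(1)[OF that] by (meson less_imp_le)
  have v_super: "(\<Sum>g\<in>N f \<inter> C. Q f g * v g) \<le> v f" if f: "f \<in> C" for f
  proof -
    have fE: "f \<in> E" using f CE by auto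
    have "(\<lambda>n. it \<rho> (Suc (r n)) f / m f) \<longlonglongrightarrow> m f / m f"
      using LIMSEQ_subseq_LIMSEQ[OF LIMSEQ_Suc[OF it_tendsto[OF fE]] r] m_pos[OF fE]
      by (intro tendsto_divide tendsto_const) (auto simp: o_def)
    then have "(\<lambda>n. it \<rho> (Suc (r n)) f / m f * (\<Sum>g\<in>N f \<inter> C. Q f g * u (r n) g))
        \<longlonglongrightarrow> m f / m f * (\<Sum>g\<in>N f \<inter> C. Q f g * v g)"
      by (intro tendsto_mult tendsto_sum tendsto_const v) auto
    then have "m f / m f * (\<Sum>g\<in>N f \<inter> C. Q f g * v g) \<le> v f"
      by (rule LIMSEQ_le[OF _ v[OF f]]) (use u_super[OF f] in blast)
    then show ?thesis using m_pos[OF fE] by simp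
  qed
  have "(\<lambda>n. \<Sum>f\<in>C. u (r n) f) \<longlonglongrightarrow> (\<Sum>f\<in>C. v f)" by (intro tendsto_sum v)
  moreover have "1 \<le> (\<Sum>f\<in>C. u n f)" for n
  proof -
    obtain f where f: "f \<in> C" "s n f = V n" using V(3) by blast
    then have "1 = u n f" using V(1)[of n] by (simp add: u_def)
    also have "\<dots> \<le> (\<Sum>f\<in>C. u n f)" using f finC u(1) by (intro member_le_sum) (auto simp: less_imp_le)
    finally show ?thesis .
  qed
  ultimately have "1 \<le> (\<Sum>f\<in>C. v f)" by (meson LIMSEQ_le_const)
  then obtain k where k: "k \<in> C" "0 < v k"
    by (metis not_one_le_zero sum_nonpos linorder_not_le order_trans)
  have v_pos: "0 < v f" if f: "f \<in> C" for f
  proof -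
    have "(f, k) \<in> R\<^sup>*" using scc_reach f k by (auto simp: C_def)
    then show ?thesis using f
    proof (induction rule: converse_rtrancl_induct)
      case base
      then show ?case using k by simp
    next
      case (step f g)
      have gC: "g \<in> C" using step scc_between[of f f0 g k] k by (auto simp: C_def)
      have gN: "g \<in> N f \<inter> C" using step gC by (auto simp: R_def)
      have fE: "f \<in> E" using step.prems CE by auto
      have "0 < Q f g * v g" using step.IH[OF gC] Q_pos fE gC CE by auto
      also have "\<dots> \<le> (\<Sum>g\<in>N f \<inter> C. Q f g * v g)"
        using gN finite_N[OF fE] v_nonneg Q_pos fE CE
        by (intro member_le_sum) (auto simp: less_imp_le subset_iff)
      finally show ?case using v_super[OF step.prems] by linarith
    qed
  qed
  show ?thesis by (rule that[of v]) (use v_pos v_super C_def in auto)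
qed


section \<open>Holomorphic branch functions\<close>

lemma Im_D_ge:
  assumes "\<And>g. g \<in> E \<Longrightarrow> Im (h g) \<le> 0" "f \<in> E"
  shows "Im z \<le> Im (D z h f)"
proof -
  have "0 \<le> (\<Sum>g\<in>N f. \<alpha> g * (- Im (h g)))"
    using assms N_E \<alpha>_pos by (intro sum_nonneg mult_nonneg_nonneg) (auto simp: less_imp_le)
  then show ?thesis by (simp add: branch_denom_def sum_negf)
qed

lemma it_Im_nonpos: "0 < Im z \<Longrightarrow> f \<in> E \<Longrightarrow> Im (it z n f) \<le> 0"
proof (induction n arbitrary: f)
  case (Suc n)
  have "Im z \<le> Im (D z (it z n) f)" using Suc by (intro Im_D_ge) auto
  then have "0 \<le> Im (D z (it z n) f)" using Suc.prems by linarith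
  then show ?case by (simp add: complex_inverse divide_nonpos_nonneg)
qed simp

lemma Im_D_it: "0 < Im z \<Longrightarrow> f \<in> E \<Longrightarrow> Im z \<le> Im (D z (it z n) f)"
  by (intro Im_D_ge it_Im_nonpos)

lemma D_it_nonzero: "0 < Im z \<Longrightarrow> f \<in> E \<Longrightarrow> D z (it z n) f \<noteq> 0"
  using Im_D_it[of z f n] by auto

lemma norm_it_le: assumes z: "0 < Im z" and f: "f \<in> E" shows "cmod (it z n f) \<le> 1 / Im z"
proof (cases n)
  case 0
  then show ?thesis using z by simp
next
  case (Suc k)
  have "Im z \<le> cmod (D z (it z k) f)"
    using Im_D_it[OF z f, of k] abs_Im_le_cmod[of "D z (it z k) f"] by linarith
  then show ?thesis using z Suc by (simp add: norm_inverse norm_divide inverse_eq_divide frac_le)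
qed

lemma it_holomorphic: "f \<in> E \<Longrightarrow> (\<lambda>z. it z n f) holomorphic_on {z. 0 < Im z}"
proof (induction n arbitrary: f)
  case (Suc n)
  have "(\<lambda>z. D z (it z n) f) holomorphic_on {z. 0 < Im z}"
    unfolding branch_denom_def using Suc.IH N_E[OF Suc.prems] by (intro holomorphic_intros) auto
  then show ?case using D_it_nonzero[OF _ Suc.prems] by (auto intro!: holomorphic_intros)
qed simp

lemma Re_D_ge:
  assumes z: "\<rho> \<le> Re z" and h: "\<And>g. g \<in> E \<Longrightarrow> cmod (h g) \<le> k g" and f: "f \<in> E"
  shows "D \<rho> k f \<le> Re (D z h f)"
proof -
  have "(\<Sum>g\<in>N f. \<alpha> g * Re (h g)) \<le> (\<Sum>g\<in>N f. \<alpha> g * k g)"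
  proof (intro sum_mono mult_left_mono)
    fix g assume "g \<in> N f"
    then have g: "g \<in> E" using N_E f by auto
    show "Re (h g) \<le> k g" using h[OF g] complex_Re_le_cmod[of "h g"] by linarith
    show "0 \<le> \<alpha> g" using \<alpha>_pos[OF g] by simp
  qed
  then show ?thesis using z by (simp add: branch_denom_def)
qed

text \<open>
The Green's functions of truncated branches are power series in \<open>1 / (z - \<beta>)\<close> with
nonnegative coefficients, so on the right of \<open>\<rho>\<close> they are dominated by their values at \<open>\<rho>\<close>.
The proof only needs that the real part of the denominator dominates the denominator at \<open>\<rho>\<close>.
\<close>

lemma norm_it_le_it: "\<rho> \<le> Re z \<Longrightarrow> f \<in> E \<Longrightarrow> cmod (it z n f) \<le> it \<rho> n f"
proof (induction n arbitrary: f)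
  case (Suc n)
  have "D \<rho> (it \<rho> n) f \<le> Re (D z (it z n) f)" using Suc by (intro Re_D_ge) auto
  then have "D \<rho> (it \<rho> n) f \<le> cmod (D z (it z n) f)"
    using complex_Re_le_cmod order_trans by blast
  then show ?case using denom_pos[OF Suc.prems(2), of n] by (simp add: norm_inverse le_imp_inverse_le)
qed simp

lemma Re_D_it: "\<rho> \<le> Re z \<Longrightarrow> f \<in> E \<Longrightarrow> D \<rho> (it \<rho> n) f \<le> Re (D z (it z n) f)"
  by (intro Re_D_ge norm_it_le_it)

lemma D_it_nonzero_Re: "\<rho> \<le> Re z \<Longrightarrow> f \<in> E \<Longrightarrow> D z (it z n) f \<noteq> 0"
  using Re_D_it[of z f n] denom_pos[of f n] by auto

text \<open>
The real increments are a summable majorant of the complex ones, as in the Weierstrass M-test;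
this gives convergence on the closed half-plane \<open>Re z \<ge> \<rho>\<close> uniformly up to the point \<open>\<rho>\<close>.
\<close>

lemma it_increment_bound:
  assumes z: "\<rho> \<le> Re z"
  shows "f \<in> E \<Longrightarrow> cmod (it z (Suc n) f - it z n f) \<le> it \<rho> (Suc n) f - it \<rho> n f"
proof (induction n arbitrary: f)
  case 0
  then show ?case using norm_it_le_it[OF z, of f "Suc 0"] by simp
next
  case (Suc n)
  have inv_diff: "inverse x - inverse y = inverse x * inverse y * (y - x)"
    if "x \<noteq> 0" "y \<noteq> 0" for x y :: "'b::field" using that by (simp add: field_simps)
  have eq: "it z (Suc (Suc n)) f - it z (Suc n) f =
      it z (Suc (Suc n)) f * it z (Suc n) f * (\<Sum>g\<in>N f. of_real (\<alpha> g) * (it z (Suc n) g - it z n g))"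
    using inv_diff[OF D_it_nonzero_Re[OF z Suc.prems, of "Suc n"] D_it_nonzero_Re[OF z Suc.prems, of n]]
    by (simp add: denom_diff)
  have eq': "it \<rho> (Suc (Suc n)) f - it \<rho> (Suc n) f =
      it \<rho> (Suc (Suc n)) f * it \<rho> (Suc n) f * (\<Sum>g\<in>N f. \<alpha> g * (it \<rho> (Suc n) g - it \<rho> n g))"
    using inv_diff[of "D \<rho> (it \<rho> (Suc n)) f" "D \<rho> (it \<rho> n) f"]
      denom_pos[OF Suc.prems, of "Suc n"] denom_pos[OF Suc.prems, of n]
    by (simp add: denom_diff)
  have "cmod (\<Sum>g\<in>N f. of_real (\<alpha> g) * (it z (Suc n) g - it z n g))
      \<le> (\<Sum>g\<in>N f. \<alpha> g * (it \<rho> (Suc n) g - it \<rho> n g))"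
  proof (intro sum_norm_le)
    fix g assume g: "g \<in> N f"
    then have "g \<in> E" using N_E Suc.prems by auto
    then show "cmod (of_real (\<alpha> g) * (it z (Suc n) g - it z n g)) \<le> \<alpha> g * (it \<rho> (Suc n) g - it \<rho> n g)"
      using Suc.IH \<alpha>_pos by (simp add: norm_mult abs_of_pos mult_left_mono del: branch_iter.simps)
  qed
  then show ?case unfolding eq eq' norm_mult
    by (intro mult_mono norm_it_le_it[OF z Suc.prems] mult_nonneg_nonneg it_nonneg[OF Suc.prems]) auto
qed

lemma it_increments_bound:
  assumes "\<rho> \<le> Re z" "f \<in> E" "n \<le> k"
  shows "cmod (it z k f - it z n f) \<le> it \<rho> k f - it \<rho> n f"
  using assms(3)
proof (induction k rule: dec_induct)
  case (step k)
  have "cmod (it z (Suc k) f - it z n f) \<le> cmod (it z (Suc k) f - it z k f) + cmod (it z k f - it z n f)"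
    by (metis norm_triangle_ineq add_diff_eq diff_add_cancel)
  then show ?case using step.IH it_increment_bound[OF assms(1,2), of k] by linarith
qed simp

lemma it_continuous: "f \<in> E \<Longrightarrow> continuous_on {z. \<rho> \<le> Re z} (\<lambda>z::complex. it z n f)"
proof (induction n arbitrary: f)
  case (Suc n)
  have "continuous_on {z. \<rho> \<le> Re z} (\<lambda>z. D z (it z n) f)"
    unfolding branch_denom_def using Suc.IH N_E[OF Suc.prems] by (intro continuous_intros) auto
  then show ?case using D_it_nonzero_Re[OF _ Suc.prems] by (auto intro!: continuous_intros)
qed simp

lemma it_of_real: "it (complex_of_real x) n f = complex_of_real (it x n f)"
  by (induction n arbitrary: f) (simp_all add: branch_denom_def)

text \<open>
The properties of the Green's functions of the branches that matter: a solution of the recursion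
on the upper half-plane with the right sign and size, and with limit \<open>m\<close> when \<open>\<rho>\<close> is
approached from the quadrant on its right.
\<close>

definition branch_solution :: "('e \<Rightarrow> complex \<Rightarrow> complex) \<Rightarrow> bool" where
  "branch_solution h \<longleftrightarrow> (\<forall>f\<in>E. h f holomorphic_on {z. 0 < Im z} \<and>
     (\<forall>z. 0 < Im z \<longrightarrow> h f z * D z (\<lambda>g. h g z) f = 1 \<and> Im (h f z) < 0 \<and> cmod (h f z) \<le> 1 / Im z) \<and>
     ((h f) \<longlongrightarrow> complex_of_real (m f)) (at (complex_of_real \<rho>) within {z. \<rho> \<le> Re z \<and> 0 < Im z}))"

text \<open>
By Montel's theorem a subsequence of the iterates converges on the upper half-plane. A
subsequential limit need not satisfy the recursion, but on the right of \<open>\<rho>\<close> the full sequence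
converges, so there it does, and the identity theorem carries the equation over to the whole
half-plane.
\<close>

lemma branch_solution_exists: obtains h where "branch_solution h"
proof -
  define U where "U = {z. 0 < Im z}"
  have openU: "open U" by (simp add: U_def open_halfspace_Im_gt)
  define P where "P f r \<longleftrightarrow> (\<exists>g. g holomorphic_on U \<and> (\<forall>z\<in>U. (\<lambda>n. it z (r n) f) \<longlonglongrightarrow> g z))" for f r
  have "\<exists>r :: nat \<Rightarrow> nat. strict_mono r \<and> (\<forall>f\<in>E. P f r)"
  proof (rule finite_common_subseq[OF finite_E])
    fix f and r :: "nat \<Rightarrow> nat" assume f: "f \<in> E" and "strict_mono r"
    show "\<exists>s :: nat \<Rightarrow> nat. strict_mono s \<and> P f (r \<circ> s)"
    proof (rule Montel[OF openU, of "range (\<lambda>n z. it z n f)" "\<lambda>n z. it z (r n) f"])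
      show "h holomorphic_on U" if "h \<in> range (\<lambda>n z. it z n f)" for h
        using that it_holomorphic[OF f] by (auto simp: U_def)
      show "\<exists>B. \<forall>h\<in>range (\<lambda>n z. it z n f). \<forall>z\<in>K. cmod (h z) \<le> B" if K: "compact K" "K \<subseteq> U" for K
      proof (cases "K = {}")
        case False
        obtain z0 where z0: "z0 \<in> K" "\<And>z. z \<in> K \<Longrightarrow> Im z0 \<le> Im z"
          using continuous_attains_inf[OF K(1) False, of Im] continuous_on_Im[OF continuous_on_id] by auto
        have "cmod (it z n f) \<le> 1 / Im z0" if "z \<in> K" for z n
        proof -
          have "0 < Im z0" "0 < Im z" using z0 that K by (auto simp: U_def)
          then have "1 / Im z \<le> 1 / Im z0" using z0(2)[OF that] by (simp add: frac_le)
          then show ?thesis using norm_it_le[OF \<open>0 < Im z\<close> f, of n] by linarith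
        qed
        then show ?thesis by blast
      qed auto
      show "range (\<lambda>n z. it z (r n) f) \<subseteq> range (\<lambda>n z. it z n f)" by auto
    next
      fix g and s :: "nat \<Rightarrow> nat"
      assume "g holomorphic_on U" "strict_mono s" "\<And>x. x \<in> U \<Longrightarrow> (\<lambda>n. it x (r (s n)) f) \<longlonglongrightarrow> g x"
      then show ?thesis by (auto simp: P_def intro!: exI[of _ s] exI[of _ g])
    qed
  next
    fix f r and s :: "nat \<Rightarrow> nat" assume "P f r" "strict_mono s"
    then obtain g where g: "g holomorphic_on U" "\<And>z. z \<in> U \<Longrightarrow> (\<lambda>n. it z (r n) f) \<longlonglongrightarrow> g z"
      by (auto simp: P_def)
    have "(\<lambda>n. it z ((r \<circ> s) n) f) \<longlonglongrightarrow> g z" if "z \<in> U" for z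
      using LIMSEQ_subseq_LIMSEQ[OF g(2)[OF that] \<open>strict_mono s\<close>] by (simp only: o_def)
    then show "P f (r \<circ> s)" unfolding P_def using g(1) by blast
  qed
  then obtain r :: "nat \<Rightarrow> nat" and h where r: "strict_mono r"
    and hol: "\<And>f. f \<in> E \<Longrightarrow> h f holomorphic_on U"
    and lim: "\<And>f z. f \<in> E \<Longrightarrow> z \<in> U \<Longrightarrow> (\<lambda>n. it z (r n) f) \<longlonglongrightarrow> h f z"
    unfolding P_def by metis
  have full: "(\<lambda>n. it z n f) \<longlonglongrightarrow> h f z" if f: "f \<in> E" and z: "z \<in> U" "\<rho> \<le> Re z" for f z
  proof -
    have cau: "Cauchy (\<lambda>n. it \<rho> n f)" using it_tendsto[OF f] LIMSEQ_imp_Cauchy by blast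
    have "Cauchy (\<lambda>n. it z n f)"
    proof (rule metric_CauchyI)
      fix e :: real assume "0 < e"
      then obtain M where M: "\<And>k n. k \<ge> M \<Longrightarrow> n \<ge> M \<Longrightarrow> dist (it \<rho> k f) (it \<rho> n f) < e"
        using metric_CauchyD[OF cau] by metis
      have "dist (it z k f) (it z n f) < e" if "k \<ge> M" "n \<ge> M" for k n
      proof -
        have main: "dist (it z k f) (it z n f) < e" if "k \<ge> M" "n \<ge> M" "n \<le> k" for k n
          using it_increments_bound[OF z(2) f that(3)] M[OF that(1,2)]
          by (auto simp: dist_norm)
        show ?thesis using main[of k n] main[of n k] that by (cases "n \<le> k") (auto simp: dist_commute)
      qed
      then show "\<exists>M. \<forall>k\<ge>M. \<forall>n\<ge>M. dist (it z k f) (it z n f) < e" by blast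
    qed
    then obtain L where L: "(\<lambda>n. it z n f) \<longlonglongrightarrow> L" by (meson Cauchy_convergent_iff convergent_def)
    have "L = h f z" using LIMSEQ_unique[OF LIMSEQ_subseq_LIMSEQ[OF L r]] lim[OF f z(1)] by (simp add: o_def)
    then show ?thesis using L by simp
  qed
  have fixed_right: "h f z * D z (\<lambda>g. h g z) f = 1" if f: "f \<in> E" and z: "z \<in> U" "\<rho> \<le> Re z" for f z
  proof (rule LIMSEQ_unique)
    have "(\<lambda>n. D z (it z n) f) \<longlonglongrightarrow> D z (\<lambda>g. h g z) f"
      unfolding branch_denom_def using N_E[OF f] by (intro tendsto_intros full z) auto
    then show "(\<lambda>n. it z (Suc n) f * D z (it z n) f) \<longlonglongrightarrow> h f z * D z (\<lambda>g. h g z) f"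
      by (intro tendsto_mult LIMSEQ_Suc[OF full[OF f z]])
    show "(\<lambda>n. it z (Suc n) f * D z (it z n) f) \<longlonglongrightarrow> 1"
      using D_it_nonzero_Re[OF z(2) f] by simp
  qed
  have fixed: "h f z * D z (\<lambda>g. h g z) f = 1" if f: "f \<in> E" and z: "z \<in> U" for f z
  proof -
    have hol': "(\<lambda>z. h f z * D z (\<lambda>g. h g z) f) holomorphic_on U"
      unfolding branch_denom_def using hol f N_E[OF f] by (intro holomorphic_intros) auto
    have "Complex (\<rho> + 1) 1 \<in> U \<inter> {z. \<rho> < Re z}" by (simp add: U_def)
    then have ne: "U \<inter> {z. \<rho> < Re z} \<noteq> {}" by blast
    have op: "open (U \<inter> {z. \<rho> < Re z})" using openU open_halfspace_Re_gt by blast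
    have con: "convex U" unfolding U_def by (rule convex_halfspace_Im_gt)
    show ?thesis
      by (rule analytic_continuation_open[where f = "\<lambda>z. h f z * D z (\<lambda>g. h g z) f" and g = "\<lambda>_. 1",
            OF op openU ne convex_connected[OF con] _ hol' _ _ z]) (use fixed_right[OF f] in auto)
  qed
  have Im_le: "Im (h f z) \<le> 0" if "f \<in> E" "z \<in> U" for f z
    using LIMSEQ_le_const2[OF tendsto_Im[OF lim[OF that]]] it_Im_nonpos that by (auto simp: U_def)
  have Im_less: "Im (h f z) < 0" if f: "f \<in> E" and z: "z \<in> U" for f z
  proof -
    have "0 \<le> (\<Sum>g\<in>N f. \<alpha> g * (- Im (h g z)))"
      using N_E[OF f] \<alpha>_pos Im_le z by (intro sum_nonneg mult_nonneg_nonneg) (auto simp: less_imp_le)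
    then have "0 < Im (D z (\<lambda>g. h g z) f)" using z by (simp add: U_def branch_denom_def sum_negf)
    moreover have "h f z = inverse (D z (\<lambda>g. h g z) f)"
      using fixed[OF f z] by (metis inverse_unique mult.commute)
    ultimately show ?thesis
      by (simp add: complex_inverse) (intro divide_pos_pos add_nonneg_pos, auto)
  qed
  have norm_le: "cmod (h f z) \<le> 1 / Im z" if "f \<in> E" "z \<in> U" for f z
    using LIMSEQ_le_const2[OF tendsto_norm[OF lim[OF that]]] norm_it_le that by (auto simp: U_def)
  have lim_rho: "((h f) \<longlongrightarrow> complex_of_real (m f)) (at (complex_of_real \<rho>) within {z. \<rho> \<le> Re z \<and> 0 < Im z})"
    if f: "f \<in> E" for f
  proof (rule tendstoI)
    fix e :: real assume e: "0 < e"
    have "\<forall>\<^sub>F n in sequentially. dist (it \<rho> n f) (m f) < e / 3"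
      using tendstoD[OF it_tendsto[OF f], of "e / 3"] e by simp
    then obtain n where n: "m f - it \<rho> n f < e / 3"
      using it_le_m[OF f] by (auto simp: eventually_sequentially dist_real_def)
    have "((\<lambda>z. it z n f) \<longlongrightarrow> it (complex_of_real \<rho>) n f) (at (complex_of_real \<rho>) within {z. \<rho> \<le> Re z})"
      using it_continuous[OF f, of n] by (simp add: continuous_on_def)
    then have "((\<lambda>z. it z n f) \<longlongrightarrow> complex_of_real (it \<rho> n f))
        (at (complex_of_real \<rho>) within {z. \<rho> \<le> Re z \<and> 0 < Im z})"
      unfolding it_of_real by (rule tendsto_within_subset) auto
    then have "\<forall>\<^sub>F z in at (complex_of_real \<rho>) within {z. \<rho> \<le> Re z \<and> 0 < Im z}.
        dist (it z n f) (complex_of_real (it \<rho> n f)) < e / 3"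
      using e by (intro tendstoD) auto
    moreover have "\<forall>\<^sub>F z in at (complex_of_real \<rho>) within {z. \<rho> \<le> Re z \<and> 0 < Im z}. \<rho> \<le> Re z \<and> 0 < Im z"
      by (simp add: eventually_at_filter)
    ultimately show "\<forall>\<^sub>F z in at (complex_of_real \<rho>) within {z. \<rho> \<le> Re z \<and> 0 < Im z}.
        dist (h f z) (complex_of_real (m f)) < e"
    proof eventually_elim
      case (elim z)
      have "cmod (h f z - it z n f) \<le> m f - it \<rho> n f"
      proof (rule LIMSEQ_le)
        show "(\<lambda>k. cmod (it z k f - it z n f)) \<longlonglongrightarrow> cmod (h f z - it z n f)"
          using full[OF f] elim by (intro tendsto_intros) (auto simp: U_def)
        show "(\<lambda>k. it \<rho> k f - it \<rho> n f) \<longlonglongrightarrow> m f - it \<rho> n f"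
          by (intro tendsto_intros it_tendsto[OF f])
        show "\<exists>M. \<forall>k\<ge>M. cmod (it z k f - it z n f) \<le> it \<rho> k f - it \<rho> n f"
          using it_increments_bound[of z f] elim f by blast
      qed
      then have "dist (h f z) (it z n f) < e / 3" using n by (simp add: dist_norm)
      moreover have "dist (complex_of_real (it \<rho> n f)) (complex_of_real (m f)) < e / 3"
        using n it_le_m[OF f, of n] by (simp add: dist_norm norm_of_real flip: of_real_diff)
      ultimately show ?case
        using elim dist_triangle[of "h f z" "complex_of_real (m f)" "it z n f"]
          dist_triangle[of "it z n f" "complex_of_real (m f)" "complex_of_real (it \<rho> n f)"]
        by linarith
    qed
  qed
  show ?thesis
    by (rule that[of h]) (use hol fixed Im_less norm_le lim_rho in \<open>auto simp: branch_solution_def U_def\<close>)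
qed


section \<open>Rigidity at the edge\<close>

text \<open>
The equation is imposed only on the support of \<open>s\<close>: a solution on one class, extended by \<open>0\<close> to
the arcs that lead into it, does not solve the equation on those arcs.
\<close>

definition zero_isolated :: "real \<Rightarrow> bool" where
  "zero_isolated \<epsilon> \<longleftrightarrow> (\<forall>s. (\<forall>g\<in>E. 0 \<le> s g \<and> s g < \<epsilon>) \<longrightarrow>
     (\<forall>g\<in>E. s g \<noteq> 0 \<longrightarrow> s g = (1 + s g) * (\<Sum>k\<in>N g. Q g k * s k)) \<longrightarrow> (\<forall>g\<in>E. s g = 0))"

text \<open>
Two positive solutions with the same support cannot be strictly ordered: at the arc where their
ratio \<open>\<kappa> < 1\<close> is largest, the concave function \<open>s / (1 + s)\<close> exceeds \<open>\<kappa>\<close> times its value at the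
larger solution, while the linear right-hand side does not. Hence each of the finitely many
possible supports allows only solutions that are not small.
\<close>

lemma real_solutions_isolated: obtains \<epsilon> where "0 < \<epsilon>" "zero_isolated \<epsilon>"
proof -
  define sol :: "'e set \<Rightarrow> ('e \<Rightarrow> real) \<Rightarrow> bool" where
    "sol B s \<longleftrightarrow> (\<forall>g\<in>E. 0 \<le> s g) \<and> (\<forall>g\<in>E. s g \<noteq> 0 \<longleftrightarrow> g \<in> B) \<and>
      (\<forall>g\<in>B. s g = (1 + s g) * (\<Sum>k\<in>N g. Q g k * s k))" for B s
  have "\<exists>\<epsilon>>0. \<forall>s. sol B s \<longrightarrow> (\<exists>f\<in>B. \<epsilon> \<le> s f)" if B: "B \<subseteq> E" "B \<noteq> {}" for B
  proof (cases "\<exists>s. sol B s")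
    case True
    then obtain t where t: "sol B t" by blast
    have finB: "finite B" using B finite_E finite_subset by blast
    have tpos: "0 < t f" if "f \<in> B" for f
      using t B that by (force simp: sol_def less_le)
    define \<epsilon> where "\<epsilon> = Min (t ` B)"
    have \<epsilon>: "0 < \<epsilon>" "\<And>f. f \<in> B \<Longrightarrow> \<epsilon> \<le> t f" using finB B tpos by (auto simp: \<epsilon>_def)
    have "\<exists>f\<in>B. \<epsilon> \<le> s f" if s: "sol B s" for s
    proof (rule ccontr)
      assume "\<not> (\<exists>f\<in>B. \<epsilon> \<le> s f)"
      then have small: "s f < t f" if "f \<in> B" for f using \<epsilon>(2)[OF that] that by force
      have spos: "0 < s f" if "f \<in> B" for f using s B that by (force simp: sol_def less_le)
      define \<kappa> where "\<kappa> = Max ((\<lambda>f. s f / t f) ` B)"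
      have "\<kappa> \<in> (\<lambda>f. s f / t f) ` B" unfolding \<kappa>_def using finB B by (intro Max_in) auto
      then obtain f where f: "f \<in> B" "\<kappa> = s f / t f" by auto
      have fE: "f \<in> E" using f B by auto
      have le: "s g \<le> \<kappa> * t g" if "g \<in> E" for g
      proof (cases "g \<in> B")
        case True
        then have "s g / t g \<le> \<kappa>" using finB by (auto simp: \<kappa>_def)
        then show ?thesis using tpos[OF True] by (simp add: divide_le_eq)
      next
        case False
        then have "s g = 0" "t g = 0" using s t that by (auto simp: sol_def)
        then show ?thesis by simp
      qed
      have "(\<Sum>k\<in>N f. Q f k * s k) \<le> (\<Sum>k\<in>N f. Q f k * (\<kappa> * t k))"
        using le N_E[OF fE] Q_pos[OF fE] by (intro sum_mono mult_left_mono) (auto simp: less_imp_le)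
      also have "\<dots> = \<kappa> * (\<Sum>k\<in>N f. Q f k * t k)" by (simp add: sum_distrib_left mult_ac)
      finally have sum_le: "(\<Sum>k\<in>N f. Q f k * s k) \<le> \<kappa> * (\<Sum>k\<in>N f. Q f k * t k)" .
      have "s f = (1 + s f) * (\<Sum>k\<in>N f. Q f k * s k)" "t f = (1 + t f) * (\<Sum>k\<in>N f. Q f k * t k)"
        using s t f by (auto simp: sol_def)
      then have eqs: "(\<Sum>k\<in>N f. Q f k * s k) = s f / (1 + s f)" "(\<Sum>k\<in>N f. Q f k * t k) = t f / (1 + t f)"
        using spos[OF f(1)] tpos[OF f(1)] by (simp_all add: field_simps)
      have "s f / (1 + s f) \<le> s f / (1 + t f)"
        using sum_le tpos[OF f(1)] unfolding eqs f(2) by simp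
      moreover have "s f / (1 + t f) < s f / (1 + s f)"
        using spos[OF f(1)] small[OF f(1)] by (simp add: divide_strict_left_mono)
      ultimately show False by linarith
    qed
    then show ?thesis using \<epsilon> by blast
  next
    case False
    then show ?thesis by (intro exI[of _ 1]) auto
  qed
  then obtain e where e: "\<And>B. B \<subseteq> E \<Longrightarrow> B \<noteq> {} \<Longrightarrow> 0 < e B \<and> (\<forall>s. sol B s \<longrightarrow> (\<exists>f\<in>B. e B \<le> s f))"
    by metis
  define \<epsilon> where "\<epsilon> = Min (insert 1 (e ` (Pow E - {{}})))"
  have fin: "finite (insert 1 (e ` (Pow E - {{}})))" using finite_E by simp
  have \<epsilon>_pos: "0 < \<epsilon>" unfolding \<epsilon>_def using fin e by (subst Min_gr_iff) auto
  have \<epsilon>_le: "\<epsilon> \<le> e B" if "B \<subseteq> E" "B \<noteq> {}" for B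
    unfolding \<epsilon>_def using fin that by (intro Min_le) auto
  have "zero_isolated \<epsilon>" unfolding zero_isolated_def
  proof (intro allI impI ballI)
    fix s f
    assume s: "\<forall>g\<in>E. 0 \<le> s g \<and> s g < \<epsilon>"
      and eq: "\<forall>g\<in>E. s g \<noteq> 0 \<longrightarrow> s g = (1 + s g) * (\<Sum>k\<in>N g. Q g k * s k)"
      and f: "f \<in> E"
    define B where "B = {g \<in> E. s g \<noteq> 0}"
    have "sol B s" using s eq by (auto simp: sol_def B_def)
    then have "B = {}" using e[of B] \<epsilon>_le[of B] s by (force simp: B_def)
    then show "s f = 0" using f by (auto simp: B_def)
  qed
  then show ?thesis using that \<epsilon>_pos by blast
qed

text \<open>
The image of the half-plane \<open>Im \<ge> t\<close> under inversion is a disc that touches the real line at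
\<open>0\<close>, written here without division so that it also makes sense at its boundary point \<open>0\<close>.
\<close>

lemma Im_inverse_disc:
  assumes "S \<noteq> 0" "t \<le> Im (inverse S)"
  shows "t * (cmod S)\<^sup>2 \<le> - Im S"
proof -
  have "Im (inverse S) = - Im S / (cmod S)\<^sup>2"
    by (simp add: complex_inverse cmod_power2)
  then have "Im (inverse S) * (cmod S)\<^sup>2 = - Im S" using assms(1) by (simp add: field_simps)
  then show ?thesis using mult_right_mono[OF assms(2), of "(cmod S)\<^sup>2"] by simp
qed

text \<open>
The proof goes through the strongly connected classes from the end of the walks backwards: on the
class of \<open>f0\<close> the solution may be assumed to vanish at all arcs that leave the class. With
\<open>S = s / v\<close> the equation becomes \<open>S f / (1 + s f) = (\<Sum>g. p f g * S g)\<close> with substochastic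
weights \<open>p\<close>. If no nonzero value is real, the harmonic mean argument applies to \<open>W = 1 / S\<close>. If
one is real, then all values on the class are, because imaginary parts of one sign cannot cancel;
a minimum principle makes them nonnegative, and then they vanish as \<open>0\<close> is isolated.
\<close>

lemma complex_solution_zero:
  assumes iso: "zero_isolated \<epsilon>"
    and eq: "\<And>f. f \<in> E \<Longrightarrow> s f = (1 + s f) * (\<Sum>g\<in>N f. of_real (Q f g) * s g)"
    and Im_le: "\<And>f. f \<in> E \<Longrightarrow> Im (s f) \<le> 0"
    and small: "\<And>f. f \<in> E \<Longrightarrow> cmod (s f) < \<epsilon>" "\<And>f. f \<in> E \<Longrightarrow> cmod (s f) < 1"
    and "0 < \<epsilon>" "f \<in> E"
  shows "s f = 0"
  using \<open>f \<in> E\<close>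
proof (induction "card (R\<^sup>* `` {f})" arbitrary: f rule: less_induct)
  case (less f0)
  define C where "C = scc f0"
  have CE: "C \<subseteq> E" using scc_subset[OF less.prems] by (simp add: C_def)
  then have finC: "finite C" using finite_E finite_subset by blast
  have down: "s g = 0" if "f \<in> C" "g \<in> N f" "g \<notin> C" for f g
  proof (rule less.hyps)
    have fE: "f \<in> E" using that CE by auto
    show gE: "g \<in> E" using that N_E fE by auto
    have f0g: "(f0, g) \<in> R\<^sup>*"
      using that fE by (auto simp: C_def scc_def R_def intro: rtrancl_into_rtrancl)
    have "R\<^sup>* `` {g} \<subset> R\<^sup>* `` {f0}"
    proof
      show "R\<^sup>* `` {g} \<subseteq> R\<^sup>* `` {f0}" using f0g by (auto intro: rtrancl_trans)
      have "f0 \<notin> R\<^sup>* `` {g}" using that f0g by (auto simp: C_def scc_def)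
      then show "R\<^sup>* `` {g} \<noteq> R\<^sup>* `` {f0}" by auto
    qed
    moreover have "finite (R\<^sup>* `` {f0})"
      by (rule finite_subset[OF _ finite_E]) (auto dest: R_reach_E[OF _ less.prems])
    ultimately show "card (R\<^sup>* `` {g}) < card (R\<^sup>* `` {f0})" by (rule psubset_card_mono[rotated])
  qed
  have nz: "1 + s f \<noteq> 0" if "f \<in> E" for f
    using small(2)[OF that] by (metis add_eq_0_iff norm_minus_cancel norm_one less_irrefl)
  obtain v where v: "\<And>f. f \<in> C \<Longrightarrow> 0 < v f"
    and v_super: "\<And>f. f \<in> C \<Longrightarrow> (\<Sum>g\<in>N f \<inter> C. Q f g * v g) \<le> v f"
    using scc_supersolution[OF less.prems] by (auto simp: C_def)
  define S where "S f = s f / of_real (v f)" for f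
  define p where "p f g = Q f g * v g / v f" for f g
  have p_pos: "0 < p f g" if "f \<in> C" "g \<in> C" for f g
    using that v Q_pos[of f g] CE by (auto simp: p_def intro!: divide_pos_pos mult_pos_pos)
  have p_sum: "(\<Sum>g\<in>N f \<inter> C. p f g) \<le> 1" if "f \<in> C" for f
    using v_super[OF that] v[OF that] by (simp add: p_def sum_divide_distrib[symmetric])
  have S_eq: "S f / (1 + s f) = (\<Sum>g\<in>N f \<inter> C. of_real (p f g) * S g)" if f: "f \<in> C" for f
  proof -
    have fE: "f \<in> E" using f CE by auto
    have "(\<Sum>g\<in>N f. of_real (Q f g) * s g) = (\<Sum>g\<in>N f \<inter> C. of_real (Q f g) * s g)"
      using down[OF f] finite_N[OF fE] by (intro sum.mono_neutral_right) auto
    also have "\<dots> = (\<Sum>g\<in>N f \<inter> C. of_real (v f) * (of_real (p f g) * S g))"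
      using v f by (intro sum.cong) (force simp: p_def S_def)+
    finally have "(\<Sum>g\<in>N f. of_real (Q f g) * s g) = of_real (v f) * (\<Sum>g\<in>N f \<inter> C. of_real (p f g) * S g)"
      by (simp add: sum_distrib_left)
    moreover have "s f / (1 + s f) = (\<Sum>g\<in>N f. of_real (Q f g) * s g)"
      using eq[OF fE] nz[OF fE] by (simp add: field_simps)
    ultimately have "s f / (1 + s f) = of_real (v f) * (\<Sum>g\<in>N f \<inter> C. of_real (p f g) * S g)" by simp
    moreover have "S f / (1 + s f) = s f / (1 + s f) / of_real (v f)" by (simp add: S_def)
    ultimately show ?thesis using v[OF f] by simp
  qed
  define A where "A = {g \<in> C. s g \<noteq> 0}"
  have "A = {}"
  proof (rule ccontr)
    assume ne: "A \<noteq> {}"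
    have finA: "finite A" using finC by (simp add: A_def)
    show False
    proof (cases "\<exists>g\<in>A. Im (s g) = 0")
      case False
      define W where "W g = inverse (S g)" for g
      have S0: "S g \<noteq> 0" if "g \<in> A" for g using that v by (force simp: A_def S_def)
      have ImS: "Im (S g) \<le> 0" if "g \<in> C" for g
        using that Im_le CE v[OF that] by (auto simp: S_def Im_divide_of_real divide_nonpos_pos)
      define t where "t = Min ((\<lambda>g. Im (W g)) ` A)"
      have t_in: "t \<in> (\<lambda>g. Im (W g)) ` A" unfolding t_def using finA ne by (intro Min_in) auto
      have t_le: "t \<le> Im (W g)" if "g \<in> A" for g unfolding t_def using finA that by (intro Min_le) auto
      have t_pos: "0 < t"
      proof -
        obtain g where g: "g \<in> A" "t = Im (W g)" using t_in by auto
        have "Im (S g) < 0"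
        proof -
          have "Im (s g) < 0" using g(1) False Im_le[of g] CE by (force simp: A_def)
          then show ?thesis using g(1) v[of g] by (simp add: A_def S_def Im_divide_of_real divide_neg_pos)
        qed
        then show ?thesis
          unfolding g(2) W_def by (simp add: complex_inverse) (intro divide_neg_pos add_nonneg_pos, auto)
      qed
      \<comment> \<open>Among the arcs that minimise the imaginary part, one with maximal real part is chosen.\<close>
      define A' where "A' = {g \<in> A. Im (W g) = t}"
      have "A' \<noteq> {}" "finite A'" using t_in finA by (auto simp: A'_def)
      then obtain f where f: "f \<in> A'" "\<And>g. g \<in> A' \<Longrightarrow> Re (W g) \<le> Re (W f)"
        using Max_in[of "(\<lambda>g. Re (W g)) ` A'"] Max_ge[of "(\<lambda>g. Re (W g)) ` A'"] by fastforce
      have fA: "f \<in> A" and fC: "f \<in> C" and Wf: "Im (W f) = t" using f(1) by (auto simp: A'_def A_def)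
      have fE: "f \<in> E" using fC CE by auto
      define Y where "Y = S f / (1 + s f)"
      have Y0: "Y \<noteq> 0" using S0[OF fA] nz[OF fE] by (simp add: Y_def)
      have inv_Y: "inverse Y = W f + of_real (v f)"
      proof -
        have "s f \<noteq> 0" using fA by (simp add: A_def)
        then show ?thesis using v[OF fC] by (simp add: Y_def W_def S_def field_simps)
      qed
      have tY: "t * (cmod Y)\<^sup>2 = - Im Y"
      proof -
        have "Im (inverse Y) = t" using inv_Y Wf by simp
        then have "- Im Y / (cmod Y)\<^sup>2 = t" by (simp add: complex_inverse cmod_power2)
        then show ?thesis using Y0 by (simp add: field_simps)
      qed
      have Y_eq: "Y = (\<Sum>g\<in>N f \<inter> C. of_real (p f g) * S g)" using S_eq[OF fC] by (simp add: Y_def)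
      have disc: "t * (cmod (S g))\<^sup>2 \<le> - Im (S g)" if "g \<in> C" for g
      proof (cases "g \<in> A")
        case True
        then show ?thesis using Im_inverse_disc[OF S0[OF True]] t_le by (simp add: W_def)
      next
        case False
        then show ?thesis using that by (simp add: A_def S_def)
      qed
      have "t * (\<Sum>g\<in>N f \<inter> C. p f g * (cmod (S g))\<^sup>2) = (\<Sum>g\<in>N f \<inter> C. p f g * (t * (cmod (S g))\<^sup>2))"
        by (simp add: sum_distrib_left mult_ac)
      also have "\<dots> \<le> (\<Sum>g\<in>N f \<inter> C. p f g * (- Im (S g)))"
        using disc p_pos[OF fC] by (intro sum_mono mult_left_mono) (auto simp: less_imp_le)
      also have "\<dots> = - Im Y" by (simp add: Y_eq sum_negf)
      finally have "t * (\<Sum>g\<in>N f \<inter> C. p f g * (cmod (S g))\<^sup>2) \<le> t * (cmod Y)\<^sup>2" using tY by simp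
      then have second_moment: "(\<Sum>g\<in>N f \<inter> C. p f g * (cmod (S g))\<^sup>2) \<le> (cmod Y)\<^sup>2" using t_pos by simp
      \<comment> \<open>With the mean \<open>Y\<close> on the boundary circle of the disc, the variance of the \<open>S g\<close> is zero.\<close>
      have expand: "(cmod (S g - Y))\<^sup>2 = (cmod (S g))\<^sup>2 + (cmod Y)\<^sup>2 - 2 * Re (S g * cnj Y)" for g
        by (simp only: cmod_power2) (simp add: power2_eq_square algebra_simps)
      have "(\<Sum>g\<in>N f \<inter> C. p f g * Re (S g * cnj Y)) = (\<Sum>g\<in>N f \<inter> C. Re (of_real (p f g) * S g * cnj Y))"
        by (intro sum.cong) (simp_all add: algebra_simps)
      also have "\<dots> = Re ((\<Sum>g\<in>N f \<inter> C. of_real (p f g) * S g) * cnj Y)"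
        by (simp only: sum_distrib_right Re_sum)
      also have "\<dots> = (cmod Y)\<^sup>2"
        by (simp only: Y_eq[symmetric] cmod_power2) (simp add: power2_eq_square)
      finally have cross: "(\<Sum>g\<in>N f \<inter> C. p f g * Re (S g * cnj Y)) = (cmod Y)\<^sup>2" .
      have "(\<Sum>g\<in>N f \<inter> C. p f g * (cmod (S g - Y))\<^sup>2)
          = (\<Sum>g\<in>N f \<inter> C. p f g * (cmod (S g))\<^sup>2) + (\<Sum>g\<in>N f \<inter> C. p f g) * (cmod Y)\<^sup>2
            - 2 * (\<Sum>g\<in>N f \<inter> C. p f g * Re (S g * cnj Y))"
        unfolding expand
        by (simp add: algebra_simps sum.distrib sum_subtractf sum_distrib_left sum_distrib_right del: times_complex.sel)
      also have "\<dots> \<le> (cmod Y)\<^sup>2 + 1 * (cmod Y)\<^sup>2 - 2 * (cmod Y)\<^sup>2"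
        unfolding cross using second_moment p_sum[OF fC] by (intro diff_right_mono add_mono mult_right_mono) auto
      finally have var: "(\<Sum>g\<in>N f \<inter> C. p f g * (cmod (S g - Y))\<^sup>2) \<le> 0" by simp
      have same: "S g = Y" if g: "g \<in> N f \<inter> C" for g
      proof -
        have "p f g * (cmod (S g - Y))\<^sup>2 \<le> (\<Sum>g\<in>N f \<inter> C. p f g * (cmod (S g - Y))\<^sup>2)"
          using g finC p_pos[OF fC] by (intro member_le_sum mult_nonneg_nonneg) (auto simp: less_imp_le)
        then have "p f g * (cmod (S g - Y))\<^sup>2 \<le> 0" using var by linarith
        then show ?thesis using p_pos[OF fC, of g] g by (simp add: mult_le_0_iff)
      qed
      have "N f \<inter> C \<noteq> {}" using Y0 Y_eq by auto
      then obtain g where g: "g \<in> N f \<inter> C" by blast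
      have Wg: "W g = W f + of_real (v f)" using inv_Y same[OF g] by (simp add: W_def)
      have "s g \<noteq> 0" using same[OF g] Y0 by (auto simp: S_def)
      then have "g \<in> A'" using g Wg Wf by (simp add: A'_def A_def)
      then show False using f(2)[of g] Wg v[OF fC] by simp
    next
      case True
      then obtain g0 where g0: "g0 \<in> C" "Im (s g0) = 0" by (auto simp: A_def)
      have Im_sum: "(\<Sum>k\<in>N g. Q g k * Im (s k)) = 0" if g: "g \<in> E" "Im (s g) = 0" for g
      proof -
        have "s g = of_real (Re (s g))" using g(2) by (simp add: complex_eq_iff)
        then have "s g / (1 + s g) = of_real (Re (s g) / (1 + Re (s g)))"
          by (metis of_real_1 of_real_add of_real_divide)
        moreover have "s g / (1 + s g) = (\<Sum>k\<in>N g. of_real (Q g k) * s k)"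
          using eq[OF g(1)] nz[OF g(1)] by (simp add: field_simps)
        ultimately have "Im (\<Sum>k\<in>N g. of_real (Q g k) * s k) = 0" by (metis Im_complex_of_real)
        then show ?thesis by simp
      qed
      have step: "Im (s k) = 0" if g: "g \<in> E" "Im (s g) = 0" and k: "k \<in> N g" for g k
      proof -
        have "(\<Sum>k\<in>N g. Q g k * (- Im (s k))) = 0" using Im_sum[OF g] by (simp add: sum_negf)
        moreover have "0 \<le> Q g k * (- Im (s k))" if "k \<in> N g" for k
          using that N_E[OF g(1)] Q_pos[OF g(1)] Im_le by (intro mult_nonneg_nonneg) (auto simp: less_imp_le)
        ultimately have "Q g k * (- Im (s k)) = 0"
          using sum_nonneg_eq_0_iff[OF finite_N[OF g(1)], of "\<lambda>k. Q g k * (- Im (s k))"] k by blast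
        then show ?thesis using Q_pos[OF g(1) N_E[OF g(1) k]] by simp
      qed
      have real: "Im (s g) = 0" if "g \<in> C" for g
      proof -
        have "(g0, g) \<in> R\<^sup>*" using scc_reach g0(1) that by (simp add: C_def)
        then show ?thesis
        proof (induction rule: rtrancl_induct)
          case base
          then show ?case using g0 by simp
        next
          case (step g k)
          then show ?case using \<open>\<And>k g. g \<in> E \<Longrightarrow> Im (s g) = 0 \<Longrightarrow> k \<in> N g \<Longrightarrow> Im (s k) = 0\<close>
            by (auto simp: R_def)
        qed
      qed
      have S_real: "S g = of_real (Re (S g))" "s g = of_real (Re (s g))" if "g \<in> C" for g
        using real[OF that] by (simp_all add: S_def complex_eq_iff Im_divide_of_real)
      have Re_eq: "Re (S f) / (1 + Re (s f)) = (\<Sum>g\<in>N f \<inter> C. p f g * Re (S g))" if f: "f \<in> C" for f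
      proof -
        have "complex_of_real (Re (S f) / (1 + Re (s f))) = S f / (1 + s f)"
          using S_real[OF f] by (metis of_real_1 of_real_add of_real_divide)
        also have "\<dots> = complex_of_real (\<Sum>g\<in>N f \<inter> C. p f g * Re (S g))"
          unfolding S_eq[OF f] of_real_sum of_real_mult using S_real by (intro sum.cong) auto
        finally show ?thesis by (simp only: of_real_eq_iff)
      qed
      have s_lt: "\<bar>Re (s g)\<bar> < \<epsilon>" "\<bar>Re (s g)\<bar> < 1" if "g \<in> C" for g
        using small[of g] abs_Re_le_cmod[of "s g"] that CE by (auto intro: le_less_trans)
      have nonneg: "0 \<le> Re (s g)" if g: "g \<in> C" for g
      proof -
        define \<mu> where "\<mu> = Min ((\<lambda>g. Re (S g)) ` C)"
        have "\<mu> \<in> (\<lambda>g. Re (S g)) ` C" unfolding \<mu>_def using finC g by (intro Min_in) auto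
        then obtain f where f: "f \<in> C" "\<mu> = Re (S f)" by auto
        have le: "\<mu> \<le> Re (S k)" if "k \<in> C" for k unfolding \<mu>_def using finC that by (intro Min_le) auto
        have "0 \<le> \<mu>"
        proof (rule ccontr)
          assume neg: "\<not> 0 \<le> \<mu>"
          have "\<mu> \<le> \<mu> * (\<Sum>g\<in>N f \<inter> C. p f g)" using p_sum[OF f(1)] neg by (simp add: mult_le_cancel_left1)
          also have "\<dots> \<le> (\<Sum>g\<in>N f \<inter> C. p f g * Re (S g))"
            unfolding sum_distrib_left using le p_pos[OF f(1)]
            by (intro sum_mono) (auto simp: mult.commute mult_left_mono less_imp_le)
          also have "\<dots> = \<mu> / (1 + Re (s f))" by (simp add: Re_eq[OF f(1)] f(2))
          \<comment> \<open>Division of a negative number by \<open>1 + Re (s f) < 1\<close> makes it strictly smaller.\<close>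
          finally have "\<mu> \<le> \<mu> / (1 + Re (s f))" .
          moreover have "Re (s f) < 0"
            using neg v[OF f(1)] by (simp add: f(2) S_def Re_divide_of_real zero_le_divide_iff not_le)
          ultimately show False using neg s_lt(2)[OF f(1)] by (simp add: le_divide_eq mult_le_cancel_left1 not_le)
        qed
        then have "0 \<le> Re (S g)" using le[OF g] by linarith
        then show ?thesis using v[OF g] by (simp add: S_def Re_divide_of_real zero_le_divide_iff)
      qed
      define \<sigma> where "\<sigma> g = (if g \<in> C then Re (s g) else 0)" for g
      have "\<forall>g\<in>E. 0 \<le> \<sigma> g \<and> \<sigma> g < \<epsilon>"
        using nonneg s_lt(1) \<open>0 < \<epsilon>\<close> by (auto simp: \<sigma>_def)
      moreover have "\<forall>g\<in>E. \<sigma> g \<noteq> 0 \<longrightarrow> \<sigma> g = (1 + \<sigma> g) * (\<Sum>k\<in>N g. Q g k * \<sigma> k)"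
      proof (intro ballI impI)
        fix g assume g: "g \<in> E" and nz': "\<sigma> g \<noteq> 0"
        then have gC: "g \<in> C" by (auto simp: \<sigma>_def split: if_splits)
        have "(\<Sum>k\<in>N g. Q g k * \<sigma> k) = (\<Sum>k\<in>N g \<inter> C. Q g k * Re (s k))"
          using finite_N[OF g] by (intro sum.mono_neutral_cong_right) (auto simp: \<sigma>_def)
        also have "\<dots> = v g * (\<Sum>k\<in>N g \<inter> C. p g k * Re (S k))"
          unfolding sum_distrib_left using v gC
          by (intro sum.cong) (force simp: p_def S_def Re_divide_of_real)+
        also have "\<dots> = v g * (Re (S g) / (1 + Re (s g)))" by (simp add: Re_eq[OF gC])
        also have "\<dots> = Re (s g) / (1 + Re (s g))" using v[OF gC] by (simp add: S_def Re_divide_of_real)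
        finally have "(\<Sum>k\<in>N g. Q g k * \<sigma> k) = Re (s g) / (1 + Re (s g))" .
        then show "\<sigma> g = (1 + \<sigma> g) * (\<Sum>k\<in>N g. Q g k * \<sigma> k)"
          using s_lt(2)[OF gC] gC by (simp add: \<sigma>_def)
      qed
      ultimately have zero: "\<sigma> g = 0" if "g \<in> E" for g
        using iso that unfolding zero_isolated_def by blast
      obtain g where "g \<in> A" using ne by blast
      then show False using zero[of g] real[of g] CE by (auto simp: A_def complex_eq_iff \<sigma>_def)
    qed
  qed
  then show "s f0 = 0" using self_scc[of f0] by (auto simp: A_def C_def)
qed


text \<open>
A direct limit argument along \<open>z \<rightarrow> \<rho>\<close> would have to exclude that \<open>h\<close> becomes unbounded.
Instead, rigidity is applied to points where the maximum of \<open>cmod s\<close> is exactly \<open>d\<close>: they cannot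
accumulate at \<open>\<rho>\<close>. Since the maximum is below \<open>d\<close> at points on the right of \<open>\<rho>\<close> and the
half-disc is connected, it is below \<open>d\<close> throughout.
\<close>

lemma branch_solution_tendsto:
  assumes h: "branch_solution h" and f: "f \<in> E"
  shows "((h f) \<longlongrightarrow> complex_of_real (m f)) (at (complex_of_real \<rho>) within {z. 0 < Im z})"
proof -
  define U where "U = {z. 0 < Im z}"
  have hol: "h f holomorphic_on U" if "f \<in> E" for f using h that by (simp add: branch_solution_def U_def)
  have fixed: "h f z * D z (\<lambda>g. h g z) f = 1" and Im_h: "Im (h f z) < 0" if "f \<in> E" "z \<in> U" for f z
    using h that by (auto simp: branch_solution_def U_def)
  have lim: "((h f) \<longlongrightarrow> complex_of_real (m f)) (at (complex_of_real \<rho>) within {z. \<rho> \<le> Re z \<and> 0 < Im z})"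
    if "f \<in> E" for f using h that by (simp add: branch_solution_def)
  define s where "s z f = h f z / of_real (m f) - 1" for z f
  have cont_s: "continuous_on U (\<lambda>z. s z f)" if "f \<in> E" for f
    unfolding s_def by (intro continuous_intros holomorphic_on_imp_continuous_on hol that) (use m_pos[OF that] in auto)
  have Im_s: "Im (s z f) \<le> 0" if "f \<in> E" "z \<in> U" for z f
    using Im_h[OF that] m_pos[OF that(1)] by (simp add: s_def Im_divide_of_real divide_nonpos_pos)
  have s_eq: "s z f = (1 + s z f) * ((\<Sum>g\<in>N f. of_real (Q f g) * s z g) - (z - of_real \<rho>) * of_real (m f))"
    if f: "f \<in> E" and z: "z \<in> U" for z f
  proof -
    have m0: "m g \<noteq> 0" if "g \<in> E" for g using m_pos[OF that] by simp
    have "(\<Sum>g\<in>N f. of_real (Q f g) * s z g) = (\<Sum>g\<in>N f. of_real (m f) * (of_real (\<alpha> g) * (h g z - of_real (m g))))"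
      using m0 N_E[OF f] by (intro sum.cong) (auto simp: Q_def s_def field_simps)
    also have "\<dots> = of_real (m f) * (D \<rho>c (\<lambda>g. of_real (m g)) f - D \<rho>c (\<lambda>g. h g z) f)" for \<rho>c
      by (simp add: denom_diff sum_distrib_left)
    finally have 1: "(\<Sum>g\<in>N f. of_real (Q f g) * s z g)
      = of_real (m f) * (D (of_real \<rho>) (\<lambda>g. of_real (m g)) f - D (of_real \<rho>) (\<lambda>g. h g z) f)" .
    have 2: "D (of_real \<rho>) (\<lambda>g. complex_of_real (m g)) f = of_real (D \<rho> m f)" by (simp add: branch_denom_def)
    have 3: "D (of_real \<rho>) (\<lambda>g. h g z) f = D z (\<lambda>g. h g z) f - (z - of_real \<rho>)" by (simp add: branch_denom_def)
    have mD: "complex_of_real (m f) * of_real (D \<rho> m f) = 1"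
      using m_fixed[OF f] by (metis of_real_1 of_real_mult)
    have "(\<Sum>g\<in>N f. of_real (Q f g) * s z g) - (z - of_real \<rho>) * of_real (m f)
        = 1 - of_real (m f) * D z (\<lambda>g. h g z) f"
      unfolding 1 2 3 using mD by (simp add: algebra_simps)
    moreover have "(1 + s z f) = h f z / of_real (m f)" by (simp add: s_def)
    moreover have "h f z / of_real (m f) * (1 - of_real (m f) * D z (\<lambda>g. h g z) f) = s z f"
      using fixed[OF f z] m0[OF f] by (simp add: s_def field_simps)
    ultimately show ?thesis by simp
  qed
  obtain \<epsilon> where \<epsilon>: "0 < \<epsilon>" and iso: "zero_isolated \<epsilon>"
    by (rule real_solutions_isolated) blast
  have barrier: "\<exists>\<delta>>0. \<forall>z\<in>U \<inter> ball (of_real \<rho>) \<delta>. (\<forall>f\<in>E. cmod (s z f) \<le> d) \<longrightarrow> (\<forall>f\<in>E. cmod (s z f) < d)"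
    if d: "0 < d" "d < \<epsilon>" "d < 1" for d
  proof (rule ccontr)
    assume contr: "\<not> ?thesis"
    have "\<exists>z. z \<in> U \<inter> ball (of_real \<rho>) (inverse (real (Suc n))) \<and> (\<forall>f\<in>E. cmod (s z f) \<le> d) \<and> (\<exists>f\<in>E. cmod (s z f) = d)" for n
    proof -
      have "0 < inverse (real (Suc n))" by simp
      then obtain z where z: "z \<in> U \<inter> ball (of_real \<rho>) (inverse (real (Suc n)))" "\<forall>f\<in>E. cmod (s z f) \<le> d"
          "\<not> (\<forall>f\<in>E. cmod (s z f) < d)"
        using contr by blast
      then have "\<exists>f\<in>E. cmod (s z f) = d" by force
      then show ?thesis using z by blast
    qed
    then obtain Z where Z: "\<And>n. Z n \<in> U" "\<And>n. dist (of_real \<rho>) (Z n) < inverse (real (Suc n))"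
        "\<And>n f. f \<in> E \<Longrightarrow> cmod (s (Z n) f) \<le> d" "\<And>n. \<exists>f\<in>E. cmod (s (Z n) f) = d"
      by (auto simp: mem_ball) metis
    have Z_lim: "Z \<longlonglongrightarrow> of_real \<rho>"
    proof (rule LIMSEQ_I)
      fix e :: real assume "0 < e"
      then obtain M where "inverse (real (Suc M)) < e" using reals_Archimedean by blast
      then have "norm (Z n - of_real \<rho>) < e" if "M \<le> n" for n
      proof -
        have "inverse (real (Suc n)) \<le> inverse (real (Suc M))" using that by simp
        then show ?thesis using Z(2)[of n] \<open>inverse (real (Suc M)) < e\<close>
            unfolding dist_norm norm_minus_commute[of "of_real \<rho>"] by linarith
      qed
      then show "\<exists>M. \<forall>n\<ge>M. norm (Z n - of_real \<rho>) < e" by blast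
    qed
    obtain r l where r: "strict_mono (r :: nat \<Rightarrow> nat)" and l: "\<And>f. f \<in> E \<Longrightarrow> (\<lambda>n. s (Z (r n)) f) \<longlonglongrightarrow> l f"
    proof (rule finite_convergent_subseq[OF finite_E, of "\<lambda>n f. s (Z n) f"])
      fix f assume "f \<in> E"
      then show "bounded (range (\<lambda>n. s (Z n) f))" using Z(3) by (intro boundedI[of _ d]) auto
    qed auto
    have Zr: "(\<lambda>n. Z (r n)) \<longlonglongrightarrow> of_real \<rho>" using LIMSEQ_subseq_LIMSEQ[OF Z_lim r] by (simp add: o_def)
    have l_le: "cmod (l f) \<le> d" if "f \<in> E" for f
      using LIMSEQ_le_const2[OF tendsto_norm[OF l[OF that]]] Z(3)[OF that] by blast
    have l_zero: "l f = 0" if "f \<in> E" for f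
    proof (rule complex_solution_zero[OF iso])
      show "l f = (1 + l f) * (\<Sum>g\<in>N f. of_real (Q f g) * l g)" if f: "f \<in> E" for f
      proof (rule LIMSEQ_unique[OF l[OF f]])
        have "(\<lambda>n. (1 + s (Z (r n)) f) * ((\<Sum>g\<in>N f. of_real (Q f g) * s (Z (r n)) g) - (Z (r n) - of_real \<rho>) * of_real (m f)))
            \<longlonglongrightarrow> (1 + l f) * ((\<Sum>g\<in>N f. of_real (Q f g) * l g) - (of_real \<rho> - of_real \<rho>) * of_real (m f))"
          using N_E[OF f] f by (intro tendsto_intros l Zr) auto
        then show "(\<lambda>n. s (Z (r n)) f) \<longlonglongrightarrow> (1 + l f) * (\<Sum>g\<in>N f. of_real (Q f g) * l g)"
          using s_eq[OF f Z(1)] by simp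
      qed
      show "Im (l f) \<le> 0" if f: "f \<in> E" for f
        using LIMSEQ_le_const2[OF tendsto_Im[OF l[OF f]]] Im_s[OF f Z(1)] by blast
      show "cmod (l f) < \<epsilon>" "cmod (l f) < 1" if f: "f \<in> E" for f using l_le[OF f] d by auto
    qed (use \<epsilon> that in auto)
    \<comment> \<open>The product keeps track of the fact that some arc attains \<open>d\<close>, without fixing the arc.\<close>
    have "(\<lambda>n. \<Prod>f\<in>E. (cmod (s (Z (r n)) f) - d)) \<longlonglongrightarrow> (\<Prod>f\<in>E. (cmod (l f) - d))"
      by (intro tendsto_intros l)
    moreover have "(\<Prod>f\<in>E. (cmod (s (Z (r n)) f) - d)) = 0" for n
      using Z(4)[of "r n"] finite_E by (auto simp: prod_zero_iff)
    ultimately have "(\<Prod>f\<in>E. (cmod (l f) - d)) = 0" by (simp add: LIMSEQ_const_iff)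
    then show False using l_zero d finite_E by auto
  qed
  have main: "\<exists>\<delta>>0. \<forall>z\<in>U \<inter> ball (of_real \<rho>) \<delta>. \<forall>f\<in>E. cmod (s z f) < d"
    if d: "0 < d" "d < \<epsilon>" "d < 1" for d
  proof -
    obtain \<delta> where \<delta>: "0 < \<delta>" and bar: "\<And>z. z \<in> U \<inter> ball (of_real \<rho>) \<delta> \<Longrightarrow>
        (\<And>f. f \<in> E \<Longrightarrow> cmod (s z f) \<le> d) \<Longrightarrow> (\<forall>f\<in>E. cmod (s z f) < d)"
      using barrier[OF d] by metis
    define X where "X = U \<inter> ball (complex_of_real \<rho>) \<delta>"
    have convX: "convex X" unfolding X_def U_def
      by (intro convex_Int convex_halfspace_Im_gt convex_ball)
    define A where "A = {z \<in> X. \<forall>f\<in>E. cmod (s z f) < d}"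
    have cont: "continuous_on X (\<lambda>z. cmod (s z f))" if "f \<in> E" for f
      by (rule continuous_on_norm[OF continuous_on_subset[OF cont_s[OF that]]]) (auto simp: X_def)
    have A_alt: "A = {z \<in> X. \<forall>f\<in>E. cmod (s z f) \<le> d}"
      unfolding A_def using bar by (auto simp: X_def intro: less_imp_le)
    have "\<forall>\<^sub>F z in at (complex_of_real \<rho>) within {z. \<rho> \<le> Re z \<and> 0 < Im z}. \<forall>f\<in>E. cmod (s z f) < d"
    proof (intro eventually_ball_finite[OF finite_E] ballI)
      fix f assume f: "f \<in> E"
      have "((\<lambda>z. s z f) \<longlongrightarrow> of_real (m f) / of_real (m f) - 1)
          (at (complex_of_real \<rho>) within {z. \<rho> \<le> Re z \<and> 0 < Im z})"
        unfolding s_def using m_pos[OF f] by (intro tendsto_intros lim f) auto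
      then have "((\<lambda>z. s z f) \<longlongrightarrow> 0) (at (complex_of_real \<rho>) within {z. \<rho> \<le> Re z \<and> 0 < Im z})"
        using m_pos[OF f] by simp
      from tendstoD[OF this d(1)]
      show "\<forall>\<^sub>F z in at (complex_of_real \<rho>) within {z. \<rho> \<le> Re z \<and> 0 < Im z}. cmod (s z f) < d" by simp
    qed
    then obtain \<eta> where \<eta>: "0 < \<eta>" "\<And>z. \<rho> \<le> Re z \<Longrightarrow> 0 < Im z \<Longrightarrow> dist z (of_real \<rho>) < \<eta> \<Longrightarrow> \<forall>f\<in>E. cmod (s z f) < d"
      unfolding eventually_at by force
    define z0 where "z0 = Complex \<rho> (min \<eta> \<delta> / 2)"
    have "dist z0 (of_real \<rho>) = min \<eta> \<delta> / 2"
      using \<eta>(1) \<delta> by (simp add: z0_def dist_norm cmod_def)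
    then have "z0 \<in> A" using \<eta> \<delta> by (auto simp: A_def X_def U_def dist_commute z0_def intro!: \<eta>(2))
    have "A = X"
    proof -
      have "openin (top_of_set X) A"
      proof -
        have "openin (top_of_set X) (\<Inter>f\<in>E. X \<inter> (\<lambda>z. cmod (s z f)) -` {..<d})"
        proof (rule openin_INT2[OF finite_E])
          show "E \<noteq> {}" using f by blast
          show "openin (top_of_set X) (X \<inter> (\<lambda>z. cmod (s z f)) -` {..<d})" if "f \<in> E" for f
            by (rule continuous_openin_preimage_gen[OF cont[OF that] open_lessThan])
        qed
        moreover have "A = (\<Inter>f\<in>E. X \<inter> (\<lambda>z. cmod (s z f)) -` {..<d})" using f by (auto simp: A_def)
        ultimately show ?thesis by simp
      qed
      moreover have "closedin (top_of_set X) A"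
      proof -
        have "closedin (top_of_set X) (\<Inter>f\<in>E. X \<inter> (\<lambda>z. cmod (s z f)) -` {..d})"
        proof (rule closedin_INT)
          show "E \<noteq> {}" using f by blast
          show "closedin (top_of_set X) (X \<inter> (\<lambda>z. cmod (s z f)) -` {..d})" if "f \<in> E" for f
            by (rule continuous_closedin_preimage[OF cont[OF that] closed_atMost])
        qed
        moreover have "A = (\<Inter>f\<in>E. X \<inter> (\<lambda>z. cmod (s z f)) -` {..d})" using f by (auto simp: A_alt)
        ultimately show ?thesis by simp
      qed
      ultimately show ?thesis using convex_connected[OF convX] \<open>z0 \<in> A\<close> unfolding connected_clopen by blast
    qed
    then show ?thesis using \<delta> by (auto simp: A_def X_def)
  qed
  have "((\<lambda>z. s z f) \<longlongrightarrow> 0) (at (complex_of_real \<rho>) within U)"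
  proof (rule tendstoI)
    fix e :: real assume "0 < e"
    define d where "d = min e (min \<epsilon> 1) / 2"
    have d: "0 < d" "d < \<epsilon>" "d < 1" "d < e" using \<open>0 < e\<close> \<epsilon> by (auto simp: d_def)
    obtain \<delta> where \<delta>: "0 < \<delta>" "\<forall>z\<in>U \<inter> ball (of_real \<rho>) \<delta>. \<forall>f\<in>E. cmod (s z f) < d"
      using main[OF d(1-3)] by blast
    have "dist (s z f) 0 < e" if "z \<in> U" "dist z (of_real \<rho>) < \<delta>" for z
      using \<delta>(2) that f d(4) by (force simp: dist_commute)
    then show "\<forall>\<^sub>F z in at (complex_of_real \<rho>) within U. dist (s z f) 0 < e"
      unfolding eventually_at using \<delta>(1) by blast
  qed
  then have "((\<lambda>z. of_real (m f) * (s z f + 1)) \<longlongrightarrow> of_real (m f) * (0 + 1)) (at (complex_of_real \<rho>) within U)"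
    by (intro tendsto_intros)
  moreover have "of_real (m f) * (s z f + 1) = h f z" for z
    using m_pos[OF f] by (simp add: s_def)
  ultimately show ?thesis by (simp add: U_def)
qed

end

section \<open>Stieltjes transforms\<close>

definition stieltjes :: "real measure \<Rightarrow> complex \<Rightarrow> complex" where
  "stieltjes M z = (\<integral>t. 1 / (z - of_real t) \<partial>M)"

lemma upper_minus_real_nonzero: "0 < Im z \<Longrightarrow> z - of_real t \<noteq> 0"
  by (auto simp: complex_eq_iff)

lemma norm_upper_minus_real: "0 < Im z \<Longrightarrow> Im z \<le> cmod (z - of_real t)"
  using abs_Im_le_cmod[of "z - of_real t"] by simp

lemma norm_resolvent_le: "0 < Im z \<Longrightarrow> cmod (1 / (z - of_real t)) \<le> 1 / Im z"
  using norm_upper_minus_real[of z t] by (simp add: norm_divide frac_le)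

lemma resolvent_measurable:
  assumes "sets M = sets (borel :: real measure)" "0 < Im z"
  shows "(\<lambda>t. 1 / (z - complex_of_real t)) \<in> borel_measurable M"
proof -
  have "(\<lambda>t. 1 / (z - complex_of_real t)) \<in> borel_measurable borel"
    using upper_minus_real_nonzero[OF assms(2)]
    by (intro borel_measurable_continuous_onI continuous_intros) auto
  then show ?thesis using measurable_cong_sets[OF assms(1) refl] by blast
qed

lemma resolvent_integrable:
  assumes "finite_measure M" "sets M = sets (borel :: real measure)" "0 < Im z"
  shows "integrable M (\<lambda>t. 1 / (z - complex_of_real t))"
  using norm_resolvent_le[OF assms(3)]
  by (intro finite_measure.integrable_const_bound[OF assms(1), of _ "1 / Im z"]
      resolvent_measurable assms AE_I2) auto

lemma stieltjes_holomorphic: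
  assumes M: "finite_measure M" "sets M = sets borel"
  shows "stieltjes M holomorphic_on {z. 0 < Im z}"
proof -
  interpret finite_measure M by (fact M)
  have "\<exists>d. (stieltjes M has_field_derivative d) (at z)" if z: "0 < Im z" for z
  proof -
    define \<eta> where "\<eta> = Im z"
    define q where "q w t = - (1 / (w - complex_of_real t)) * (1 / (z - complex_of_real t))" for w t
    have q_meas: "q w \<in> borel_measurable M" if "0 < Im w" for w
      unfolding q_def using resolvent_measurable[OF M(2)] that z by (intro borel_measurable_times borel_measurable_uminus) auto
    have q_le: "cmod (q w t) \<le> 2 / \<eta> * (1 / \<eta>)" if "\<eta> / 2 < Im w" for w t
    proof -
      have w: "0 < Im w" using that z by (simp add: \<eta>_def)
      have "1 / Im w \<le> 2 / \<eta>" using that z w by (simp add: \<eta>_def field_simps)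
      then have "cmod (1 / (w - complex_of_real t)) \<le> 2 / \<eta>"
        using norm_resolvent_le[OF w, of t] by linarith
      then show ?thesis unfolding q_def norm_mult norm_minus_cancel
        using norm_resolvent_le[OF z, of t] z by (intro mult_mono) (auto simp: \<eta>_def)
    qed
    have q_int: "integrable M (q w)" if "\<eta> / 2 < Im w" for w
      using q_le[OF that] that z by (intro integrable_const_bound[of _ "2 / \<eta> * (1 / \<eta>)"] q_meas AE_I2) (auto simp: \<eta>_def)
    have "((\<lambda>w. \<integral>t. q w t \<partial>M) \<longlongrightarrow> (\<integral>t. q z t \<partial>M)) (at z)"
    proof (rule tendstoI)
      fix e :: real assume e: "0 < e"
      define B where "B = 2 / \<eta> * (1 / \<eta>) * (1 / \<eta>) * measure M (space M)"
      have B: "0 \<le> B" using z by (simp add: B_def \<eta>_def)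
      have bnd: "dist (\<integral>t. q w t \<partial>M) (\<integral>t. q z t \<partial>M) \<le> dist w z * B" if w: "\<eta> / 2 < Im w" for w
      proof -
        have wpos: "0 < Im w" using w z by (simp add: \<eta>_def)
        have zz: "\<eta> / 2 < Im z" using z by (simp add: \<eta>_def)
        have diff: "q w t - q z t = - ((w - z) * (q w t * (1 / (z - of_real t))))" for t
        proof -
          have "- (1 / x) * (1 / y) - - (1 / y) * (1 / y) = - ((x - y) * (- (1 / x) * (1 / y) * (1 / y)))"
            if "x \<noteq> 0" "y \<noteq> 0" for x y :: complex using that by (simp add: field_simps)
          from this[OF upper_minus_real_nonzero[OF wpos, of t] upper_minus_real_nonzero[OF z, of t]]
          show ?thesis by (simp add: q_def)
        qed
        have le: "cmod (q w t - q z t) \<le> dist w z * (2 / \<eta> * (1 / \<eta>) * (1 / \<eta>))" for t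
          unfolding diff norm_minus_cancel norm_mult dist_norm
          using q_le[OF w, of t] norm_resolvent_le[OF z, of t] z
          by (intro mult_left_mono mult_mono) (auto simp: \<eta>_def)
        have "dist (\<integral>t. q w t \<partial>M) (\<integral>t. q z t \<partial>M) = cmod (\<integral>t. q w t - q z t \<partial>M)"
          using q_int[OF w] q_int[OF zz] by (simp add: dist_norm)
        also have "\<dots> \<le> (\<integral>t. cmod (q w t - q z t) \<partial>M)" by (rule integral_norm_bound)
        also have "\<dots> \<le> (\<integral>t. dist w z * (2 / \<eta> * (1 / \<eta>) * (1 / \<eta>)) \<partial>M)"
          using q_int[OF w] q_int[OF zz] le by (intro integral_mono) auto
        also have "\<dots> = dist w z * B" by (simp add: B_def)
        finally show ?thesis .
      qed
      have "\<forall>\<^sub>F w in at z. dist w z < min (\<eta> / 2) (e / (B + 1))"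
        unfolding eventually_at using z e B by (intro exI[of _ "min (\<eta> / 2) (e / (B + 1))"]) (auto simp: \<eta>_def)
      then show "\<forall>\<^sub>F w in at z. dist (\<integral>t. q w t \<partial>M) (\<integral>t. q z t \<partial>M) < e"
      proof eventually_elim
        case (elim w)
        have "\<bar>Im w - Im z\<bar> \<le> dist w z" using abs_Im_le_cmod[of "w - z"] by (simp add: dist_norm)
        moreover have "dist w z < \<eta> / 2" using elim by simp
        ultimately have w: "\<eta> / 2 < Im w" unfolding \<eta>_def by linarith
        have "dist w z * B \<le> dist w z * (B + 1)" by (intro mult_left_mono) auto
        also have "\<dots> < e" using elim B by (simp add: pos_less_divide_eq)
        finally show ?case using bnd[OF w] by linarith
      qed
    qed
    moreover have "\<forall>\<^sub>F w in at z. (\<integral>t. q w t \<partial>M) = (stieltjes M w - stieltjes M z) / (w - z)"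
    proof -
      have "\<forall>\<^sub>F w in at z. 0 < Im w \<and> w \<noteq> z"
        using eventually_at_in_open[of "{z. 0 < Im z}" z] open_halfspace_Im_gt[of 0] z by simp
      then show ?thesis
      proof eventually_elim
        case (elim w)
        then have w: "0 < Im w" "w \<noteq> z" by auto
        have "stieltjes M w - stieltjes M z = (\<integral>t. 1 / (w - complex_of_real t) - 1 / (z - complex_of_real t) \<partial>M)"
          using resolvent_integrable[OF M w(1)] resolvent_integrable[OF M z] by (simp add: stieltjes_def)
        also have "\<dots> = (\<integral>t. (w - z) * q w t \<partial>M)"
        proof (rule Bochner_Integration.integral_cong[OF refl])
          fix t
          show "1 / (w - complex_of_real t) - 1 / (z - complex_of_real t) = (w - z) * q w t"
          proof -
            have "1 / x - 1 / y = (x - y) * (- (1 / x) * (1 / y))"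
              if "x \<noteq> 0" "y \<noteq> 0" for x y :: complex using that by (simp add: field_simps)
            from this[OF upper_minus_real_nonzero[OF w(1), of t] upper_minus_real_nonzero[OF z, of t]]
            show ?thesis by (simp add: q_def)
          qed
        qed
        also have "\<dots> = (w - z) * (\<integral>t. q w t \<partial>M)" by simp
        finally show ?case using w(2) by simp
      qed
    qed
    ultimately have "((\<lambda>w. (stieltjes M w - stieltjes M z) / (w - z)) \<longlongrightarrow> (\<integral>t. q z t \<partial>M)) (at z)"
      by (rule Lim_transform_eventually)
    then show ?thesis by (auto simp: has_field_derivative_iff)
  qed
  then show ?thesis
    by (auto simp: holomorphic_on_def field_differentiable_def intro: has_field_derivative_at_within)
qed

text \<open>
After the first \<open>2 * j\<close> terms of the geometric series the remainder is controlled by the moment of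
order \<open>2 * j\<close>. Even orders are used because there the absolute moment is the moment itself.
\<close>

lemma stieltjes_moment_series:
  assumes M: "finite_measure M" "sets M = sets borel"
    and int: "\<And>k. integrable M (\<lambda>t. t ^ k)"
    and mom: "\<And>k. \<bar>\<integral>t. t ^ k \<partial>M\<bar> \<le> C ^ k"
    and C: "0 \<le> C" and z: "0 < Im z" "C < cmod z"
  shows "(\<lambda>k. complex_of_real (\<integral>t. t ^ k \<partial>M) / z ^ Suc k) sums stieltjes M z"
proof -
  interpret finite_measure M by (fact M)
  have z0: "z \<noteq> 0" using z(1) by auto
  define a where "a k = complex_of_real (\<integral>t. t ^ k \<partial>M) / z ^ Suc k" for k
  have intc: "integrable M (\<lambda>t. complex_of_real (t ^ k))" for k by (rule integrable_of_real[OF int])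
  have partial: "stieltjes M z - (\<Sum>k<n. a k) = (\<integral>t. (of_real t / z) ^ n * (1 / (z - of_real t)) \<partial>M)" for n
  proof -
    have a_int: "a k = (\<integral>t. complex_of_real (t ^ k) / z ^ Suc k \<partial>M)" for k
      by (simp add: a_def integral_complex_of_real del: of_real_power)
    have "stieltjes M z - (\<Sum>k<n. a k)
        = (\<integral>t. 1 / (z - of_real t) - (\<Sum>k<n. complex_of_real (t ^ k) / z ^ Suc k) \<partial>M)"
      unfolding a_int stieltjes_def using intc resolvent_integrable[OF M z(1)]
      by (subst Bochner_Integration.integral_diff) (auto simp: Bochner_Integration.integral_sum)
    also have "\<dots> = (\<integral>t. (of_real t / z) ^ n * (1 / (z - of_real t)) \<partial>M)"
    proof (rule Bochner_Integration.integral_cong[OF refl])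
      fix t
      have "(\<Sum>k<n. complex_of_real (t ^ k) / z ^ Suc k) = (\<Sum>k<n. (of_real t / z) ^ k) / z"
        by (simp add: sum_divide_distrib power_divide mult.commute)
      moreover have "(\<Sum>k<n. (of_real t / z) ^ k) * (1 - of_real t / z) = 1 - (of_real t / z) ^ n"
        by (metis one_diff_power_eq mult.commute)
      moreover have "X / z * (z - of_real t) = X * (1 - of_real t / z)" for X
        using z0 by (simp add: field_simps)
      ultimately have "(\<Sum>k<n. complex_of_real (t ^ k) / z ^ Suc k) * (z - of_real t) = 1 - (of_real t / z) ^ n"
        by simp
      then show "1 / (z - of_real t) - (\<Sum>k<n. complex_of_real (t ^ k) / z ^ Suc k)
          = (of_real t / z) ^ n * (1 / (z - of_real t))"
        using upper_minus_real_nonzero[OF z(1), of t] by (simp add: divide_simps)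
    qed
    finally show ?thesis .
  qed
  have even_bound: "cmod (stieltjes M z - (\<Sum>k<2*j. a k)) \<le> ((C / cmod z)\<^sup>2) ^ j * (1 / Im z)" for j
  proof -
    have le: "cmod ((of_real t / z) ^ (2*j) * (1 / (z - of_real t))) \<le> t ^ (2*j) * (1 / cmod z ^ (2*j) * (1 / Im z))" for t
    proof -
      have "cmod ((of_real t / z) ^ (2*j)) = t ^ (2*j) / cmod z ^ (2*j)"
        by (simp add: norm_power norm_divide power_divide power_even_abs)
      then have "cmod ((of_real t / z) ^ (2*j) * (1 / (z - of_real t)))
          = t ^ (2*j) / cmod z ^ (2*j) * cmod (1 / (z - of_real t))" by (simp only: norm_mult)
      also have "\<dots> \<le> t ^ (2*j) / cmod z ^ (2*j) * (1 / Im z)"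
        by (intro mult_left_mono norm_resolvent_le[OF z(1)] divide_nonneg_nonneg zero_le_even_power) auto
      finally show ?thesis by simp
    qed
    have meas: "(\<lambda>t. (of_real t / z) ^ (2*j) * (1 / (z - of_real t))) \<in> borel_measurable M"
    proof -
      have "(\<lambda>t::real. (of_real t / z) ^ (2*j) * (1 / (z - of_real t))) \<in> borel_measurable borel"
        using upper_minus_real_nonzero[OF z(1)] z0
        by (intro borel_measurable_continuous_onI continuous_intros) auto
      then show ?thesis using measurable_cong_sets[OF M(2) refl] by blast
    qed
    have int2: "integrable M (\<lambda>t. t ^ (2*j) * (1 / cmod z ^ (2*j) * (1 / Im z)))"
      by (intro integrable_mult_left int)
    have "cmod (stieltjes M z - (\<Sum>k<2*j. a k)) \<le> (\<integral>t. cmod ((of_real t / z) ^ (2*j) * (1 / (z - of_real t))) \<partial>M)"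
      unfolding partial by (rule integral_norm_bound)
    also have "\<dots> \<le> (\<integral>t. t ^ (2*j) * (1 / cmod z ^ (2*j) * (1 / Im z)) \<partial>M)"
    proof (rule integral_mono[OF _ int2])
      show "integrable M (\<lambda>t. cmod ((of_real t / z) ^ (2*j) * (1 / (z - of_real t))))"
        by (rule Bochner_Integration.integrable_bound[OF int2]) (use meas in auto, rule AE_I2, use order_trans[OF le abs_ge_self] in auto)
    qed (use le in auto)
    also have "\<dots> = (\<integral>t. t ^ (2*j) \<partial>M) * (1 / cmod z ^ (2*j) * (1 / Im z))" by simp
    also have "\<dots> \<le> C ^ (2*j) * (1 / cmod z ^ (2*j) * (1 / Im z))"
      using mom[of "2*j"] z(1) by (intro mult_right_mono) auto
    also have "\<dots> = ((C / cmod z)\<^sup>2) ^ j * (1 / Im z)" by (simp add: power_mult power_divide)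
    finally show ?thesis .
  qed
  have ratio: "0 \<le> C / cmod z" "C / cmod z < 1" using C z z0 by (auto simp: divide_less_eq)
  have "summable a"
  proof (rule summable_comparison_test[OF exI[of _ 0]])
    show "summable (\<lambda>k. (C / cmod z) ^ k * (1 / cmod z))"
      using ratio by (intro summable_mult2 summable_geometric) auto
    have "cmod (a k) \<le> (C / cmod z) ^ k * (1 / cmod z)" for k
      using mom[of k] z0 by (simp add: a_def norm_divide norm_mult norm_power power_divide divide_right_mono mult.commute)
    then show "\<forall>k\<ge>0. norm (a k) \<le> (C / cmod z) ^ k * (1 / cmod z)" by blast
  qed
  then have "(\<lambda>n. \<Sum>k<n. a k) \<longlonglongrightarrow> suminf a" by (rule summable_LIMSEQ)
  then have lim: "(\<lambda>j. \<Sum>k<2*j. a k) \<longlonglongrightarrow> suminf a"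
    using LIMSEQ_subseq_LIMSEQ[of "\<lambda>n. \<Sum>k<n. a k" _ "\<lambda>j. 2 * j"] by (simp add: o_def strict_mono_def)
  have "(C / cmod z)\<^sup>2 < 1" using ratio by (simp add: power_less_one_iff)
  then have "(\<lambda>j. ((C / cmod z)\<^sup>2) ^ j * (1 / Im z)) \<longlonglongrightarrow> 0 * (1 / Im z)"
    by (intro tendsto_mult_right LIMSEQ_power_zero) auto
  then have "(\<lambda>j. stieltjes M z - (\<Sum>k<2*j. a k)) \<longlonglongrightarrow> 0"
    by (intro Lim_null_comparison[OF always_eventually[OF allI[OF even_bound]]]) auto
  moreover have "(\<lambda>j. stieltjes M z - (\<Sum>k<2*j. a k)) \<longlonglongrightarrow> stieltjes M z - suminf a"
    by (intro tendsto_intros lim)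
  ultimately have "stieltjes M z = suminf a" using LIMSEQ_unique by fastforce
  then have "a sums stieltjes M z" using summable_sums[OF \<open>summable a\<close>] by simp
  then show ?thesis by (simp only: a_def[abs_def])
qed

text \<open>
The Poisson kernel at \<open>x + \<i> \<eta>\<close> is at least \<open>1 / (2 * \<eta>)\<close> on the interval.
\<close>

lemma interval_measure_le_Im_stieltjes:
  assumes M: "finite_measure M" "sets M = sets borel" and \<eta>: "0 < \<eta>"
  shows "measure M {x - \<eta>..x + \<eta>} \<le> 2 * \<eta> * (- Im (stieltjes M (Complex x \<eta>)))"
proof -
  interpret finite_measure M by (fact M)
  define z where "z = Complex x \<eta>"
  have z: "0 < Im z" using \<eta> by (simp add: z_def)
  have Im_eq: "- Im (1 / (z - complex_of_real t)) = \<eta> / ((x - t)\<^sup>2 + \<eta>\<^sup>2)" for t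
    by (simp add: z_def Im_divide power2_eq_square)
  have int: "integrable M (\<lambda>t. - Im (1 / (z - complex_of_real t)))"
    by (intro integrable_minus integrable_Im resolvent_integrable M z)
  have meas: "{x - \<eta>..x + \<eta>} \<in> sets M" using M(2) by simp
  have "measure M {x - \<eta>..x + \<eta>} = 2 * \<eta> * (\<integral>t. indicator {x - \<eta>..x + \<eta>} t * (1 / (2 * \<eta>)) \<partial>M)"
    using \<eta> meas by (simp add: Int_absorb1 sets.sets_into_space)
  also have "\<dots> \<le> 2 * \<eta> * (\<integral>t. - Im (1 / (z - complex_of_real t)) \<partial>M)"
  proof (intro mult_left_mono integral_mono)
    show "integrable M (\<lambda>t. indicator {x - \<eta>..x + \<eta>} t * (1 / (2 * \<eta>)))"
      using meas by (intro integrable_mult_left integrable_real_indicator) (auto simp: less_top[symmetric])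
    fix t
    show "indicator {x - \<eta>..x + \<eta>} t * (1 / (2 * \<eta>)) \<le> - Im (1 / (z - complex_of_real t))"
    proof (cases "t \<in> {x - \<eta>..x + \<eta>}")
      case True
      then have "\<bar>x - t\<bar> \<le> \<bar>\<eta>\<bar>" using \<eta> by (auto simp: abs_le_iff)
      then have "(x - t)\<^sup>2 \<le> \<eta>\<^sup>2" by (simp add: abs_le_square_iff)
      then have "\<eta> * ((x - t)\<^sup>2 + \<eta>\<^sup>2) \<le> \<eta> * (2 * \<eta>\<^sup>2)" using \<eta> by (intro mult_left_mono) auto
      moreover have "0 < (x - t)\<^sup>2 + \<eta>\<^sup>2" using \<eta> by (intro add_nonneg_pos) auto
      ultimately have "1 / (2 * \<eta>) \<le> \<eta> / ((x - t)\<^sup>2 + \<eta>\<^sup>2)"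
        using \<eta> by (simp add: divide_simps power2_eq_square mult_ac)
      then show ?thesis unfolding Im_eq using True by simp
    next
      case False
      then show ?thesis unfolding Im_eq using \<eta> by simp
    qed
  qed (use int \<eta> in auto)
  also have "(\<integral>t. - Im (1 / (z - complex_of_real t)) \<partial>M) = - Im (stieltjes M z)"
    using resolvent_integrable[OF M z] by (simp add: stieltjes_def integral_Im del: Im_divide)
  finally show ?thesis by (simp add: z_def)
qed

section \<open>Densities\<close>

text \<open>
An open set is the increasing union of the dyadic intervals of length \<open>1 / 2 ^ n\<close> whose closure it
contains; for fixed \<open>n\<close> these are disjoint, so the bound for intervals can be summed.
\<close>

lemma open_emeasure_le:
  fixes N :: "real measure"
  assumes N: "sets N = sets borel" and c: "0 \<le> c"
    and le: "\<And>a b. a < b \<Longrightarrow> {a..b} \<subseteq> V \<Longrightarrow> emeasure N {a..<b} \<le> ennreal (c * (b - a))"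
    and V: "open V"
  shows "emeasure N V \<le> ennreal c * emeasure lborel V"
proof -
  define a where "a n k = of_int k / (2::real) ^ n" for n :: nat and k
  define I where "I n k = {a n k..<a n (k + 1)}" for n k
  define K where "K n = {k. {a n k..a n (k + 1)} \<subseteq> V}" for n
  define W where "W n = (\<Union>k\<in>K n. I n k)" for n
  have a_less: "a n k < a n (k + 1)" for n k by (simp add: a_def divide_strict_right_mono)
  have len: "a n (k + 1) - a n k = 1 / 2 ^ n" for n k by (simp add: a_def field_simps)
  have I_floor: "x \<in> I n k \<longleftrightarrow> \<lfloor>x * 2 ^ n\<rfloor> = k" for x n k
    by (simp add: I_def a_def floor_eq_iff divide_le_eq less_divide_eq)
  have I_sets: "I n k \<in> sets borel" for n k by (simp add: I_def)
  have disj: "disjoint_family_on (I n) (K n)" for n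
    by (auto simp: disjoint_family_on_def I_floor)
  have sub: "W n \<subseteq> V" for n by (fastforce simp: W_def K_def I_def)
  have W_sets: "W n \<in> sets borel" for n unfolding W_def by (intro sets.countable_UN'') (auto simp: I_def)
  have W_le: "emeasure N (W n) \<le> ennreal c * emeasure lborel (W n)" for n
  proof -
    have "emeasure N (W n) = (\<integral>\<^sup>+k. emeasure N (I n k) \<partial>count_space (K n))"
      unfolding W_def by (rule emeasure_UN_countable) (use disj N I_sets in auto)
    also have "\<dots> \<le> (\<integral>\<^sup>+k. ennreal c * emeasure lborel (I n k) \<partial>count_space (K n))"
    proof (rule nn_integral_mono)
      fix k assume "k \<in> space (count_space (K n))"
      then have k: "{a n k..a n (k + 1)} \<subseteq> V" by (simp add: K_def)
      show "emeasure N (I n k) \<le> ennreal c * emeasure lborel (I n k)"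
        using le[OF a_less k] a_less[of n k] c by (simp add: I_def ennreal_mult'')
    qed
    also have "\<dots> = ennreal c * (\<integral>\<^sup>+k. emeasure lborel (I n k) \<partial>count_space (K n))"
      by (rule nn_integral_cmult) simp
    also have "(\<integral>\<^sup>+k. emeasure lborel (I n k) \<partial>count_space (K n)) = emeasure lborel (W n)"
      unfolding W_def by (rule emeasure_UN_countable[symmetric]) (use disj I_sets in auto)
    finally show ?thesis .
  qed
  have "incseq W"
  proof (rule incseq_SucI, rule subsetI)
    fix n x assume "x \<in> W n"
    then obtain k where k: "k \<in> K n" "x \<in> I n k" by (auto simp: W_def)
    define j where "j = \<lfloor>x * 2 ^ Suc n\<rfloor>"
    have xj: "x \<in> I (Suc n) j" by (simp add: I_floor j_def)
    have "2 * k \<le> j" using k(2) unfolding j_def by (simp add: I_floor le_floor_iff) (use k(2) I_floor in linarith)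
    moreover have "j < 2 * k + 2" using k(2) unfolding j_def by (simp add: I_floor floor_less_iff) (use k(2) I_floor in linarith)
    ultimately have "2 * k \<le> j" "j + 1 \<le> 2 * (k + 1)" by auto
    then have "real_of_int (2 * k) \<le> real_of_int j" "real_of_int (j + 1) \<le> real_of_int (2 * (k + 1))"
      by (simp_all only: of_int_le_iff)
    then have "2 * real_of_int k \<le> real_of_int j" "real_of_int j + 1 \<le> 2 * (real_of_int k + 1)"
      by simp_all
    then have "2 * real_of_int k / 2 ^ Suc n \<le> real_of_int j / 2 ^ Suc n"
        "(real_of_int j + 1) / 2 ^ Suc n \<le> 2 * (real_of_int k + 1) / 2 ^ Suc n"
      by (simp_all only: divide_right_mono zero_le_power zero_le_numeral)
    then have "a n k \<le> a (Suc n) j" "a (Suc n) (j + 1) \<le> a n (k + 1)"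
      using mult_divide_mult_cancel_left[of "2::real" "real_of_int k + 1" "2 ^ n"]
      by (simp_all add: a_def)
    then have "{a (Suc n) j..a (Suc n) (j + 1)} \<subseteq> {a n k..a n (k + 1)}" by auto
    then have "j \<in> K (Suc n)" using k(1) by (auto simp: K_def)
    then show "x \<in> W (Suc n)" using xj by (auto simp: W_def)
  qed
  moreover have "(\<Union>n. W n) = V"
  proof
    show "(\<Union>n. W n) \<subseteq> V" using sub by blast
    show "V \<subseteq> (\<Union>n. W n)"
    proof
      fix x assume "x \<in> V"
      then obtain e where e: "0 < e" "ball x e \<subseteq> V" using V open_contains_ball by blast
      obtain n where n: "(1 / 2) ^ n < e" using real_arch_pow_inv[OF e(1), of "1/2"] by auto
      define k where "k = \<lfloor>x * 2 ^ n\<rfloor>"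
      have xk: "x \<in> I n k" by (simp add: I_floor k_def)
      have "{a n k..a n (k + 1)} \<subseteq> ball x e"
        using xk len[of n k] n by (auto simp: I_def dist_real_def power_one_over abs_less_iff)
      then have "k \<in> K n" using e(2) by (auto simp: K_def)
      then show "x \<in> (\<Union>n. W n)" using xk by (auto simp: W_def)
    qed
  qed
  ultimately have "emeasure N V = (SUP n. emeasure N (W n))"
  proof -
    assume "incseq W" "(\<Union>n. W n) = V"
    moreover have "range W \<subseteq> sets N" using W_sets N by auto
    ultimately show ?thesis using SUP_emeasure_incseq[of W N] by simp
  qed
  also have "\<dots> \<le> ennreal c * emeasure lborel V"
  proof (rule SUP_least)
    fix n
    have "emeasure lborel (W n) \<le> emeasure lborel V" using sub V by (intro emeasure_mono) auto
    then show "emeasure N (W n) \<le> ennreal c * emeasure lborel V"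
      using W_le[of n] mult_left_mono[of "emeasure lborel (W n)" "emeasure lborel V" "ennreal c"] by (meson order_trans zero_le)
  qed
  finally show ?thesis .
qed

lemma borel_emeasure_le:
  fixes N :: "real measure"
  assumes N: "sets N = sets borel" and c: "0 < c" and U: "open U"
    and le: "\<And>a b. a < b \<Longrightarrow> {a..b} \<subseteq> U \<Longrightarrow> emeasure N {a..<b} \<le> ennreal (c * (b - a))"
    and A: "A \<in> sets borel" "A \<subseteq> U"
  shows "emeasure N A \<le> ennreal c * emeasure lborel A"
proof (rule ennreal_le_epsilon)
  fix e :: real assume e: "0 < e"
  obtain T where T: "open T" "A \<subseteq> T" "emeasure lborel (T - A) < ennreal (e / c)"
    using outer_regular_lborel[OF A(1), of "e / c"] e c by auto
  have "emeasure N A \<le> emeasure N (T \<inter> U)" using A T U N by (intro emeasure_mono) auto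
  also have "\<dots> \<le> ennreal c * emeasure lborel (T \<inter> U)"
    using c le T U by (intro open_emeasure_le[OF N]) auto
  also have "\<dots> \<le> ennreal c * emeasure lborel (A \<union> (T - A))"
    using A T by (intro mult_left_mono emeasure_mono) auto
  also have "emeasure lborel (A \<union> (T - A)) = emeasure lborel A + emeasure lborel (T - A)"
    using A T by (intro plus_emeasure[symmetric]) auto
  also have "ennreal c * (emeasure lborel A + emeasure lborel (T - A))
      \<le> ennreal c * (emeasure lborel A + ennreal (e / c))"
    using T(3) by (intro mult_left_mono add_left_mono) auto
  also have "\<dots> = ennreal c * emeasure lborel A + ennreal e"
    using c e by (simp add: distrib_left ennreal_mult[symmetric])
  finally show "emeasure N A \<le> ennreal c * emeasure lborel A + ennreal e" .
qed

text \<open>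
Near \<open>\<rho>\<close> the measure is at most \<open>c k * lborel\<close> with \<open>c k = 1 / (k + 1)\<close>, so the Radon-Nikodym
derivative is at most \<open>c k\<close> there up to a null set. Setting it to \<open>0\<close> on the union of these
null sets gives the representative with limit \<open>0\<close>.
\<close>

lemma vanishing_density:
  fixes M :: "real measure"
  assumes M: "sets M = sets borel"
    and small: "\<And>e. 0 < e \<Longrightarrow> \<exists>\<delta>>0. \<forall>a b. a < b \<longrightarrow> {a..b} \<subseteq> {\<rho> - \<delta><..<\<rho> + \<delta>} \<longrightarrow>
      emeasure M {a..b} \<le> ennreal (e * (b - a))"
  shows "\<exists>U. open U \<and> \<rho> \<in> U \<and> absolutely_continuous lborel (cut_measure M U) \<and>
    (\<exists>g :: real \<Rightarrow> ennreal. (AE x in lborel. RN_deriv lborel (cut_measure M U) x = g x) \<and> (g \<longlongrightarrow> 0) (at \<rho>))"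
proof -
  define c where "c k = 1 / real (Suc k)" for k
  have c_pos: "0 < c k" for k by (simp add: c_def)
  obtain \<delta> where \<delta>: "\<And>k. 0 < \<delta> k" "\<And>k a b. a < b \<Longrightarrow> {a..b} \<subseteq> {\<rho> - \<delta> k<..<\<rho> + \<delta> k} \<Longrightarrow>
      emeasure M {a..b} \<le> ennreal (c k * (b - a))"
    using small[OF c_pos] by metis
  define J where "J k = {\<rho> - \<delta> k<..<\<rho> + \<delta> k}" for k
  have J: "open (J k)" "\<rho> \<in> J k" for k using \<delta>(1)[of k] by (auto simp: J_def)
  have M_le: "emeasure M A \<le> ennreal (c k) * emeasure lborel A" if "A \<in> sets borel" "A \<subseteq> J k" for A k
  proof (rule borel_emeasure_le[OF M c_pos J(1) _ that])
    fix a b :: real assume "a < b" "{a..b} \<subseteq> J k"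
    moreover have "emeasure M {a..<b} \<le> emeasure M {a..b}" using M by (intro emeasure_mono) auto
    ultimately show "emeasure M {a..<b} \<le> ennreal (c k * (b - a))"
      using \<delta>(2)[of a b k] by (auto simp: J_def)
  qed
  define U where "U = J 0"
  define N where "N = cut_measure M U"
  have N_sets: "sets N = sets borel" by (simp add: N_def cut_measure_def M)
  have N_eq: "emeasure N A = emeasure M (U \<inter> A)" if "A \<in> sets borel" for A
    using that J(1) unfolding N_def cut_measure_def U_def
    by (subst emeasure_density) (auto simp: M nn_integral_indicator[symmetric] indicator_inter_arith measurable_cong_sets[OF M refl] simp del: nn_integral_indicator intro!: nn_integral_cong)
  have ac: "absolutely_continuous lborel N"
    unfolding absolutely_continuous_def
  proof
    fix A :: "real set" assume A: "A \<in> null_sets lborel"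
    then have "A \<in> sets borel" "emeasure lborel A = 0" by auto
    moreover have "emeasure lborel (U \<inter> A) = 0"
      using A J(1) by (intro emeasure_eq_0[OF _ \<open>emeasure lborel A = 0\<close>]) (auto simp: U_def)
    ultimately show "A \<in> null_sets N"
      using M_le[of "U \<inter> A" 0] J(1) N_sets N_eq by (auto simp: U_def)
  qed
  define R where "R = RN_deriv lborel N"
  have R_meas: "R \<in> borel_measurable lborel" by (simp add: R_def)
  have R_density: "density lborel R = N"
    unfolding R_def using ac N_sets by (intro sigma_finite_measure.density_RN_deriv sigma_finite_lborel) auto
  have null: "{x \<in> U \<inter> J k. ennreal (c k) < R x} \<in> null_sets lborel" for k
  proof -
    define B where "B = {x \<in> U \<inter> J k. ennreal (c k) < R x}"
    have B_sets: "B \<in> sets borel"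
    proof -
      have "B = (U \<inter> J k) \<inter> {x \<in> space lborel. ennreal (c k) < R x}" by (auto simp: B_def)
      moreover have "{x \<in> space lborel. ennreal (c k) < R x} \<in> sets lborel" using R_meas by measurable
      ultimately show ?thesis using J(1) by (auto simp: U_def)
    qed
    have B_fin: "emeasure lborel B < \<infinity>"
    proof -
      have "emeasure lborel B \<le> emeasure lborel (J k)" using J(1) by (intro emeasure_mono) (auto simp: B_def)
      also have "\<dots> < \<infinity>" using \<delta>(1)[of k] by (simp add: J_def)
      finally show ?thesis .
    qed
    have "(\<integral>\<^sup>+x. R x * indicator B x \<partial>lborel) = emeasure N B"
      using B_sets R_meas by (simp add: R_density[symmetric] emeasure_density)
    also have "\<dots> = emeasure M B" using N_eq[OF B_sets] by (auto simp: B_def intro!: arg_cong[of _ _ "emeasure M"])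
    also have "\<dots> \<le> ennreal (c k) * emeasure lborel B" by (rule M_le[OF B_sets]) (auto simp: B_def)
    finally have le: "(\<integral>\<^sup>+x. R x * indicator B x \<partial>lborel) \<le> (\<integral>\<^sup>+x. ennreal (c k) * indicator B x \<partial>lborel)"
      using B_sets by (simp add: nn_integral_cmult_indicator)
    have "AE x in lborel. R x * indicator B x \<le> ennreal (c k) * indicator B x"
    proof (rule ccontr)
      assume not_ae: "\<not> ?thesis"
      have "(\<integral>\<^sup>+x. ennreal (c k) * indicator B x \<partial>lborel) < (\<integral>\<^sup>+x. R x * indicator B x \<partial>lborel)"
      proof (rule nn_integral_less)
        show "(\<integral>\<^sup>+x. ennreal (c k) * indicator B x \<partial>lborel) \<noteq> \<infinity>"
          using B_sets B_fin by (simp add: nn_integral_cmult_indicator ennreal_mult_eq_top_iff)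
        show "AE x in lborel. ennreal (c k) * indicator B x \<le> R x * indicator B x"
          by (intro AE_I2) (auto simp: B_def indicator_def less_imp_le)
      qed (use B_sets R_meas not_ae in auto)
      then show False using le by simp
    qed
    then have "AE x in lborel. x \<notin> B" by eventually_elim (auto simp: B_def indicator_def split: if_splits)
    then show ?thesis using B_sets AE_iff_null_sets[of B lborel] by (simp add: B_def)
  qed
  define Z where "Z = (\<Union>k. {x \<in> U \<inter> J k. ennreal (c k) < R x})"
  have Z: "Z \<in> null_sets lborel" unfolding Z_def by (intro null_sets_UN null)
  define g where "g x = (if x \<in> Z then 0 else R x)" for x
  have "AE x in lborel. R x = g x"
    using AE_not_in[OF Z] by eventually_elim (simp add: g_def)
  moreover have "(g \<longlongrightarrow> 0) (at \<rho>)"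
  proof (rule order_tendstoI)
    fix e :: ennreal assume e: "0 < e"
    have "\<exists>k. ennreal (c k) < e"
    proof (cases e)
      case (real r)
      then have "0 < r" using e by (simp add: ennreal_less_zero_iff)
      then obtain k where "inverse (real (Suc k)) < r" using reals_Archimedean by blast
      then show ?thesis using real by (intro exI[of _ k]) (simp add: c_def inverse_eq_divide ennreal_less_iff)
    next
      case top
      then show ?thesis by (intro exI[of _ 0]) (simp add: less_top[symmetric])
    qed
    then obtain k where k: "ennreal (c k) < e" by blast
    have "\<forall>\<^sub>F x in at \<rho>. x \<in> U \<inter> J k"
      by (rule eventually_at_in_open') (use J in \<open>auto simp: U_def\<close>)
    then show "\<forall>\<^sub>F x in at \<rho>. g x < e"
    proof eventually_elim
      case (elim x)
      then show ?case using k e unfolding g_def Z_def by (auto simp: not_less intro: le_less_trans)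
    qed
  qed simp
  ultimately show ?thesis using ac J by (intro exI[of _ U]) (auto simp: N_def R_def U_def)
qed

lemma emeasure_density_of_states:
  assumes fin: "finite (verts G)" and \<mu>: "\<And>u. u \<in> verts G \<Longrightarrow> sets (\<mu> u) = sets borel"
    and A: "A \<in> sets borel"
  shows "emeasure (density_of_states G \<mu>) A = (\<Sum>u\<in>verts G. emeasure (\<mu> u) A) / of_nat (card (verts G))"
proof -
  have sa: "sigma_algebra UNIV (sets borel)" using sets.sigma_algebra_axioms[of borel] by simp
  have ca: "countably_additive (sets borel) (\<lambda>A. (\<Sum>u\<in>verts G. emeasure (\<mu> u) A) / of_nat (card (verts G)))"
    unfolding countably_additive_def
  proof (intro allI impI)
    fix A :: "nat \<Rightarrow> real set"
    assume A: "range A \<subseteq> sets borel" "disjoint_family A" "(\<Union>i. A i) \<in> sets borel"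
    have "(\<Sum>i. (\<Sum>u\<in>verts G. emeasure (\<mu> u) (A i)) / of_nat (card (verts G)))
        = (\<Sum>i. (\<Sum>u\<in>verts G. emeasure (\<mu> u) (A i))) / of_nat (card (verts G))"
      by (simp add: divide_ennreal_def)
    also have "(\<Sum>i. (\<Sum>u\<in>verts G. emeasure (\<mu> u) (A i))) = (\<Sum>u\<in>verts G. (\<Sum>i. emeasure (\<mu> u) (A i)))"
      by (rule suminf_sum) simp
    also have "\<dots> = (\<Sum>u\<in>verts G. emeasure (\<mu> u) (\<Union>i. A i))"
      using A \<mu> by (intro sum.cong suminf_emeasure) auto
    finally show "(\<Sum>i. (\<Sum>u\<in>verts G. emeasure (\<mu> u) (A i)) / of_nat (card (verts G)))
        = (\<Sum>u\<in>verts G. emeasure (\<mu> u) (\<Union>i. A i)) / of_nat (card (verts G))" .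
  qed
  show ?thesis unfolding density_of_states_def
    by (rule emeasure_measure_of_sigma[OF sa _ ca A]) (simp add: positive_def)
qed

lemma sets_density_of_states: "sets (density_of_states G \<mu>) = sets borel"
  by (simp add: density_of_states_def sets_measure_of_conv sigma_algebra.sigma_sets_eq[OF sets.sigma_algebra_axioms[of borel, simplified]])

section \<open>The universal cover seen from its vertices\<close>

locale periodic_tree = fin_digraph G + bidirected_digraph G arev
  for G :: "('v, 'e) pre_digraph" and arev :: "'e \<Rightarrow> 'e" +
  fixes a :: "'e \<Rightarrow> real" and b :: "'v \<Rightarrow> real" and v0 :: 'v
  assumes a_arev: "f \<in> arcs G \<Longrightarrow> a (arev f) = a f"
    and a_pos: "f \<in> arcs G \<Longrightarrow> 0 < a f"
    and v0: "v0 \<in> verts G"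
begin

abbreviation T :: "'e list set" where "T \<equiv> nb_walks G arev v0"

abbreviation \<pi> :: "'e list \<Rightarrow> 'v" where "\<pi> \<equiv> cover_map G v0"

abbreviation J :: "('e list \<Rightarrow> complex) \<Rightarrow> 'e list \<Rightarrow> complex" where "J \<equiv> cover_jacobi G arev v0 a b"

text \<open>
The neighbour of a walk \<open>w\<close> across the lift of the arc \<open>g\<close> out of its end vertex. In this way
the lifted edges at \<open>w\<close> correspond to the arcs of \<open>G\<close> at the end vertex, also for the edge back
to the root, and no choice of root is visible any more.
\<close>

definition step :: "'e list \<Rightarrow> 'e \<Rightarrow> 'e list" where
  "step w g = (if w \<noteq> [] \<and> g = arev (last w) then butlast w else w @ [g])"

definition nsucc :: "'e \<Rightarrow> 'e set" where
  "nsucc f = out_arcs G (head G f) - {arev f}"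

lemma \<pi>_simps [simp]: "\<pi> [] = v0" "\<pi> (p @ [f]) = head G f"
  by (simp_all add: cover_map_def awalk_verts_conv)

lemma T_Nil [simp]: "[] \<in> T"
  using v0 by (auto simp: nb_walks_def awalk_Nil_iff)

lemma T_snoc: "p @ [f] \<in> T \<longleftrightarrow> p \<in> T \<and> f \<in> out_arcs G (\<pi> p) \<and> (p = [] \<or> f \<noteq> arev (last p))"
proof -
  have "(\<exists>v. awalk v0 (p @ [f]) v) \<longleftrightarrow> (\<exists>v. awalk v0 p v) \<and> f \<in> out_arcs G (\<pi> p)"
  proof
    assume "\<exists>v. awalk v0 (p @ [f]) v"
    then obtain v where "awalk v0 p (\<pi> p)" "awalk (\<pi> p) [f] v" unfolding cover_map_def awalk_append_iff by blast
    then show "(\<exists>v. awalk v0 p v) \<and> f \<in> out_arcs G (\<pi> p)" by (auto simp: awalk_Cons_iff)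
  next
    assume "(\<exists>v. awalk v0 p v) \<and> f \<in> out_arcs G (\<pi> p)"
    then obtain v where v: "awalk v0 p v" "f \<in> arcs G" "tail G f = \<pi> p" by auto
    then have "\<pi> p = v" by (auto simp: cover_map_def)
    then show "\<exists>v. awalk v0 (p @ [f]) v"
      using v by (intro exI[of _ "head G f"]) (auto simp: awalk_Cons_iff awalk_Nil_iff cover_map_def)
  qed
  moreover have "successively (\<lambda>e f. f \<noteq> arev e) (p @ [f]) \<longleftrightarrow>
      successively (\<lambda>e f. f \<noteq> arev e) p \<and> (p = [] \<or> f \<noteq> arev (last p))"
    by (auto simp: successively_append_iff)
  ultimately show ?thesis unfolding nb_walks_def mem_Collect_eq by blast
qed

lemma \<pi>_verts: "w \<in> T \<Longrightarrow> \<pi> w \<in> verts G"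
  by (cases w rule: rev_cases) (auto simp: v0 T_snoc)

lemma step_props:
  assumes w: "w \<in> T" and g: "g \<in> out_arcs G (\<pi> w)"
  shows "step w g \<in> T" "\<pi> (step w g) = head G g" "step (step w g) (arev g) = w"
    "arev g \<in> out_arcs G (\<pi> (step w g))"
proof -
  have gA: "g \<in> arcs G" "tail G g = \<pi> w" using g by auto
  have all: "step w g \<in> T \<and> \<pi> (step w g) = head G g \<and> step (step w g) (arev g) = w"
  proof (cases "w \<noteq> [] \<and> g = arev (last w)")
    case True
    then obtain p e where pe: "w = p @ [e]" "g = arev e" by (metis append_butlast_last_id)
    have e: "p \<in> T" "e \<in> arcs G" "tail G e = \<pi> p" "p = [] \<or> e \<noteq> arev (last p)"
      using w by (auto simp: pe T_snoc)
    have "\<not> (p \<noteq> [] \<and> arev g = arev (last p))" using e(4) pe by simp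
    then have "step p (arev g) = w" unfolding step_def using pe by auto
    then show ?thesis using e by (simp add: step_def pe)
  next
    case False
    then have "step w g = w @ [g]" by (simp only: step_def if_False)
    then show ?thesis using w g False by (auto simp: T_snoc step_def)
  qed
  then show "step w g \<in> T" "\<pi> (step w g) = head G g" "step (step w g) (arev g) = w" by auto
  then show "arev g \<in> out_arcs G (\<pi> (step w g))" using gA by simp
qed

lemma step_inj: "inj_on (step w) S"
proof (rule inj_onI)
  fix x y assume eq: "step w x = step w y"
  have len: "length (step w g) = (if w \<noteq> [] \<and> g = arev (last w) then length w - 1 else Suc (length w))" for g
    by (simp add: step_def)
  show "x = y"
    using eq len[of x] len[of y] by (auto simp: step_def split: if_splits)
qed

lemma out_arcs_cover:
  assumes w: "w \<in> T"
  shows "out_arcs (universal_cover G arev v0) w = (\<lambda>g. (w, step w g)) ` out_arcs G (\<pi> w)"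
proof
  show "(\<lambda>g. (w, step w g)) ` out_arcs G (\<pi> w) \<subseteq> out_arcs (universal_cover G arev v0) w"
  proof
    fix x assume "x \<in> (\<lambda>g. (w, step w g)) ` out_arcs G (\<pi> w)"
    then obtain g where g: "g \<in> out_arcs G (\<pi> w)" "x = (w, step w g)" by auto
    have "\<exists>f. step w g = w @ [f] \<or> w = step w g @ [f]"
    proof (cases "w \<noteq> [] \<and> g = arev (last w)")
      case True
      then have "w = step w g @ [last w]" by (simp add: step_def)
      then show ?thesis by blast
    next
      case False
      then show ?thesis by (simp only: step_def if_False) blast
    qed
    then show "x \<in> out_arcs (universal_cover G arev v0) w"
      using w g step_props(1)[OF w g(1)] by (auto simp: universal_cover_def out_arcs_def)
  qed
  show "out_arcs (universal_cover G arev v0) w \<subseteq> (\<lambda>g. (w, step w g)) ` out_arcs G (\<pi> w)"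
  proof
    fix x assume "x \<in> out_arcs (universal_cover G arev v0) w"
    then obtain q f where q: "x = (w, q)" "q \<in> T" "q = w @ [f] \<or> w = q @ [f]"
      by (auto simp: universal_cover_def out_arcs_def)
    from q(3) show "x \<in> (\<lambda>g. (w, step w g)) ` out_arcs G (\<pi> w)"
    proof
      assume e: "q = w @ [f]"
      then have "f \<in> out_arcs G (\<pi> w)" "w = [] \<or> f \<noteq> arev (last w)" using q(2) by (auto simp: T_snoc)
      then show ?thesis using e q by (intro image_eqI[of _ _ f]) (auto simp: step_def)
    next
      assume e: "w = q @ [f]"
      then have "f \<in> arcs G" using w by (auto simp: T_snoc)
      then show ?thesis using e q by (intro image_eqI[of _ _ "arev f"]) (auto simp: step_def)
    qed
  qed
qed

lemma lift_weight_step: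
  assumes w: "w \<in> T" and g: "g \<in> out_arcs G (\<pi> w)"
  shows "lift_weight a (w, step w g) = a g"
proof (cases "w \<noteq> [] \<and> g = arev (last w)")
  case True
  then obtain p e where pe: "w = p @ [e]" "g = arev e" by (metis append_butlast_last_id)
  then have "e \<in> arcs G" using w by (auto simp: T_snoc)
  then show ?thesis using pe a_arev by (simp add: lift_weight_def step_def)
next
  case False
  then show ?thesis by (auto simp: lift_weight_def step_def)
qed

text \<open>
In terms of \<open>step\<close> the Jacobi matrix of the cover looks the same at every walk.
\<close>

lemma J_eq:
  assumes w: "w \<in> T"
  shows "J \<xi> w = of_real (b (\<pi> w)) * \<xi> w + (\<Sum>g\<in>out_arcs G (\<pi> w). of_real (a g) * \<xi> (step w g))"
proof -
  have head: "head (universal_cover G arev v0) = snd" by (simp add: universal_cover_def)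
  have "(\<Sum>f\<in>out_arcs (universal_cover G arev v0) w. complex_of_real (lift_weight a f) * \<xi> (snd f))
      = (\<Sum>g\<in>out_arcs G (\<pi> w). complex_of_real (lift_weight a (w, step w g)) * \<xi> (step w g))"
    unfolding out_arcs_cover[OF w]
    by (subst sum.reindex) (auto simp: inj_on_def dest: inj_onD[OF step_inj[of w UNIV]])
  also have "\<dots> = (\<Sum>g\<in>out_arcs G (\<pi> w). of_real (a g) * \<xi> (step w g))"
    using lift_weight_step[OF w] by (intro sum.cong) auto
  finally show ?thesis by (simp add: cover_jacobi_def jacobi_def head lift_potential_def)
qed

lemma J_outside:
  assumes w: "w \<notin> T"
  shows "J \<xi> w = of_real (b (\<pi> w)) * \<xi> w"
proof -
  have "out_arcs (universal_cover G arev v0) w = {}"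
    using w by (auto simp: universal_cover_def out_arcs_def)
  then show ?thesis by (simp add: cover_jacobi_def jacobi_def lift_potential_def)
qed

lemma out_arcs_subset: "out_arcs G u \<subseteq> arcs G" by auto

lemma out_arcs_split:
  assumes f: "f \<in> arcs G"
  shows "(\<Sum>g\<in>out_arcs G (head G f). F g) = F (arev f) + (\<Sum>g\<in>nsucc f. F g)"
  unfolding nsucc_def by (rule sum.remove[OF finite_out_arcs]) (use f in auto)

lemma finite_nsucc: "finite (nsucc f)" unfolding nsucc_def by (intro finite_Diff finite_out_arcs)

lemma nsucc_arcs: "g \<in> nsucc f \<Longrightarrow> g \<in> arcs G" by (auto simp: nsucc_def)

lemma nsucc_subset: "nsucc f \<subseteq> arcs G" by (auto simp: nsucc_def)

text \<open>
A crude bound for all absolute row sums of the Jacobi matrix. The summand \<open>1\<close> makes the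
potential shifted by this constant at least \<open>1\<close>.
\<close>

definition row_bound :: real where "row_bound = 1 + (\<Sum>u\<in>verts G. \<bar>b u\<bar>) + (\<Sum>g\<in>arcs G. a g)"

lemma row_bound_pos: "1 \<le> row_bound"
  using a_pos by (simp add: row_bound_def sum_nonneg less_imp_le add_nonneg_nonneg)

lemma row_bound_ge:
  assumes u: "u \<in> verts G" and S: "S \<subseteq> arcs G"
  shows "1 + \<bar>b u\<bar> + (\<Sum>g\<in>S. a g) \<le> row_bound"
proof -
  have "\<bar>b u\<bar> \<le> (\<Sum>u\<in>verts G. \<bar>b u\<bar>)" using u by (intro member_le_sum) auto
  moreover have "(\<Sum>g\<in>S. a g) \<le> (\<Sum>g\<in>arcs G. a g)"
    using S a_pos by (intro sum_mono2) (auto simp: less_imp_le)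
  ultimately show ?thesis by (simp add: row_bound_def)
qed

text \<open>
The edge from \<open>w\<close> to \<open>step w g\<close> leads away from \<open>r\<close> in the tree. A step towards the root
leads away from \<open>r\<close> iff \<open>w\<close> lies on the path from the root to \<open>r\<close>.
\<close>

definition away :: "'e list \<Rightarrow> 'e list \<Rightarrow> 'e \<Rightarrow> bool" where
  "away r w g \<longleftrightarrow> (if w \<noteq> [] \<and> g = arev (last w) then prefix w r else \<not> prefix (w @ [g]) r)"

lemma away_root: "away r r g"
  by (auto simp: away_def dest: prefix_length_le)

lemma away_not_root:
  assumes "away r w g" shows "step w g \<noteq> r"
proof
  assume e: "step w g = r"
  show False
  proof (cases "w \<noteq> [] \<and> g = arev (last w)")
    case True
    then have "prefix w (butlast w)" using assms e by (auto simp: away_def step_def)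
    then have "length w \<le> length w - 1" using prefix_length_le[of w "butlast w"] by (simp only: length_butlast)
    moreover have "0 < length w" using True by simp
    ultimately show False by linarith
  next
    case False
    then show False using assms e by (auto simp: away_def step_def split: if_splits)
  qed
qed

lemma away_step:
  assumes w: "w \<in> T" and g: "g \<in> out_arcs G (\<pi> w)" and aw: "away r w g" and g': "g' \<in> nsucc g"
  shows "away r (step w g) g'"
proof (cases "w \<noteq> [] \<and> g = arev (last w)")
  case True
  then obtain p e where pe: "w = p @ [e]" "g = arev e" by (metis append_butlast_last_id)
  have pre: "prefix (p @ [e]) r" using aw True pe by (simp add: away_def)
  have ne: "g' \<noteq> e" using g' pe by (auto simp: nsucc_def)
  have "step w g = p" using True pe by (simp add: step_def)
  moreover have "prefix p r" using pre by (meson append_prefixD)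
  moreover have "\<not> prefix (p @ [g']) r"
    using pre ne by (auto simp: prefix_def)
  ultimately show ?thesis by (auto simp: away_def)
next
  case False
  then have st: "step w g = w @ [g]" by (simp only: step_def if_False)
  have "\<not> prefix (w @ [g]) r" using aw False by (auto simp: away_def split: if_splits)
  then have "\<not> prefix ((w @ [g]) @ [g']) r" by (meson append_prefixD)
  then show ?thesis using g' st by (auto simp: away_def nsucc_def)
qed

lemma indicator_inner: 
  assumes "r \<in> T"
  shows "ell2_inner T (indicator {r}) \<xi> = \<xi> r"
proof -
  have "ell2_inner T (indicator {r}) \<xi> = (\<Sum>\<^sub>\<infinity>x\<in>{r}. cnj (indicator {r} x) * \<xi> x)"
    unfolding ell2_inner_def using assms by (intro infsum_cong_neutral) (auto simp: indicator_def)
  then show ?thesis by simp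
qed

lemma J_power_bound:
  "cmod ((J ^^ k) (indicator {r}) w) \<le> row_bound ^ k" if "w \<in> T"
  using that
proof (induction k arbitrary: w)
  case (Suc k)
  have "cmod ((J ^^ Suc k) (indicator {r}) w)
      \<le> \<bar>b (\<pi> w)\<bar> * row_bound ^ k + (\<Sum>g\<in>out_arcs G (\<pi> w). a g * row_bound ^ k)"
    unfolding funpow.simps o_def J_eq[OF Suc.prems]
  proof (intro norm_triangle_le add_mono sum_norm_le)
    show "cmod (of_real (b (\<pi> w)) * (J ^^ k) (indicator {r}) w) \<le> \<bar>b (\<pi> w)\<bar> * row_bound ^ k"
      using Suc by (simp add: norm_mult mult_left_mono)
    fix g assume g: "g \<in> out_arcs G (\<pi> w)"
    then show "cmod (of_real (a g) * (J ^^ k) (indicator {r}) (step w g)) \<le> a g * row_bound ^ k"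
      using Suc.IH[OF step_props(1)[OF Suc.prems g]] a_pos[of g] by (simp add: norm_mult mult_left_mono)
  qed
  also have "\<dots> = (\<bar>b (\<pi> w)\<bar> + (\<Sum>g\<in>out_arcs G (\<pi> w). a g)) * row_bound ^ k"
    by (simp add: sum_distrib_right distrib_right)
  also have "\<dots> \<le> row_bound * row_bound ^ k"
    using row_bound_ge[OF \<pi>_verts[OF Suc.prems] out_arcs_subset, of "\<pi> w"] row_bound_pos
    by (intro mult_right_mono) auto
  finally show ?case by simp
qed (simp add: indicator_def)

text \<open>
Far up in the half-plane the moment series defines a bounded solution \<open>\<psi>\<close> of
\<open>(z - J) \<psi> = \<delta>\<close> at \<open>r\<close>. Along edges that lead away from \<open>r\<close> the error
\<open>\<psi> (step w g) - a g * h g z * \<psi> w\<close> is a linear combination of the errors one step further, with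
coefficients of total size at most \<open>1 / 2\<close>; being bounded, it vanishes. The equation for \<open>\<psi>\<close> at \<open>r\<close>
is then the claim, and the identity theorem extends it to the half-plane.
\<close>

lemma stieltjes_eq:
  assumes r: "r \<in> T" and M: "is_spectral_measure T J r M"
    and h: "\<And>f z. f \<in> arcs G \<Longrightarrow> 0 < Im z \<Longrightarrow>
        h f z * (z - of_real (b (head G f)) - (\<Sum>g\<in>nsucc f. of_real ((a g)\<^sup>2) * h g z)) = 1"
    and h_le: "\<And>f z. f \<in> arcs G \<Longrightarrow> 0 < Im z \<Longrightarrow> cmod (h f z) \<le> 1 / Im z"
    and h_hol: "\<And>f. f \<in> arcs G \<Longrightarrow> h f holomorphic_on {z. 0 < Im z}"
    and z: "0 < Im z"
  shows "stieltjes M z * (z - of_real (b (\<pi> r)) - (\<Sum>g\<in>out_arcs G (\<pi> r). of_real ((a g)\<^sup>2) * h g z)) = 1"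
proof -
  have prob: "prob_space M" and sets_M: "sets M = sets borel"
    and int: "\<And>k. integrable M (\<lambda>x. x ^ k)"
    and mom: "\<And>k. complex_of_real (\<integral>x. x ^ k \<partial>M) = (J ^^ k) (indicator {r}) r"
    using M unfolding is_spectral_measure_def indicator_inner[OF r] by blast+
  have fin: "finite_measure M" using prob by (simp add: prob_space_def)
  define X where "X k = (J ^^ k) (indicator {r})" for k
  have X_le: "cmod (X k w) \<le> row_bound ^ k" if "w \<in> T" for k w
    using J_power_bound[OF that] by (simp add: X_def)
  have mom_le: "\<bar>\<integral>x. x ^ k \<partial>M\<bar> \<le> row_bound ^ k" for k
    using X_le[OF r, of k] mom[of k] by (metis X_def norm_of_real)
  define Gd where "Gd z = z - of_real (b (\<pi> r)) - (\<Sum>g\<in>out_arcs G (\<pi> r). of_real ((a g)\<^sup>2) * h g z)" for z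
  have high: "stieltjes M z * Gd z = 1" if z: "2 * row_bound < Im z" for z
  proof -
    have z_pos: "0 < Im z" using z row_bound_pos by linarith
    have z_big: "row_bound < cmod z" using z row_bound_pos abs_Im_le_cmod[of z] by linarith
    have z0: "z \<noteq> 0" using z_pos by auto
    define \<psi> where "\<psi> w = (\<Sum>k. X k w / z ^ Suc k)" for w
    define B where "B = (\<Sum>k. (row_bound / cmod z) ^ k * (1 / cmod z))"
    have B_sum: "summable (\<lambda>k. (row_bound / cmod z) ^ k * (1 / cmod z))"
      using z_big row_bound_pos by (intro summable_mult2 summable_geometric) (auto simp: divide_less_eq)
    have term_le: "cmod (X k w / z ^ Suc k) \<le> (row_bound / cmod z) ^ k * (1 / cmod z)" if "w \<in> T" for k w
      using X_le[OF that, of k] z0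
      by (simp add: norm_divide norm_mult norm_power power_divide divide_right_mono mult.commute)
    have sums: "(\<lambda>k. X k w / z ^ Suc k) sums \<psi> w" if "w \<in> T" for w
      unfolding \<psi>_def
      by (intro summable_sums summable_comparison_test[OF exI[of _ 0] B_sum]) (use term_le[OF that] in blast)
    have \<psi>_le: "cmod (\<psi> w) \<le> B" if "w \<in> T" for w
      unfolding \<psi>_def B_def by (rule norm_suminf_le[OF term_le[OF that] B_sum])
    have \<psi>_eq: "z * \<psi> w - of_real (b (\<pi> w)) * \<psi> w - (\<Sum>g\<in>out_arcs G (\<pi> w). of_real (a g) * \<psi> (step w g))
        = indicator {r} w" if w: "w \<in> T" for w
    proof -
      have "(\<lambda>k. of_real (b (\<pi> w)) * (X k w / z ^ Suc k)
            + (\<Sum>g\<in>out_arcs G (\<pi> w). of_real (a g) * (X k (step w g) / z ^ Suc k)))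
          sums (of_real (b (\<pi> w)) * \<psi> w + (\<Sum>g\<in>out_arcs G (\<pi> w). of_real (a g) * \<psi> (step w g)))"
        by (intro sums_add sums_mult sums_sum sums w step_props(1)[OF w]) auto
      moreover have "of_real (b (\<pi> w)) * (X k w / z ^ Suc k)
            + (\<Sum>g\<in>out_arcs G (\<pi> w). of_real (a g) * (X k (step w g) / z ^ Suc k)) = X (Suc k) w / z ^ Suc k" for k
        unfolding X_def funpow.simps o_def J_eq[OF w]
        by (simp add: add_divide_distrib sum_divide_distrib)
      ultimately have 1: "(\<lambda>k. X (Suc k) w / z ^ Suc k)
          sums (of_real (b (\<pi> w)) * \<psi> w + (\<Sum>g\<in>out_arcs G (\<pi> w). of_real (a g) * \<psi> (step w g)))"
        by simp
      have "(\<lambda>k. X (Suc k) w / z ^ Suc (Suc k)) sums (\<psi> w - X 0 w / z ^ Suc 0)"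
        using sums[OF w] by (subst sums_Suc_iff) simp
      from sums_mult[OF this, of z] have 2: "(\<lambda>k. X (Suc k) w / z ^ Suc k) sums (z * \<psi> w - X 0 w)"
        using z0 by (simp add: algebra_simps)
      have "X 0 w = indicator {r} w" by (simp add: X_def)
      then show ?thesis using sums_unique2[OF 1 2] by (simp add: algebra_simps)
    qed
    define err where "err w g = \<psi> (step w g) - of_real (a g) * h g z * \<psi> w" for w g
    \<comment> \<open>The equation for \<open>\<psi>\<close> at \<open>step w g\<close> is homogeneous, since that walk is not \<open>r\<close>.\<close>
    have err_eq: "err w g = h g z * (\<Sum>g'\<in>nsucc g. of_real (a g') * err (step w g) g')"
      if w: "w \<in> T" and g: "g \<in> out_arcs G (\<pi> w)" and aw: "away r w g" for w g
    proof -
      have gA: "g \<in> arcs G" using g by auto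
      note st = step_props[OF w g]
      have expand: "of_real (a g') * \<psi> (step (step w g) g')
          = of_real (a g') * err (step w g) g' + of_real ((a g')\<^sup>2) * h g' z * \<psi> (step w g)" for g'
        by (simp add: err_def power2_eq_square algebra_simps)
      have "(\<Sum>g'\<in>out_arcs G (\<pi> (step w g)). of_real (a g') * \<psi> (step (step w g) g'))
          = of_real (a g) * \<psi> w + (\<Sum>g'\<in>nsucc g. of_real (a g') * \<psi> (step (step w g) g'))"
        using out_arcs_split[OF gA, of "\<lambda>g'. of_real (a g') * \<psi> (step (step w g) g')"] st a_arev[OF gA] by simp
      also have "(\<Sum>g'\<in>nsucc g. of_real (a g') * \<psi> (step (step w g) g'))
          = (\<Sum>g'\<in>nsucc g. of_real (a g') * err (step w g) g')
            + (\<Sum>g'\<in>nsucc g. of_real ((a g')\<^sup>2) * h g' z) * \<psi> (step w g)"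
        unfolding expand by (simp add: sum.distrib sum_distrib_right)
      finally have "(z - of_real (b (head G g)) - (\<Sum>g'\<in>nsucc g. of_real ((a g')\<^sup>2) * h g' z)) * \<psi> (step w g)
          = of_real (a g) * \<psi> w + (\<Sum>g'\<in>nsucc g. of_real (a g') * err (step w g) g')"
        using \<psi>_eq[OF st(1)] away_not_root[OF aw] st(2) by (simp add: algebra_simps)
      then have "h g z * (z - of_real (b (head G g)) - (\<Sum>g'\<in>nsucc g. of_real ((a g')\<^sup>2) * h g' z)) * \<psi> (step w g)
          = h g z * (of_real (a g) * \<psi> w + (\<Sum>g'\<in>nsucc g. of_real (a g') * err (step w g) g'))"
        by (simp only: mult.assoc)
      then have \<psi>_step: "\<psi> (step w g) = h g z * (of_real (a g) * \<psi> w + (\<Sum>g'\<in>nsucc g. of_real (a g') * err (step w g) g'))"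
        unfolding h[OF gA z_pos] by simp
      have "err w g = \<psi> (step w g) - of_real (a g) * h g z * \<psi> w" by (simp only: err_def)
      also have "\<dots> = h g z * (\<Sum>g'\<in>nsucc g. of_real (a g') * err (step w g) g')"
        by (subst \<psi>_step) (simp only: algebra_simps add_diff_cancel_left')
      finally show ?thesis .
    qed
    have B_nonneg: "0 \<le> B" using \<psi>_le[OF r] norm_ge_zero[of "\<psi> r"] by linarith
    have err_le: "cmod (err w g) \<le> 2 * B / 2 ^ n"
      if w: "w \<in> T" and g: "g \<in> out_arcs G (\<pi> w)" and aw: "away r w g" for w g n
      using that
    proof (induction n arbitrary: w g)
      case 0
      have gA: "g \<in> arcs G" using 0 by auto
      have "a g \<le> row_bound" using row_bound_ge[of "head G g" "{g}"] gA by simp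
      have "a g * cmod (h g z) \<le> row_bound * (1 / Im z)"
        using h_le[OF gA z_pos] \<open>a g \<le> row_bound\<close> a_pos[OF gA] by (intro mult_mono) auto
      also have "\<dots> \<le> 1" using z z_pos row_bound_pos by (simp add: field_simps)
      finally have "a g * cmod (h g z) \<le> 1" .
      then have "a g * cmod (h g z) * cmod (\<psi> w) \<le> 1 * B"
        using \<psi>_le[OF 0(1)] a_pos[OF gA] by (intro mult_mono) auto
      then have "cmod (of_real (a g) * h g z * \<psi> w) \<le> B"
        using a_pos[OF gA] by (simp add: norm_mult)
      then show ?case unfolding err_def
        using \<psi>_le[OF step_props(1)[OF 0(1,2)]] norm_triangle_ineq4[of "\<psi> (step w g)" "of_real (a g) * h g z * \<psi> w"]
        by simp
    next
      case (Suc n)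
      have gA: "g \<in> arcs G" using Suc.prems by auto
      note st = step_props[OF Suc.prems(1,2)]
      have "cmod (\<Sum>g'\<in>nsucc g. of_real (a g') * err (step w g) g') \<le> (\<Sum>g'\<in>nsucc g. a g' * (2 * B / 2 ^ n))"
      proof (rule sum_norm_le)
        fix g' assume g': "g' \<in> nsucc g"
        then have "cmod (err (step w g) g') \<le> 2 * B / 2 ^ n"
          using Suc.IH[OF st(1) _ away_step[OF Suc.prems g']] st(2) by (simp add: nsucc_def)
        then show "cmod (of_real (a g') * err (step w g) g') \<le> a g' * (2 * B / 2 ^ n)"
          using a_pos[OF nsucc_arcs[OF g']] by (simp add: norm_mult mult_left_mono del: times_divide_eq_right)
      qed
      also have "\<dots> = (\<Sum>g'\<in>nsucc g. a g') * (2 * B / 2 ^ n)" by (simp only: sum_distrib_right)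
      also have "\<dots> \<le> row_bound * (2 * B / 2 ^ n)"
        using row_bound_ge[OF head_in_verts[OF gA], of "nsucc g"] nsucc_subset B_nonneg by (intro mult_right_mono) auto
      finally have "cmod (err w g) \<le> 1 / Im z * (row_bound * (2 * B / 2 ^ n))"
        unfolding err_eq[OF Suc.prems] norm_mult using h_le[OF gA z_pos] z_pos by (intro mult_mono) auto
      also have "\<dots> = row_bound / Im z * (2 * B / 2 ^ n)" by simp
      also have "\<dots> \<le> 1 / 2 * (2 * B / 2 ^ n)"
        using z z_pos B_nonneg by (intro mult_right_mono) (auto simp: field_simps)
      finally show ?case by simp
    qed
    have err_zero: "err r g = 0" if g: "g \<in> out_arcs G (\<pi> r)" for g
    proof -
      have "(\<lambda>n. 2 * B * (1 / 2) ^ n) \<longlonglongrightarrow> 2 * B * 0"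
        by (intro tendsto_mult tendsto_const LIMSEQ_power_zero) auto
      then have "(\<lambda>n. 2 * B / 2 ^ n) \<longlonglongrightarrow> 0" by (simp add: power_divide)
      then have "cmod (err r g) \<le> 0"
        by (rule LIMSEQ_le_const) (use err_le[OF r g away_root] in blast)
      then show ?thesis by simp
    qed
    have "(\<Sum>g\<in>out_arcs G (\<pi> r). of_real (a g) * \<psi> (step r g)) = (\<Sum>g\<in>out_arcs G (\<pi> r). of_real ((a g)\<^sup>2) * h g z * \<psi> r)"
      using err_zero by (intro sum.cong) (auto simp: err_def power2_eq_square)
    then have "Gd z * \<psi> r = 1"
      using \<psi>_eq[OF r] by (simp add: Gd_def algebra_simps sum_distrib_left)
    moreover have "\<psi> r = stieltjes M z"
    proof (rule sums_unique2[OF sums[OF r]])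
      show "(\<lambda>k. X k r / z ^ Suc k) sums stieltjes M z"
        using stieltjes_moment_series[OF fin sets_M int mom_le _ z_pos z_big] row_bound_pos
        by (simp add: mom[folded X_def])
    qed
    ultimately show ?thesis by (simp add: mult.commute)
  qed
  have hol: "(\<lambda>z. stieltjes M z * Gd z) holomorphic_on {z. 0 < Im z}"
    unfolding Gd_def by (intro holomorphic_intros stieltjes_holomorphic[OF fin sets_M] h_hol) auto
  have "Complex 0 (2 * row_bound + 1) \<in> {z. 2 * row_bound < Im z}" by simp
  then have ne: "{z. 2 * row_bound < Im z} \<noteq> {}" by blast
  have "stieltjes M z * Gd z = 1"
    by (rule analytic_continuation_open[where f = "\<lambda>z. stieltjes M z * Gd z" and g = "\<lambda>_. 1"
          and s = "{z. 2 * row_bound < Im z}" and s' = "{z. 0 < Im z}"])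
      (use hol ne high z row_bound_pos in \<open>auto intro!: open_halfspace_Im_gt convex_connected convex_halfspace_Im_gt\<close>)
  then show ?thesis by (simp add: Gd_def)
qed


section \<open>The top of the spectrum\<close>

text \<open>
After adding the constant \<open>row_bound\<close> to the potential, the Jacobi matrix has nonnegative entries
and diagonal at least \<open>1\<close>. It is considered on real functions; all vectors that occur have finite
support, so all inner products are finite sums over balls in the tree.
\<close>

definition shifted_jacobi :: "('e list \<Rightarrow> real) \<Rightarrow> 'e list \<Rightarrow> real" where
  "shifted_jacobi \<phi> w = (if w \<in> T then (b (\<pi> w) + row_bound) * \<phi> w + (\<Sum>g\<in>out_arcs G (\<pi> w). a g * \<phi> (step w g)) else 0)"

definition orbit :: "nat \<Rightarrow> 'e list \<Rightarrow> real" where "orbit k = (shifted_jacobi ^^ k) (indicator {[]})"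

definition cover_ball :: "nat \<Rightarrow> 'e list set" where "cover_ball n = {w \<in> T. length w \<le> n}"

lemma orbit_0: "orbit 0 = indicator {[]}" and orbit_Suc: "orbit (Suc k) = shifted_jacobi (orbit k)"
  by (simp_all add: orbit_def)

lemma shift_ge: "w \<in> T \<Longrightarrow> 1 \<le> b (\<pi> w) + row_bound"
  using row_bound_ge[OF \<pi>_verts, of w "{}"] by simp

lemma orbit_outside: "w \<notin> T \<Longrightarrow> orbit k w = 0"
  by (cases k) (auto simp: orbit_0 orbit_Suc shifted_jacobi_def indicator_def)

lemma a_out_pos: "g \<in> out_arcs G u \<Longrightarrow> 0 < a g" using a_pos by auto

lemma orbit_nonneg: "0 \<le> orbit k w"
proof (induction k arbitrary: w)
  case (Suc k)
  have "0 \<le> (\<Sum>g\<in>out_arcs G (\<pi> w). a g * orbit k (step w g))"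
    using Suc a_out_pos by (intro sum_nonneg mult_nonneg_nonneg) (auto intro: less_imp_le)
  moreover have "0 \<le> (b (\<pi> w) + row_bound) * orbit k w" if "w \<in> T"
    using Suc shift_ge[OF that] by (intro mult_nonneg_nonneg) auto
  ultimately show ?case by (simp add: orbit_Suc shifted_jacobi_def)
qed (simp add: orbit_0)

lemma length_step: "length w \<le> Suc (length (step w g))"
  by (auto simp: step_def)

lemma orbit_length: "k < length w \<Longrightarrow> orbit k w = 0"
proof (induction k arbitrary: w)
  case (Suc k)
  have "orbit k (step w g) = 0" for g using Suc length_step[of w g] by simp
  then show ?case using Suc by (simp add: orbit_Suc shifted_jacobi_def)
qed (auto simp: orbit_0 indicator_def)

lemma orbit_cover_ball: "k \<le> n \<Longrightarrow> w \<notin> cover_ball n \<Longrightarrow> orbit k w = 0"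
  using orbit_outside[of w k] orbit_length[of k w] by (auto simp: cover_ball_def)

lemma orbit_le: "orbit k w \<le> (2 * row_bound) ^ k"
proof (induction k arbitrary: w)
  case (Suc k)
  show ?case
  proof (cases "w \<in> T")
    case True
    have "orbit (Suc k) w \<le> (b (\<pi> w) + row_bound) * (2 * row_bound) ^ k + (\<Sum>g\<in>out_arcs G (\<pi> w). a g * (2 * row_bound) ^ k)"
      unfolding orbit_Suc shifted_jacobi_def using True shift_ge[OF True] Suc a_out_pos
      by (auto intro!: add_mono mult_left_mono sum_mono simp: less_imp_le)
    also have "\<dots> = (b (\<pi> w) + row_bound + (\<Sum>g\<in>out_arcs G (\<pi> w). a g)) * (2 * row_bound) ^ k"
      by (simp add: sum_distrib_right distrib_right)
    also have "\<dots> \<le> (2 * row_bound) * (2 * row_bound) ^ k"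
      using row_bound_ge[OF \<pi>_verts[OF True] out_arcs_subset, of "\<pi> w"] row_bound_pos
      by (intro mult_right_mono) auto
    finally show ?thesis by simp
  next
    case False
    then show ?thesis using orbit_outside[OF False, of "Suc k"] row_bound_pos by simp
  qed
qed (simp add: orbit_0 indicator_def)

lemma finite_cover_ball: "finite (cover_ball n)"
proof (rule finite_subset)
  show "cover_ball n \<subseteq> {p. set p \<subseteq> arcs G \<and> length p \<le> n}" by (auto simp: cover_ball_def nb_walks_def)
qed (rule finite_lists_length_le[OF finite_arcs])

text \<open>
Edge reversal \<open>(w, g) \<mapsto> (step w g, arev g)\<close> is an involution on the oriented edges of a ball.
\<close>

lemma shifted_jacobi_sym:
  assumes \<phi>: "\<And>w. w \<notin> cover_ball n \<Longrightarrow> \<phi> w = 0" and \<theta>: "\<And>w. w \<notin> cover_ball n \<Longrightarrow> \<theta> w = 0"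
  shows "(\<Sum>w\<in>cover_ball n. shifted_jacobi \<phi> w * \<theta> w) = (\<Sum>w\<in>cover_ball n. \<phi> w * shifted_jacobi \<theta> w)"
proof -
  define Dn where "Dn = {(w, g). w \<in> cover_ball n \<and> g \<in> out_arcs G (\<pi> w) \<and> step w g \<in> cover_ball n}"
  define A where "A = Sigma (cover_ball n) (\<lambda>w. out_arcs G (\<pi> w))"
  have DA: "Dn \<subseteq> A" by (auto simp: Dn_def A_def)
  have finA: "finite A" unfolding A_def by (intro finite_SigmaI finite_cover_ball finite_out_arcs)
  have TnT: "w \<in> T" if "w \<in> cover_ball n" for w using that by (simp add: cover_ball_def)
  have split1: "(\<Sum>w\<in>cover_ball n. (\<Sum>g\<in>out_arcs G (\<pi> w). a g * \<phi> (step w g)) * \<theta> w)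
      = (\<Sum>(w, g)\<in>Dn. a g * \<phi> (step w g) * \<theta> w)" 
    if \<phi>: "\<And>w. w \<notin> cover_ball n \<Longrightarrow> \<phi> w = 0" for \<phi> \<theta> :: "'e list \<Rightarrow> real"
  proof -
    have "(\<Sum>w\<in>cover_ball n. (\<Sum>g\<in>out_arcs G (\<pi> w). a g * \<phi> (step w g)) * \<theta> w)
        = (\<Sum>(w, g)\<in>A. a g * \<phi> (step w g) * \<theta> w)"
      unfolding A_def by (subst sum.Sigma[symmetric]) (auto simp: finite_cover_ball finite_out_arcs sum_distrib_right)
    also have "\<dots> = (\<Sum>(w, g)\<in>Dn. a g * \<phi> (step w g) * \<theta> w)"
    proof (rule sum.mono_neutral_right[OF finA DA], rule ballI)
      fix x assume "x \<in> A - Dn"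
      then have "step (fst x) (snd x) \<notin> cover_ball n" by (auto simp: A_def Dn_def)
      then show "(case x of (w, g) \<Rightarrow> a g * \<phi> (step w g) * \<theta> w) = 0" using \<phi> by (simp add: case_prod_beta)
    qed
    finally show ?thesis .
  qed
  have flip: "(\<Sum>(w, g)\<in>Dn. a g * \<phi> (step w g) * \<theta> w) = (\<Sum>(w, g)\<in>Dn. a g * \<theta> (step w g) * \<phi> w)"
  proof (rule sum.reindex_bij_witness[where i = "\<lambda>(w, g). (step w g, arev g)" and j = "\<lambda>(w, g). (step w g, arev g)"])
    fix x assume x: "x \<in> Dn"
    obtain w g where wg: "x = (w, g)" by (cases x)
    then have w: "w \<in> cover_ball n" "g \<in> out_arcs G (\<pi> w)" "step w g \<in> cover_ball n" using x by (auto simp: Dn_def)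
    note st = step_props[OF TnT[OF w(1)] w(2)]
    show "(case (case x of (w, g) \<Rightarrow> (step w g, arev g)) of (w, g) \<Rightarrow> (step w g, arev g)) = x"
      using st by (simp add: wg)
    then show "(case (case x of (w, g) \<Rightarrow> (step w g, arev g)) of (w, g) \<Rightarrow> (step w g, arev g)) = x" .
    show "(case x of (w, g) \<Rightarrow> (step w g, arev g)) \<in> Dn"
      using st w by (simp add: wg Dn_def)
    then show "(case x of (w, g) \<Rightarrow> (step w g, arev g)) \<in> Dn" .
    show "(case (case x of (w, g) \<Rightarrow> (step w g, arev g)) of (w, g) \<Rightarrow> a g * \<theta> (step w g) * \<phi> w)
        = (case x of (w, g) \<Rightarrow> a g * \<phi> (step w g) * \<theta> w)"
      using st w(2) a_arev[of g] by (simp add: wg)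
  qed
  have "(\<Sum>w\<in>cover_ball n. shifted_jacobi \<phi> w * \<theta> w) = (\<Sum>w\<in>cover_ball n. (b (\<pi> w) + row_bound) * \<phi> w * \<theta> w)
      + (\<Sum>w\<in>cover_ball n. (\<Sum>g\<in>out_arcs G (\<pi> w). a g * \<phi> (step w g)) * \<theta> w)"
    unfolding sum.distrib[symmetric] by (intro sum.cong) (auto simp: shifted_jacobi_def TnT distrib_right)
  moreover have "(\<Sum>w\<in>cover_ball n. \<phi> w * shifted_jacobi \<theta> w) = (\<Sum>w\<in>cover_ball n. (b (\<pi> w) + row_bound) * \<phi> w * \<theta> w)
      + (\<Sum>w\<in>cover_ball n. (\<Sum>g\<in>out_arcs G (\<pi> w). a g * \<theta> (step w g)) * \<phi> w)"
    unfolding sum.distrib[symmetric] by (intro sum.cong) (auto simp: shifted_jacobi_def TnT algebra_simps)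
  ultimately show ?thesis using split1[of \<phi> \<theta>, OF \<phi>] split1[of \<theta> \<phi>, OF \<theta>] flip by simp
qed

text \<open>
By symmetry, all inner products of iterates are moments at the root (\<open>orbit_inner\<close>); in
particular \<open>moment (2 * k)\<close> is the squared norm of \<open>orbit k\<close>.
\<close>

definition moment :: "nat \<Rightarrow> real" where "moment k = orbit k []"

lemma orbit_inner: "j + k \<le> n \<Longrightarrow> (\<Sum>w\<in>cover_ball n. orbit j w * orbit k w) = moment (j + k)"
proof (induction j arbitrary: k)
  case 0
  have "(\<Sum>w\<in>cover_ball n. orbit 0 w * orbit k w) = (\<Sum>w\<in>cover_ball n. if w = [] then orbit k w else 0)"
    by (intro sum.cong) (auto simp: orbit_0 indicator_def)
  also have "\<dots> = moment k" using finite_cover_ball by (simp add: moment_def cover_ball_def)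
  finally show ?case by simp
next
  case (Suc j)
  have "(\<Sum>w\<in>cover_ball n. orbit (Suc j) w * orbit k w) = (\<Sum>w\<in>cover_ball n. orbit j w * orbit (Suc k) w)"
    unfolding orbit_Suc using Suc.prems by (intro shifted_jacobi_sym orbit_cover_ball) auto
  then show ?case using Suc.IH[of "Suc k"] Suc.prems by simp
qed

lemma moment_ge: "1 \<le> moment k"
proof (induction k)
  case (Suc k)
  have "1 * moment k \<le> (b v0 + row_bound) * moment k"
    using shift_ge[OF T_Nil] Suc by (intro mult_right_mono) auto
  also have "\<dots> \<le> moment (Suc k)"
  proof -
    have "0 \<le> (\<Sum>g\<in>out_arcs G v0. a g * orbit k (step [] g))"
      using orbit_nonneg a_out_pos by (intro sum_nonneg mult_nonneg_nonneg) (auto intro: less_imp_le)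
    then show ?thesis by (simp add: moment_def orbit_Suc shifted_jacobi_def)
  qed
  finally show ?case using Suc by simp
qed (simp add: moment_def orbit_0)

lemma moment_le: "moment k \<le> (2 * row_bound) ^ k" using orbit_le by (simp add: moment_def)

text \<open>
Cauchy-Schwarz for the inner product of \<open>orbit k\<close> and \<open>orbit (k + 2)\<close>.
\<close>

lemma moment_log_convex: "(moment (2 * k + 2))\<^sup>2 \<le> moment (2 * k) * moment (2 * k + 4)"
proof -
  have "(\<Sum>w\<in>cover_ball (2*k+4). orbit k w * orbit (k + 2) w)\<^sup>2
      \<le> (\<Sum>w\<in>cover_ball (2*k+4). (orbit k w)\<^sup>2) * (\<Sum>w\<in>cover_ball (2*k+4). (orbit (k + 2) w)\<^sup>2)"
    by (rule Cauchy_Schwarz_ineq_sum)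
  moreover have "(\<Sum>w\<in>cover_ball (2*k+4). orbit k w * orbit (k + 2) w) = moment (2 * k + 2)"
    using orbit_inner[of k "k + 2" "2*k+4"] by (simp only: add.assoc[symmetric] mult_2)
  moreover have "(\<Sum>w\<in>cover_ball (2*k+4). (orbit k w)\<^sup>2) = moment (2 * k)"
    unfolding power2_eq_square mult_2[of k] by (rule orbit_inner) simp
  moreover have "(\<Sum>w\<in>cover_ball (2*k+4). (orbit (k + 2) w)\<^sup>2) = moment (2 * k + 4)"
  proof -
    have "2 * k + 4 = (k + 2) + (k + 2)" by simp
    then show ?thesis unfolding power2_eq_square by (metis orbit_inner order_refl)
  qed
  ultimately show ?thesis by simp
qed

definition moment_ratio :: "nat \<Rightarrow> real" where "moment_ratio k = moment (2 * k + 2) / moment (2 * k)"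

lemma moment_pos: "0 < moment k" using moment_ge[of k] by linarith

lemma moment_ratio_pos: "0 < moment_ratio k" using moment_pos by (simp add: moment_ratio_def)

lemma moment_ratio_mono: "moment_ratio k \<le> moment_ratio (Suc k)"
proof -
  have "moment (2 * k + 2) * moment (2 * k + 2) \<le> moment (2 * k) * moment (2 * k + 4)"
    using moment_log_convex[of k] by (simp add: power2_eq_square)
  then show ?thesis unfolding moment_ratio_def using moment_pos
    by (simp add: divide_le_eq le_divide_eq mult_ac numeral_eq_Suc)
qed

lemma incseq_moment_ratio: "incseq moment_ratio" by (rule incseq_SucI, rule moment_ratio_mono)

lemma moment_ratio_le: "moment_ratio k \<le> (2 * row_bound)\<^sup>2"
proof (rule ccontr)
  define x where "x = moment_ratio k / (2 * row_bound)\<^sup>2"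
  assume "\<not> moment_ratio k \<le> (2 * row_bound)\<^sup>2"
  then have x: "1 < x" using row_bound_pos by (simp add: x_def less_divide_eq)
  have grow: "moment (2 * k) * moment_ratio k ^ j \<le> moment (2 * k + 2 * j)" for j
  proof (induction j)
    case (Suc j)
    have "moment (2 * k) * moment_ratio k ^ Suc j = moment_ratio k * (moment (2 * k) * moment_ratio k ^ j)" by simp
    also have "\<dots> \<le> moment_ratio (k + j) * moment (2 * k + 2 * j)"
      using Suc incseqD[OF incseq_moment_ratio, of k "k + j"] moment_ratio_pos[of k] moment_ratio_pos[of "k + j"] moment_pos
      by (intro mult_mono) (auto simp: less_imp_le)
    also have "\<dots> = moment (2 * k + 2 * Suc j)"
      using moment_pos[of "2 * k + 2 * j"] by (simp add: moment_ratio_def distrib_left less_imp_neq[symmetric])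
    finally show ?case .
  qed simp
  have "moment (2 * k) * x ^ j \<le> (2 * row_bound) ^ (2 * k)" for j
  proof -
    have "moment (2 * k) * moment_ratio k ^ j \<le> (2 * row_bound) ^ (2 * k) * ((2 * row_bound)\<^sup>2) ^ j"
      using grow[of j] moment_le[of "2 * k + 2 * j"] by (simp add: power_add power_mult)
    then have "moment (2 * k) * moment_ratio k ^ j / ((2 * row_bound)\<^sup>2) ^ j \<le> (2 * row_bound) ^ (2 * k)"
      using row_bound_pos by (simp add: divide_le_eq)
    then show ?thesis by (simp add: x_def power_divide)
  qed
  moreover obtain j where "(2 * row_bound) ^ (2 * k) / moment (2 * k) < x ^ j" using real_arch_pow[OF x] by blast
  ultimately show False using moment_pos[of "2 * k"] by (simp add: divide_less_eq mult.commute not_less[symmetric])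
qed

text \<open>
The limit of the quotients of consecutive squared norms, so the norm of \<open>orbit k\<close> grows like the
\<open>k\<close>-th power of \<open>sqrt growth\<close>.
\<close>

definition growth :: real where "growth = lim moment_ratio"

lemma moment_ratio_tendsto: "moment_ratio \<longlonglongrightarrow> growth"
proof -
  obtain L where "moment_ratio \<longlonglongrightarrow> L" using incseq_convergent[OF incseq_moment_ratio] moment_ratio_le by blast
  then show ?thesis by (metis growth_def limI)
qed

lemma moment_ratio_le_growth: "moment_ratio k \<le> growth" by (rule incseq_le[OF incseq_moment_ratio moment_ratio_tendsto])

lemma growth_pos: "0 < growth" using moment_ratio_le_growth[of 0] moment_ratio_pos[of 0] by linarith

lemma moment_le_growth: "moment (2 * k) \<le> growth ^ k"
proof (induction k)
  case 0
  then show ?case by (simp add: moment_def orbit_0)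
next
  case (Suc k)
  have "moment (2 * Suc k) = moment_ratio k * moment (2 * k)"
    using moment_pos[of "2 * k"] by (simp add: moment_ratio_def)
  also have "\<dots> \<le> growth * growth ^ k"
    using moment_ratio_le_growth[of k] Suc growth_pos moment_pos by (intro mult_mono) (auto simp: less_imp_le)
  finally show ?case by simp
qed

lemma orbit_le_growth: "orbit k w \<le> sqrt growth ^ k"
proof (cases "w \<in> cover_ball (2 * k)")
  case True
  have "(orbit k w)\<^sup>2 \<le> (\<Sum>w\<in>cover_ball (2 * k). (orbit k w)\<^sup>2)"
    using True finite_cover_ball by (intro member_le_sum) auto
  also have "\<dots> = moment (2 * k)" using orbit_inner[of k k "2 * k"] by (simp add: power2_eq_square mult_2)
  also have "\<dots> \<le> growth ^ k" by (rule moment_le_growth)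
  also have "\<dots> = (sqrt growth ^ k)\<^sup>2"
    using growth_pos by (metis less_imp_le power_mult mult.commute real_sqrt_pow2)
  finally show ?thesis using growth_pos by (auto intro: power2_le_imp_le)
next
  case False
  then show ?thesis using orbit_cover_ball[of k "2 * k" w] growth_pos by simp
qed

lemma ell2_finite_support:
  assumes "\<And>w. w \<notin> cover_ball n \<Longrightarrow> \<xi> w = 0"
  shows "\<xi> \<in> ell2 T" "ell2_norm T \<xi> = sqrt (\<Sum>w\<in>cover_ball n. (cmod (\<xi> w))\<^sup>2)"
proof -
  have sub: "cover_ball n \<subseteq> T" by (auto simp: cover_ball_def)
  have "(\<lambda>w. (cmod (\<xi> w))\<^sup>2) summable_on cover_ball n" using finite_cover_ball by simp
  moreover have "(\<lambda>w. (cmod (\<xi> w))\<^sup>2) summable_on T \<longleftrightarrow> (\<lambda>w. (cmod (\<xi> w))\<^sup>2) summable_on cover_ball n"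
    using assms sub by (intro summable_on_cong_neutral) auto
  ultimately show "\<xi> \<in> ell2 T" using assms sub by (auto simp: ell2_def)
  have "(\<Sum>\<^sub>\<infinity>w\<in>T. (cmod (\<xi> w))\<^sup>2) = (\<Sum>\<^sub>\<infinity>w\<in>cover_ball n. (cmod (\<xi> w))\<^sup>2)"
    using assms sub by (intro infsum_cong_neutral) auto
  then show "ell2_norm T \<xi> = sqrt (\<Sum>w\<in>cover_ball n. (cmod (\<xi> w))\<^sup>2)"
    using finite_cover_ball by (simp add: ell2_norm_def)
qed

lemma J_of_real:
  assumes "\<And>w. w \<notin> T \<Longrightarrow> \<phi> w = 0"
  shows "J (\<lambda>w. complex_of_real (\<phi> w)) w = complex_of_real (shifted_jacobi \<phi> w - row_bound * \<phi> w)"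
proof (cases "w \<in> T")
  case True
  then show ?thesis by (simp add: J_eq shifted_jacobi_def algebra_simps)
next
  case False
  then show ?thesis using assms by (simp add: J_outside shifted_jacobi_def)
qed

text \<open>
Let \<open>B\<close> be the shifted matrix and \<open>L = growth\<close>. Because the quotients of squared norms converge
to \<open>L\<close>, the norm of \<open>(B\<^sup>2 - L) (orbit k)\<close> is small in comparison with that of \<open>orbit k\<close>. Hence
\<open>(B + sqrt L) (orbit k)\<close>, whose norm cannot be small because all entries are nonnegative, is an
approximate eigenvector of \<open>B\<close> at \<open>sqrt L\<close>, and \<open>B - sqrt L\<close> has no bounded inverse.
\<close>

lemma top_in_spectrum: "complex_of_real (sqrt growth - row_bound) \<in> ell2_spectrum T J"
proof (rule ccontr)
  define z where "z = complex_of_real (sqrt growth - row_bound)"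
  assume "complex_of_real (sqrt growth - row_bound) \<notin> ell2_spectrum T J"
  then have "z \<in> ell2_resolvent_set T J" by (simp add: ell2_spectrum_def z_def)
  then obtain Rz K where RK: "\<And>\<xi>. \<xi> \<in> ell2 T \<Longrightarrow> ell2_norm T (Rz \<xi>) \<le> K * ell2_norm T \<xi>"
    "\<And>\<xi>. \<xi> \<in> ell2 T \<Longrightarrow> Rz (\<lambda>x. J \<xi> x - z * \<xi> x) = \<xi>"
    unfolding ell2_resolvent_set_def by blast
  have sq: "sqrt growth * sqrt growth = growth" using growth_pos by simp
  have key: "growth \<le> K\<^sup>2 * (moment_ratio (Suc k) * moment_ratio k - 2 * growth * moment_ratio k + growth\<^sup>2)" for k
  proof -
    define n where "n = 2 * k + 4"
    define \<theta> where "\<theta> w = sqrt growth * orbit k w + orbit (k + 1) w" for w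
    define res where "res w = orbit (k + 2) w - growth * orbit k w" for w
    have \<theta>0: "\<theta> w = 0" if "w \<notin> cover_ball n" for w using that orbit_cover_ball[of k n] orbit_cover_ball[of "k+1" n] by (simp add: \<theta>_def n_def)
    have res0: "res w = 0" if "w \<notin> cover_ball n" for w using that orbit_cover_ball[of k n] orbit_cover_ball[of "k+2" n] by (simp add: res_def n_def)
    have \<theta>T: "\<theta> w = 0" if "w \<notin> T" for w using that orbit_outside by (simp add: \<theta>_def)
    have shifted_jacobi_\<theta>: "shifted_jacobi \<theta> w = sqrt growth * orbit (k + 1) w + orbit (k + 2) w" for w
      by (simp add: shifted_jacobi_def \<theta>_def orbit_Suc numeral_2_eq_2 sum_distrib_left sum.distrib algebra_simps)
    have "J (\<lambda>w. complex_of_real (\<theta> w)) x - z * complex_of_real (\<theta> x) = complex_of_real (res x)" for x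
    proof -
      have "shifted_jacobi \<theta> x - row_bound * \<theta> x - (sqrt growth - row_bound) * \<theta> x = shifted_jacobi \<theta> x - sqrt growth * \<theta> x"
        by (simp add: algebra_simps)
      also have "\<dots> = res x"
        unfolding shifted_jacobi_\<theta> using sq by (simp add: \<theta>_def res_def distrib_left mult.assoc[symmetric] del: real_sqrt_mult_self)
      finally show ?thesis using J_of_real[of \<theta> x] \<theta>T by (simp add: z_def flip: of_real_mult of_real_diff)
    qed
    then have "(\<lambda>x. J (\<lambda>w. complex_of_real (\<theta> w)) x - z * complex_of_real (\<theta> x)) = (\<lambda>x. complex_of_real (res x))"
      by blast
    moreover have "(\<lambda>w. complex_of_real (\<theta> w)) \<in> ell2 T"
      by (rule ell2_finite_support(1)[of n]) (simp add: \<theta>0)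
    ultimately have R_res: "Rz (\<lambda>x. complex_of_real (res x)) = (\<lambda>w. complex_of_real (\<theta> w))"
      using RK(2) by metis
    have "ell2_norm T (\<lambda>w. complex_of_real (\<theta> w)) \<le> K * ell2_norm T (\<lambda>x. complex_of_real (res x))"
      using RK(1)[of "\<lambda>x. complex_of_real (res x)"] ell2_finite_support(1)[of n "\<lambda>x. complex_of_real (res x)"]
      by (simp add: R_res res0)
    then have norm_le: "sqrt (\<Sum>w\<in>cover_ball n. (\<theta> w)\<^sup>2) \<le> K * sqrt (\<Sum>w\<in>cover_ball n. (res w)\<^sup>2)"
      using ell2_finite_support(2)[of n "\<lambda>x. complex_of_real (res x)"] ell2_finite_support(2)[of n "\<lambda>x. complex_of_real (\<theta> x)"]
      by (simp add: res0 \<theta>0)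
    have le: "(\<Sum>w\<in>cover_ball n. (\<theta> w)\<^sup>2) \<le> K\<^sup>2 * (\<Sum>w\<in>cover_ball n. (res w)\<^sup>2)"
    proof -
      have "(sqrt (\<Sum>w\<in>cover_ball n. (\<theta> w)\<^sup>2))\<^sup>2 \<le> (K * sqrt (\<Sum>w\<in>cover_ball n. (res w)\<^sup>2))\<^sup>2"
        using norm_le by (intro power_mono) (auto intro: sum_nonneg)
      then show ?thesis by (simp add: power_mult_distrib sum_nonneg)
    qed
    have inner: "(\<Sum>w\<in>cover_ball n. orbit k w * orbit k w) = moment (2 * k)"
      unfolding mult_2 by (rule orbit_inner) (simp add: n_def)
    have "(sqrt growth * orbit k w)\<^sup>2 = growth * (orbit k w * orbit k w)" for w
      using real_sqrt_pow2[OF less_imp_le[OF growth_pos]]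
      by (simp only: power_mult_distrib) (simp only: power2_eq_square[of "orbit k w"])
    then have "growth * moment (2 * k) = (\<Sum>w\<in>cover_ball n. (sqrt growth * orbit k w)\<^sup>2)"
      by (simp only: inner[symmetric] sum_distrib_left)
    also have "\<dots> \<le> (\<Sum>w\<in>cover_ball n. (\<theta> w)\<^sup>2)"
      using orbit_nonneg growth_pos by (intro sum_mono power_mono) (auto simp: \<theta>_def)
    finally have low: "growth * moment (2 * k) \<le> K\<^sup>2 * (\<Sum>w\<in>cover_ball n. (res w)\<^sup>2)" using le by simp
    have "(\<Sum>w\<in>cover_ball n. (res w)\<^sup>2) = (\<Sum>w\<in>cover_ball n. orbit (k+2) w * orbit (k+2) w) - 2 * growth * (\<Sum>w\<in>cover_ball n. orbit k w * orbit (k+2) w)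
        + growth\<^sup>2 * (\<Sum>w\<in>cover_ball n. orbit k w * orbit k w)"
      unfolding res_def sum_distrib_left sum_subtractf[symmetric] sum.distrib[symmetric]
      by (intro sum.cong) (auto simp: power2_eq_square algebra_simps)
    also have "\<dots> = moment (2 * k + 4) - 2 * growth * moment (2 * k + 2) + growth\<^sup>2 * moment (2 * k)"
    proof -
      have "2 * k + 4 = (k + 2) + (k + 2)" "2 * k + 2 = k + (k + 2)" by simp_all
      moreover have "(\<Sum>w\<in>cover_ball n. orbit (k+2) w * orbit (k+2) w) = moment ((k + 2) + (k + 2))"
        by (rule orbit_inner) (simp add: n_def)
      moreover have "(\<Sum>w\<in>cover_ball n. orbit k w * orbit (k+2) w) = moment (k + (k + 2))"
        by (rule orbit_inner) (simp add: n_def)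
      ultimately show ?thesis using inner by (simp only:)
    qed
    also have "\<dots> = (moment_ratio (Suc k) * moment_ratio k - 2 * growth * moment_ratio k + growth\<^sup>2) * moment (2 * k)"
    proof -
      have "moment (2 * k + 2) = moment_ratio k * moment (2 * k)" using moment_pos[of "2 * k"] by (simp add: moment_ratio_def)
      moreover have "moment (2 * k + 4) = moment_ratio (Suc k) * moment (2 * k + 2)"
        using moment_pos[of "2 * k + 2"] by (simp add: moment_ratio_def numeral_eq_Suc)
      ultimately show ?thesis by (simp add: algebra_simps)
    qed
    finally have "growth * moment (2 * k) \<le> (K\<^sup>2 * (moment_ratio (Suc k) * moment_ratio k - 2 * growth * moment_ratio k + growth\<^sup>2)) * moment (2 * k)"
      using low by (simp add: mult.assoc)
    then show ?thesis using moment_pos[of "2 * k"] by simp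
  qed
  have "(\<lambda>k. K\<^sup>2 * (moment_ratio (Suc k) * moment_ratio k - 2 * growth * moment_ratio k + growth\<^sup>2))
      \<longlonglongrightarrow> K\<^sup>2 * (growth * growth - 2 * growth * growth + growth\<^sup>2)"
    by (intro tendsto_intros moment_ratio_tendsto LIMSEQ_Suc[OF moment_ratio_tendsto])
  then have "growth \<le> K\<^sup>2 * (growth * growth - 2 * growth * growth + growth\<^sup>2)"
    by (rule LIMSEQ_le_const) (use key in blast)
  then show False using growth_pos by (simp add: power2_eq_square)
qed

lemma orbit_pos: "w \<in> T \<Longrightarrow> 0 < orbit (length w) w"
proof (induction w rule: rev_induct)
  case Nil
  then show ?case by (simp add: orbit_0)
next
  case (snoc f p)
  have p: "p \<in> T" "f \<in> out_arcs G (\<pi> p)" "p = [] \<or> f \<noteq> arev (last p)" using snoc.prems by (auto simp: T_snoc)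
  have "\<pi> (p @ [f]) = head G f" by simp
  have rf: "arev f \<in> out_arcs G (\<pi> (p @ [f]))" using p(2) by simp
  have st: "step (p @ [f]) (arev f) = p" by (simp add: step_def)
  have "0 < a (arev f) * orbit (length p) p" using snoc.IH[OF p(1)] a_out_pos[OF rf] by simp
  also have "\<dots> \<le> (\<Sum>g\<in>out_arcs G (\<pi> (p @ [f])). a g * orbit (length p) (step (p @ [f]) g))"
    using member_le_sum[OF rf, of "\<lambda>g. a g * orbit (length p) (step (p @ [f]) g)"] st a_out_pos orbit_nonneg
    by (simp add: less_imp_le finite_out_arcs)
  also have "\<dots> \<le> orbit (length (p @ [f])) (p @ [f])"
    using snoc.prems shift_ge[OF snoc.prems] orbit_nonneg by (simp add: orbit_Suc shifted_jacobi_def del: \<pi>_simps)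
  finally show ?case .
qed

text \<open>
The Neumann series \<open>\<Psi> = (\<Sum>k. orbit k / (x + row_bound) ^ (k + 1))\<close> converges pointwise above the
growth rate and solves \<open>(x - J) \<Psi> = \<delta>\<close> at the root.
\<close>

lemma positive_superharmonic:
  assumes x: "sqrt growth - row_bound < x"
  obtains \<Psi> :: "'e list \<Rightarrow> real" where "\<And>w. w \<in> T \<Longrightarrow> 0 < \<Psi> w"
    and "\<And>w. w \<in> T \<Longrightarrow> (\<Sum>g\<in>out_arcs G (\<pi> w). a g * \<Psi> (step w g)) \<le> (x - b (\<pi> w)) * \<Psi> w"
proof -
  define y where "y = x + row_bound"
  have y1: "sqrt growth < y" using x by (simp add: y_def)
  have y: "sqrt growth < y" "0 < y" using y1 less_trans[OF real_sqrt_gt_zero[OF growth_pos] y1] by auto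
  have sum_geo: "summable (\<lambda>k. (sqrt growth / y) ^ k * (1 / y))"
    using y growth_pos by (intro summable_mult2 summable_geometric) (auto simp: divide_less_eq)
  define \<Psi> where "\<Psi> w = (\<Sum>k. orbit k w / y ^ Suc k)" for w
  have sums: "(\<lambda>k. orbit k w / y ^ Suc k) sums \<Psi> w" for w
    unfolding \<Psi>_def
  proof (intro summable_sums summable_comparison_test[OF exI[of _ 0] sum_geo] allI impI)
    fix k :: nat
    have "orbit k w / y ^ Suc k \<le> sqrt growth ^ k / y ^ Suc k"
      using orbit_le_growth[of k w] y by (intro divide_right_mono) auto
    then show "norm (orbit k w / y ^ Suc k) \<le> (sqrt growth / y) ^ k * (1 / y)"
      using orbit_nonneg[of k w] y by (simp add: power_divide mult.commute)
  qed
  show ?thesis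
  proof (rule that)
    fix w assume w: "w \<in> T"
    have "0 < orbit (length w) w / y ^ Suc (length w)" using orbit_pos[OF w] y by simp
    also have "\<dots> \<le> \<Psi> w" unfolding \<Psi>_def
      using sum_le_suminf[OF sums_summable[OF sums[of w]], of "{length w}"] orbit_nonneg y by (simp add: less_imp_le)
    finally show "0 < \<Psi> w" .
    have "(\<lambda>k. (b (\<pi> w) + row_bound) * (orbit k w / y ^ Suc k) + (\<Sum>g\<in>out_arcs G (\<pi> w). a g * (orbit k (step w g) / y ^ Suc k)))
        sums ((b (\<pi> w) + row_bound) * \<Psi> w + (\<Sum>g\<in>out_arcs G (\<pi> w). a g * \<Psi> (step w g)))"
      by (intro sums_add sums_mult sums_sum sums)
    moreover have "(b (\<pi> w) + row_bound) * (orbit k w / y ^ Suc k) + (\<Sum>g\<in>out_arcs G (\<pi> w). a g * (orbit k (step w g) / y ^ Suc k))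
        = orbit (Suc k) w / y ^ Suc k" for k
      using w by (simp add: orbit_Suc shifted_jacobi_def add_divide_distrib sum_divide_distrib)
    ultimately have 1: "(\<lambda>k. orbit (Suc k) w / y ^ Suc k) sums
        ((b (\<pi> w) + row_bound) * \<Psi> w + (\<Sum>g\<in>out_arcs G (\<pi> w). a g * \<Psi> (step w g)))" by simp
    have "(\<lambda>k. orbit (Suc k) w / y ^ Suc (Suc k)) sums (\<Psi> w - orbit 0 w / y ^ Suc 0)"
      using sums[of w] by (subst sums_Suc_iff) simp
    from sums_mult[OF this, of y] have 2: "(\<lambda>k. orbit (Suc k) w / y ^ Suc k) sums (y * \<Psi> w - orbit 0 w)"
      using y by (simp add: algebra_simps)
    show "(\<Sum>g\<in>out_arcs G (\<pi> w). a g * \<Psi> (step w g)) \<le> (x - b (\<pi> w)) * \<Psi> w"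
      using sums_unique2[OF 1 2] orbit_nonneg[of 0 w] by (simp add: y_def algebra_simps)
  qed
qed

section \<open>Positivity of the iterates at the edge\<close>

text \<open>
The branch recursion of the graph: arcs with the relation \<open>nsucc\<close>, squared weights, and the
potential at the heads.
\<close>

abbreviation den :: "real \<Rightarrow> ('e \<Rightarrow> real) \<Rightarrow> 'e \<Rightarrow> real" where
  "den \<equiv> branch_denom nsucc (\<lambda>g. (a g)\<^sup>2) (\<lambda>f. b (head G f))"

abbreviation iter :: "real \<Rightarrow> nat \<Rightarrow> 'e \<Rightarrow> real" where
  "iter \<equiv> branch_iter nsucc (\<lambda>g. (a g)\<^sup>2) (\<lambda>f. b (head G f))"

lemma dart_denom_bound:
  assumes \<Psi>: "\<And>w. w \<in> T \<Longrightarrow> 0 < \<Psi> w"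
    and super: "\<And>w. w \<in> T \<Longrightarrow> (\<Sum>g\<in>out_arcs G (\<pi> w). a g * \<Psi> (step w g)) \<le> (x - b (\<pi> w)) * \<Psi> w"
    and k: "\<And>w g. w \<in> T \<Longrightarrow> g \<in> out_arcs G (\<pi> w) \<Longrightarrow> a g * k g * \<Psi> w \<le> \<Psi> (step w g)"
    and w: "w \<in> T" and g: "g \<in> out_arcs G (\<pi> w)"
  shows "a g * \<Psi> w \<le> den x k g * \<Psi> (step w g)" "0 < den x k g"
proof -
  have gA: "g \<in> arcs G" using g by auto
  note st = step_props[OF w g]
  have "(\<Sum>g'\<in>nsucc g. (a g')\<^sup>2 * k g') * \<Psi> (step w g) \<le> (\<Sum>g'\<in>nsucc g. a g' * \<Psi> (step (step w g) g'))"
    unfolding sum_distrib_right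
  proof (rule sum_mono)
    fix g' assume g': "g' \<in> nsucc g"
    then have "a g' * k g' * \<Psi> (step w g) \<le> \<Psi> (step (step w g) g')"
      using k[OF st(1)] st(2) by (simp add: nsucc_def)
    then have "a g' * (a g' * k g' * \<Psi> (step w g)) \<le> a g' * \<Psi> (step (step w g) g')"
      using a_pos[OF nsucc_arcs[OF g']] by (intro mult_left_mono) auto
    then show "(a g')\<^sup>2 * k g' * \<Psi> (step w g) \<le> a g' * \<Psi> (step (step w g) g')"
      by (simp add: power2_eq_square mult.assoc)
  qed
  then have "a g * \<Psi> w + (\<Sum>g'\<in>nsucc g. (a g')\<^sup>2 * k g') * \<Psi> (step w g)
      \<le> (x - b (head G g)) * \<Psi> (step w g)"
    using super[OF st(1)] st(2,3) out_arcs_split[OF gA, of "\<lambda>g'. a g' * \<Psi> (step (step w g) g')"] a_arev[OF gA]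
    by simp
  then show 1: "a g * \<Psi> w \<le> den x k g * \<Psi> (step w g)" by (simp add: branch_denom_def algebra_simps)
  have "0 < a g * \<Psi> w" using a_out_pos[OF g] w \<Psi> by simp
  then have "0 < den x k g * \<Psi> (step w g)" using 1 by linarith
  then show "0 < den x k g" using \<Psi>[OF st(1)] by (simp add: zero_less_mult_iff)
qed

text \<open>
In the branch beyond an edge, a positive superharmonic function dominates the solution with the same
value at the near end of the edge. At the far end that solution is the weight of the edge times the
Green's function of the branch times the value at the near end.
\<close>

lemma iter_above:
  assumes \<Psi>: "\<And>w. w \<in> T \<Longrightarrow> 0 < \<Psi> w"
    and super: "\<And>w. w \<in> T \<Longrightarrow> (\<Sum>g\<in>out_arcs G (\<pi> w). a g * \<Psi> (step w g)) \<le> (x - b (\<pi> w)) * \<Psi> w"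
    and w: "w \<in> T" and g: "g \<in> out_arcs G (\<pi> w)"
  shows "a g * iter x n g * \<Psi> w \<le> \<Psi> (step w g)"
  using w g
proof (induction n arbitrary: w g)
  case 0
  then show ?case using \<Psi>[OF step_props(1)[OF 0]] by simp
next
  case (Suc n)
  note db = dart_denom_bound[OF \<Psi> super Suc.IH Suc.prems]
  have "a g * \<Psi> w / den x (iter x n) g \<le> \<Psi> (step w g)"
    using db by (simp add: divide_le_eq mult.commute)
  then show ?case by (simp add: field_simps)
qed

lemma iter_bounds_above:
  assumes top: "\<And>x::real. complex_of_real x \<in> ell2_spectrum T J \<Longrightarrow> x \<le> \<rho>"
    and lift: "\<And>u. u \<in> verts G \<Longrightarrow> \<exists>w\<in>T. \<pi> w = u"
    and x: "\<rho> < x"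
  shows "f \<in> arcs G \<Longrightarrow> 0 < den x (iter x n) f"
    and "u \<in> verts G \<Longrightarrow> (\<Sum>g\<in>out_arcs G u. (a g)\<^sup>2 * iter x n g) \<le> x - b u"
proof -
  have "sqrt growth - row_bound < x" using top[OF top_in_spectrum] x by linarith
  then obtain \<Psi> where \<Psi>: "\<And>w. w \<in> T \<Longrightarrow> 0 < \<Psi> w"
    and super: "\<And>w. w \<in> T \<Longrightarrow> (\<Sum>g\<in>out_arcs G (\<pi> w). a g * \<Psi> (step w g)) \<le> (x - b (\<pi> w)) * \<Psi> w"
    using positive_superharmonic by blast
  show "0 < den x (iter x n) f" if f: "f \<in> arcs G"
  proof -
    obtain w where w: "w \<in> T" "\<pi> w = tail G f" using lift[of "tail G f"] f by auto
    then show ?thesis using dart_denom_bound(2)[OF \<Psi> super iter_above[OF \<Psi> super] w(1), where g = f] f by simp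
  qed
  show "(\<Sum>g\<in>out_arcs G u. (a g)\<^sup>2 * iter x n g) \<le> x - b u" if u: "u \<in> verts G"
  proof -
    obtain w where w: "w \<in> T" "\<pi> w = u" using lift[OF u] by auto
    have "(\<Sum>g\<in>out_arcs G u. (a g)\<^sup>2 * iter x n g) * \<Psi> w \<le> (\<Sum>g\<in>out_arcs G u. a g * \<Psi> (step w g))"
      unfolding sum_distrib_right
    proof (rule sum_mono)
      fix g assume g: "g \<in> out_arcs G u"
      have "a g * (a g * iter x n g * \<Psi> w) \<le> a g * \<Psi> (step w g)"
        using iter_above[OF \<Psi> super w(1), of g n] g w(2) a_out_pos[OF g] by (intro mult_left_mono) auto
      then show "(a g)\<^sup>2 * iter x n g * \<Psi> w \<le> a g * \<Psi> (step w g)"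
        by (simp add: power2_eq_square mult.assoc)
    qed
    also have "\<dots> \<le> (x - b u) * \<Psi> w" using super[OF w(1)] w(2) by simp
    finally show ?thesis using \<Psi>[OF w(1)] by simp
  qed
qed

lemma isCont_den:
  assumes "\<And>g. g \<in> arcs G \<Longrightarrow> isCont (\<lambda>x. k x g) \<rho>"
  shows "isCont (\<lambda>x. den x (k x) f) \<rho>"
  unfolding branch_denom_def by (intro continuous_intros assms nsucc_arcs)

text \<open>
Passing to the limit \<open>x \<rightarrow> \<rho>\<close> from the right only gives a nonnegative denominator. The row bound
at the tail of \<open>f\<close>, multiplied out to \<open>(a f)\<^sup>2 \<le> (x - b (tail G f)) * den x (iter x n) f\<close>, survives
the limit and excludes \<open>0\<close>.
\<close>

lemma den_pos_at_edge:
  assumes top: "\<And>x::real. complex_of_real x \<in> ell2_spectrum T J \<Longrightarrow> x \<le> \<rho>"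
    and lift: "\<And>u. u \<in> verts G \<Longrightarrow> \<exists>w\<in>T. \<pi> w = u"
    and cont: "\<forall>f\<in>arcs G. isCont (\<lambda>x. iter x n f) \<rho>" and f: "f \<in> arcs G"
  shows "0 < den \<rho> (iter \<rho> n) f"
proof -
  have "isCont (\<lambda>x. den x (iter x n) f) \<rho>"
    by (rule isCont_den) (use cont in blast)
  then have lim: "((\<lambda>x. den x (iter x n) f) \<longlongrightarrow> den \<rho> (iter \<rho> n) f) (at_right \<rho>)"
    unfolding isCont_def by (rule tendsto_within_subset) simp
  have right: "\<forall>\<^sub>F x in at_right \<rho>. \<rho> < x" by (simp add: eventually_at_filter)
  have "0 \<le> den \<rho> (iter \<rho> n) f"
  proof (rule tendsto_lowerbound[OF lim])
    show "\<forall>\<^sub>F x in at_right \<rho>. 0 \<le> den x (iter x n) f"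
      using right by eventually_elim (use iter_bounds_above(1)[OF top lift _ f] in \<open>auto intro: less_imp_le\<close>)
  qed simp
  moreover have "(a f)\<^sup>2 \<le> (\<rho> - b (tail G f)) * den \<rho> (iter \<rho> n) f"
  proof (rule tendsto_le)
    show "((\<lambda>x. (x - b (tail G f)) * den x (iter x n) f) \<longlongrightarrow> (\<rho> - b (tail G f)) * den \<rho> (iter \<rho> n) f) (at_right \<rho>)"
      by (intro tendsto_intros lim)
    show "((\<lambda>x. (a f)\<^sup>2) \<longlongrightarrow> (a f)\<^sup>2) (at_right \<rho>)" by simp
    show "\<forall>\<^sub>F x in at_right \<rho>. (a f)\<^sup>2 \<le> (x - b (tail G f)) * den x (iter x n) f"
      using right
    proof eventually_elim
      case (elim x)
      have pos: "0 < den x (iter x k) g" if "g \<in> arcs G" for g k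
        by (rule iter_bounds_above(1)[OF top lift elim that])
      have "(a f)\<^sup>2 * iter x (Suc n) f \<le> (\<Sum>g\<in>out_arcs G (tail G f). (a g)\<^sup>2 * iter x (Suc n) g)"
      proof (rule member_le_sum)
        show "0 \<le> (a g)\<^sup>2 * iter x (Suc n) g" if "g \<in> out_arcs G (tail G f) - {f}" for g
          using that pos[of g n] by simp
      qed (use f finite_out_arcs in auto)
      also have "\<dots> \<le> x - b (tail G f)"
        using iter_bounds_above(2)[OF top lift elim, of "tail G f" "Suc n"] f by simp
      finally show ?case using pos[OF f, of n] by (simp add: field_simps)
    qed
  qed simp
  moreover have "0 < (a f)\<^sup>2" using a_pos[OF f] by simp
  ultimately show ?thesis by (cases "den \<rho> (iter \<rho> n) f = 0") auto
qed

lemma iter_at_edge: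
  assumes top: "\<And>x::real. complex_of_real x \<in> ell2_spectrum T J \<Longrightarrow> x \<le> \<rho>"
    and lift: "\<And>u. u \<in> verts G \<Longrightarrow> \<exists>w\<in>T. \<pi> w = u"
  shows "\<forall>f\<in>arcs G. isCont (\<lambda>x. iter x n f) \<rho> \<and> 0 < den \<rho> (iter \<rho> n) f"
proof (induction n)
  case 0
  show ?case using den_pos_at_edge[OF top lift, where n = 0] by simp
next
  case (Suc n)
  have "isCont (\<lambda>x. iter x (Suc n) f) \<rho>" if f: "f \<in> arcs G" for f
  proof -
    have "isCont (\<lambda>x. den x (iter x n) f) \<rho>"
      by (rule isCont_den) (use Suc in blast)
    moreover have "den \<rho> (iter \<rho> n) f \<noteq> 0" using Suc f by force
    ultimately show ?thesis by (simp add: continuous_intros)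
  qed
  then show ?case using den_pos_at_edge[OF top lift, where n = "Suc n"] by blast
qed


section \<open>Non-backtracking connections between cycles\<close>

definition nbR :: "('e \<times> 'e) set" where "nbR = {(f, g). f \<in> arcs G \<and> g \<in> nsucc f}"

lemma nbR_iff: "(f, g) \<in> nbR \<longleftrightarrow> f \<in> arcs G \<and> g \<in> arcs G \<and> tail G g = head G f \<and> g \<noteq> arev f"
  by (auto simp: nbR_def nsucc_def)

lemma nbR_arev: "(f, g) \<in> nbR \<Longrightarrow> (arev g, arev f) \<in> nbR"
  by (auto simp: nbR_iff)

lemma nbR_rtrancl_arev: "(f, g) \<in> nbR\<^sup>* \<Longrightarrow> (arev g, arev f) \<in> nbR\<^sup>*"
  by (induction rule: rtrancl_induct) (auto dest: nbR_arev intro: converse_rtrancl_into_rtrancl)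

lemma nbR_arcs: "(f, g) \<in> nbR\<^sup>* \<Longrightarrow> f \<in> arcs G \<Longrightarrow> g \<in> arcs G"
  by (induction rule: rtrancl_induct) (auto simp: nbR_iff)

lemma nbR_arcs_back: "(f, g) \<in> nbR\<^sup>* \<Longrightarrow> g \<in> arcs G \<Longrightarrow> f \<in> arcs G"
  by (induction rule: converse_rtrancl_induct) (auto simp: nbR_iff)

text \<open>
Here \<open>V\<close> and \<open>Z\<close> are the vertices and edges of a cycle. On a walk that leaves the cycle by
the arc \<open>e\<close> and ends on the cycle, the first arc into \<open>V\<close> is not an edge of the cycle:
it is \<open>e\<close> itself, or its tail is outside \<open>V\<close>.
\<close>

lemma first_entry:
  assumes "(e, c) \<in> nbR\<^sup>*" "head G c \<in> V" "e \<notin> Z"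
    and Z: "\<And>z. z \<in> Z \<Longrightarrow> tail G z \<in> V"
  shows "\<exists>l. l \<notin> Z \<and> head G l \<in> V \<and> (e, l) \<in> nbR\<^sup>*"
  using assms(1,3)
proof (induction rule: converse_rtrancl_induct)
  case base
  then show ?case using assms(2) by blast
next
  case (step e e')
  show ?case
  proof (cases "head G e \<in> V")
    case True
    then show ?thesis using step.prems by blast
  next
    case False
    then have "e' \<notin> Z" using Z[of e'] step.hyps by (auto simp: nbR_iff)
    then obtain l where "l \<notin> Z" "head G l \<in> V" "(e', l) \<in> nbR\<^sup>*" using step.IH by blast
    then show ?thesis using step.hyps(1) by (blast intro: converse_rtrancl_into_rtrancl)
  qed
qed

lemma last_exit:
  assumes "(c, e) \<in> nbR\<^sup>*" "tail G c \<in> V" "e \<notin> Z"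
    and Z: "\<And>z. z \<in> Z \<Longrightarrow> head G z \<in> V"
  shows "\<exists>k. k \<notin> Z \<and> tail G k \<in> V \<and> (k, e) \<in> nbR\<^sup>*"
  using assms(1,3)
proof (induction rule: rtrancl_induct)
  case base
  then show ?case using assms(2) by blast
next
  case (step e' e)
  show ?case
  proof (cases "tail G e \<in> V")
    case True
    then show ?thesis using step.prems by blast
  next
    case False
    then have "e' \<notin> Z" using Z[of e'] step.hyps by (auto simp: nbR_iff)
    then obtain k where "k \<notin> Z" "tail G k \<in> V" "(k, e') \<in> nbR\<^sup>*" using step.IH by blast
    then show ?thesis using step.hyps(2) by (blast intro: rtrancl_into_rtrancl)
  qed
qed

text \<open>
What is kept of a directed cycle is its set of arcs. The reachability condition replaces the cyclic
order.
\<close>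

definition nb_cycle :: "'e set \<Rightarrow> bool" where
  "nb_cycle P \<longleftrightarrow> P \<noteq> {} \<and> P \<subseteq> arcs G \<and> (\<forall>e\<in>P. arev e \<notin> P) \<and>
     (\<forall>e\<in>P. \<forall>f\<in>P. (e, f) \<in> nbR\<^sup>*) \<and> head G ` P = tail G ` P"

lemma awalk_nbR:
  assumes "awalk u p v" "\<forall>e\<in>set p. arev e \<notin> set p" "p \<noteq> []"
  shows "(hd p, last p) \<in> nbR\<^sup>*"
  using assms
proof (induction p arbitrary: u)
  case (Cons e p)
  show ?case
  proof (cases p)
    case (Cons e' p')
    have "(hd p, last p) \<in> nbR\<^sup>*"
      using Cons Cons.IH[of "head G e"] Cons.prems by (auto simp: awalk_Cons_iff)
    moreover have "(e, e') \<in> nbR" using Cons Cons.prems by (auto simp: awalk_Cons_iff nbR_iff)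
    ultimately show ?thesis using Cons by (auto intro: converse_rtrancl_into_rtrancl)
  qed auto
qed simp

lemma nb_cycle_of_cycle:
  assumes cyc: "cycle p" and norev: "\<forall>e\<in>set p. arev e \<notin> set p"
  shows "nb_cycle (set p)"
proof -
  obtain u where u: "awalk u p u" "p \<noteq> []" using cyc by (auto simp: cycle_def)
  have hd_tail: "tail G (hd p) = u" using u by (cases p) (auto simp: awalk_Cons_iff)
  have last_head: "head G (last p) = u"
    using u by (cases p rule: rev_cases) (auto simp: awalk_Cons_iff awalk_Nil_iff)
  have pA: "set p \<subseteq> arcs G" using u by auto
  have close: "(last p, hd p) \<in> nbR"
    using hd_in_set[OF u(2)] last_in_set[OF u(2)] pA hd_tail last_head norev by (auto simp: nbR_iff)
  have to_last: "(e, last p) \<in> nbR\<^sup>*" and from_hd: "(hd p, e) \<in> nbR\<^sup>*"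
    and head_in: "head G e \<in> tail G ` set p" and tail_in: "tail G e \<in> head G ` set p" if e: "e \<in> set p" for e
  proof -
    obtain xs ys where p: "p = xs @ e # ys" using split_list[OF e] by blast
    have w1: "awalk u xs (awlast u xs)" and w2: "awalk (awlast u xs) (e # ys) u" using u(1) unfolding p awalk_append_iff by auto
    have "(hd (e # ys), last (e # ys)) \<in> nbR\<^sup>*" using norev by (intro awalk_nbR[OF w2]) (auto simp: p)
    then show "(e, last p) \<in> nbR\<^sup>*" by (simp add: p)
    have "awalk u (xs @ [e]) (head G e)" using w1 w2 by (auto simp: awalk_Cons_iff awalk_Nil_iff)
    then have "(hd (xs @ [e]), last (xs @ [e])) \<in> nbR\<^sup>*" using norev by (intro awalk_nbR) (auto simp: p)
    then show "(hd p, e) \<in> nbR\<^sup>*" by (cases xs) (auto simp: p)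
    show "head G e \<in> tail G ` set p"
    proof (cases ys)
      case Nil
      then have "head G e = tail G (hd p)" using last_head hd_tail by (simp add: p)
      then show ?thesis using u(2) by simp
    next
      case (Cons e' ys')
      then have "tail G e' = head G e" using w2 by (auto simp: awalk_Cons_iff)
      then show ?thesis using Cons by (auto simp: p intro!: rev_image_eqI[of e'])
    qed
    show "tail G e \<in> head G ` set p"
    proof (cases xs rule: rev_cases)
      case Nil
      then have "tail G e = head G (last p)" using last_head hd_tail by (simp add: p)
      then show ?thesis using u(2) by simp
    next
      case (snoc xs' e')
      then have "head G e' = tail G e" using w2 by (simp add: awalk_Cons_iff awalk_verts_conv)
      then show ?thesis using snoc by (auto simp: p intro!: rev_image_eqI[of e'])
    qed
  qed
  have "(e, f) \<in> nbR\<^sup>*" if "e \<in> set p" "f \<in> set p" for e f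
    using to_last[OF that(1)] close from_hd[OF that(2)] by (meson rtrancl_trans r_into_rtrancl)
  moreover have "head G ` set p = tail G ` set p" using head_in tail_in by auto
  ultimately show ?thesis using u(2) pA norev by (auto simp: nb_cycle_def)
qed

definition edge_closure :: "'e set \<Rightarrow> 'e set" where "edge_closure P = P \<union> arev ` P"

lemma edge_closure_props:
  assumes "nb_cycle P"
  shows "e \<in> edge_closure P \<Longrightarrow> tail G e \<in> tail G ` P" "e \<in> edge_closure P \<Longrightarrow> head G e \<in> tail G ` P"
    "arev e \<in> edge_closure P \<longleftrightarrow> e \<in> edge_closure P"
proof -
  have PA: "P \<subseteq> arcs G" and ht: "head G ` P = tail G ` P" using assms by (auto simp: nb_cycle_def)
  show "arev e \<in> edge_closure P \<longleftrightarrow> e \<in> edge_closure P"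
    by (auto simp: edge_closure_def) (metis arev_arev image_eqI)+
  show "tail G e \<in> tail G ` P" if "e \<in> edge_closure P"
    using that PA ht by (auto simp: edge_closure_def subset_iff)
  show "head G e \<in> tail G ` P" if "e \<in> edge_closure P"
    using that PA ht by (auto simp: edge_closure_def subset_iff)
qed

text \<open>
An ear leaves the cycle by an arc \<open>k\<close> and returns to it by an arc \<open>l\<close>, both not edges of the cycle.
The arc of the cycle into the vertex where the ear starts can then be continued along the cycle or
along the ear, and both continuations lead back. Nothing backtracks at the two junctions because the
ear meets the cycle there with edges that the cycle does not use.
\<close>

lemma branching_of_ear:
  assumes P: "nb_cycle P" and k: "k \<in> arcs G" "k \<notin> edge_closure P" "tail G k \<in> tail G ` P"
    and l: "l \<notin> edge_closure P" "head G l \<in> tail G ` P" and kl: "(k, l) \<in> nbR\<^sup>*"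
  shows "\<exists>f g g'. g \<noteq> g' \<and> (f, g) \<in> nbR \<and> (f, g') \<in> nbR \<and> (g, f) \<in> nbR\<^sup>* \<and> (g', f) \<in> nbR\<^sup>*"
proof -
  have PA: "P \<subseteq> arcs G" and norev: "\<And>e. e \<in> P \<Longrightarrow> arev e \<notin> P" and ht: "head G ` P = tail G ` P"
    and reach: "\<And>e f. e \<in> P \<Longrightarrow> f \<in> P \<Longrightarrow> (e, f) \<in> nbR\<^sup>*"
    using P by (auto simp: nb_cycle_def)
  obtain g where g: "g \<in> P" "tail G g = tail G k" using k(3) by auto
  obtain f where f: "f \<in> P" "head G f = tail G k" using k(3) ht by (metis imageE)
  obtain j where j: "j \<in> P" "tail G j = head G l" using l(2) by auto
  have lA: "l \<in> arcs G" using nbR_arcs[OF kl k(1)] .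
  have "g \<noteq> k" using g k(2) by (auto simp: edge_closure_def)
  moreover have "(f, g) \<in> nbR" using f g PA norev[OF f(1)] by (auto simp: nbR_iff)
  moreover have "(f, k) \<in> nbR" using f k PA by (auto simp: nbR_iff edge_closure_def)
  moreover have "(l, j) \<in> nbR"
    using j l(1) lA PA by (auto simp: nbR_iff edge_closure_def) (metis arev_arev image_eqI)
  then have "(k, f) \<in> nbR\<^sup>*" using kl reach[OF j(1) f(1)] by (meson rtrancl_into_rtrancl rtrancl_trans)
  ultimately show ?thesis using reach[OF g(1) f(1)] by blast
qed

text \<open>
An arc of \<open>P'\<close> that is not an edge of \<open>P\<close> lies, within \<open>P'\<close>, on a segment between two visits to
\<open>P\<close>; this segment is an ear.
\<close>

lemma branching_of_touching_cycles:
  assumes P: "nb_cycle P" and P': "nb_cycle P'" and meet: "tail G ` P \<inter> tail G ` P' \<noteq> {}"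
    and ne: "\<not> P' \<subseteq> edge_closure P"
  shows "\<exists>f g g'. g \<noteq> g' \<and> (f, g) \<in> nbR \<and> (f, g') \<in> nbR \<and> (g, f) \<in> nbR\<^sup>* \<and> (g', f) \<in> nbR\<^sup>*"
proof -
  have reach: "\<And>e f. e \<in> P' \<Longrightarrow> f \<in> P' \<Longrightarrow> (e, f) \<in> nbR\<^sup>*" and ht: "head G ` P' = tail G ` P'"
    and P'A: "P' \<subseteq> arcs G"
    using P' by (auto simp: nb_cycle_def)
  obtain e where e: "e \<in> P'" "e \<notin> edge_closure P" using ne by blast
  obtain y where y: "y \<in> tail G ` P" "y \<in> tail G ` P'" using meet by blast
  from y(2) obtain c where "c \<in> P'" "y = tail G c" by (rule imageE)
  then have c: "c \<in> P'" "tail G c \<in> tail G ` P" using y(1) by simp_all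
  have "tail G c \<in> head G ` P'" unfolding ht using c(1) by (rule imageI)
  then obtain c' where c': "tail G c = head G c'" "c' \<in> P'" by (rule imageE)
  obtain k where k: "k \<notin> edge_closure P" "tail G k \<in> tail G ` P" "(k, e) \<in> nbR\<^sup>*"
    using last_exit[OF reach[OF c(1) e(1)] c(2) e(2) edge_closure_props(2)[OF P]] by blast
  obtain l where l: "l \<notin> edge_closure P" "head G l \<in> tail G ` P" "(e, l) \<in> nbR\<^sup>*"
    using first_entry[OF reach[OF e(1) c'(2)] c(2)[unfolded c'(1)] e(2) edge_closure_props(1)[OF P]] by blast
  have kA: "k \<in> arcs G" using nbR_arcs_back[OF k(3)] e(1) P'A by blast
  show ?thesis by (rule branching_of_ear[OF P kA k(1,2) l(1,2) rtrancl_trans[OF k(3) l(3)]])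
qed

lemma apath_nbR:
  assumes "awalk u p v" "distinct (awalk_verts u p)" "p \<noteq> []"
  shows "(hd p, last p) \<in> nbR\<^sup>*"
  using assms
proof (induction p arbitrary: u)
  case (Cons e p)
  show ?case
  proof (cases p)
    case (Cons e' p')
    have w: "awalk (head G e) p v" "tail G e = u" "e \<in> arcs G" using Cons.prems by (auto simp: awalk_Cons_iff)
    have w': "e' \<in> arcs G" "tail G e' = head G e" "awalk (head G e') p' v"
      using w(1) Cons by (auto simp: awalk_Cons_iff)
    have "hd (awalk_verts (head G e') p') = head G e'" using w'(3) by blast
    then have "head G e' \<in> set (awalk_verts (head G e') p')" by (metis awalk_verts_non_Nil hd_in_set)
    then have "head G e' \<noteq> tail G e" using Cons.prems(2) Cons by auto
    then have "e' \<noteq> arev e" using w(3) by auto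
    then have "(e, e') \<in> nbR" using w w' by (auto simp: nbR_iff)
    moreover have "(hd p, last p) \<in> nbR\<^sup>*"
      using Cons.IH[OF w(1)] Cons.prems(2) Cons by simp
    ultimately show ?thesis using Cons by (auto intro: converse_rtrancl_into_rtrancl)
  qed auto
qed simp

text \<open>
The ear runs along a path from \<open>P\<close> to \<open>P'\<close>, around \<open>P'\<close>, and back along the reversed path. It ends
with the reversal of its first arc.
\<close>

lemma branching_of_disjoint_cycles:
  assumes P: "nb_cycle P" and P': "nb_cycle P'" and disj: "tail G ` P \<inter> tail G ` P' = {}"
    and conn: "\<And>u v. u \<in> verts G \<Longrightarrow> v \<in> verts G \<Longrightarrow> u \<rightarrow>\<^sup>*\<^bsub>G\<^esub> v"
  shows "\<exists>f g g'. g \<noteq> g' \<and> (f, g) \<in> nbR \<and> (f, g') \<in> nbR \<and> (g, f) \<in> nbR\<^sup>* \<and> (g', f) \<in> nbR\<^sup>*"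
proof -
  have reach: "\<And>e f. e \<in> P' \<Longrightarrow> f \<in> P' \<Longrightarrow> (e, f) \<in> nbR\<^sup>*" and ht: "head G ` P' = tail G ` P'"
    and P'A: "P' \<subseteq> arcs G" and ne': "P' \<noteq> {}"
    using P' by (auto simp: nb_cycle_def)
  have PA: "P \<subseteq> arcs G" and ne: "P \<noteq> {}" using P by (auto simp: nb_cycle_def)
  obtain c c' where c: "c \<in> P" "c' \<in> P'" using ne ne' by blast
  have "tail G c \<in> verts G" "tail G c' \<in> verts G" using c PA P'A by auto
  then have "\<exists>p. apath (tail G c) p (tail G c')" using conn reachable_apath by blast
  then obtain p where p: "awalk (tail G c) p (tail G c')" "distinct (awalk_verts (tail G c) p)"
    by (auto simp: apath_def)
  have "p \<noteq> []" using p(1) c disj by (auto simp: awalk_Nil_iff)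
  have hd_tail: "tail G (hd p) = tail G c" using p(1) \<open>p \<noteq> []\<close> by (cases p) (auto simp: awalk_Cons_iff)
  have last_head: "head G (last p) = tail G c'"
    using p(1) \<open>p \<noteq> []\<close> by (cases p rule: rev_cases) (auto simp: awalk_Cons_iff awalk_Nil_iff)
  have "head G (last p) \<notin> tail G ` P" using last_head c disj by auto
  then have "last p \<notin> edge_closure P" using edge_closure_props(2)[OF P] by blast
  then obtain k where k: "k \<notin> edge_closure P" "tail G k \<in> tail G ` P" "(k, last p) \<in> nbR\<^sup>*"
    using last_exit[OF apath_nbR[OF p \<open>p \<noteq> []\<close>] _ _ edge_closure_props(2)[OF P]] hd_tail c(1) by auto
  have "k \<notin> edge_closure P'" using k(2) edge_closure_props(1)[OF P'] disj by blast
  then obtain l where l: "l \<notin> edge_closure P'" "head G l \<in> tail G ` P'" "(k, l) \<in> nbR\<^sup>*"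
    using first_entry[OF k(3) _ _ edge_closure_props(1)[OF P']] last_head c(2) by auto
  have "set p \<subseteq> arcs G" using p(1) by blast
  then have lastA: "last p \<in> arcs G" using last_in_set[OF \<open>p \<noteq> []\<close>] by blast
  have kA: "k \<in> arcs G" by (rule nbR_arcs_back[OF k(3) lastA])
  have lA: "l \<in> arcs G" by (rule nbR_arcs[OF l(3) kA])
  obtain g where g: "g \<in> P'" "tail G g = head G l" using l(2) by auto
  obtain j where j: "j \<in> P'" "head G j = head G l" using l(2) ht by (metis imageE)
  have nl: "arev l \<notin> edge_closure P'" using edge_closure_props(3)[OF P'] l(1) by blast
  have lg: "(l, g) \<in> nbR" using g lA P'A nl by (auto simp: nbR_iff edge_closure_def)
  have jl: "(j, arev l) \<in> nbR"
    using j lA P'A l(1) by (auto simp: nbR_iff edge_closure_def arev_eq_iff)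
  have "(k, j) \<in> nbR\<^sup>*"
    by (rule rtrancl_trans[OF rtrancl_into_rtrancl[OF l(3) lg] reach[OF g(1) j(1)]])
  then have kk: "(k, arev k) \<in> nbR\<^sup>*"
    by (rule rtrancl_trans[OF rtrancl_into_rtrancl[OF _ jl] nbR_rtrancl_arev[OF l(3)]])
  show ?thesis
  proof (rule branching_of_ear[OF P kA k(1,2) _ _ kk])
    show "arev k \<notin> edge_closure P" using edge_closure_props(3)[OF P] k(1) by blast
    show "head G (arev k) \<in> tail G ` P" using k(2) kA by simp
  qed
qed

text \<open>
If the two cycles share a vertex, then, as their edge sets differ, one of them has an edge outside
the other; that cycle supplies the ear.
\<close>

lemma two_cycles_branching:
  assumes conn: "\<And>u v. u \<in> verts G \<Longrightarrow> v \<in> verts G \<Longrightarrow> u \<rightarrow>\<^sup>*\<^bsub>G\<^esub> v"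
    and two: "card (undirected_cycles G arev) \<ge> 2"
  shows "\<exists>f g g'. g \<noteq> g' \<and> (f, g) \<in> nbR \<and> (f, g') \<in> nbR \<and> (g, f) \<in> nbR\<^sup>* \<and> (g', f) \<in> nbR\<^sup>*"
proof -
  have "finite (undirected_cycles G arev)" using two card.infinite by force
  then obtain Z Z' where Z: "Z \<in> undirected_cycles G arev" "Z' \<in> undirected_cycles G arev" "Z \<noteq> Z'"
    using two card_le_Suc0_iff_eq[of "undirected_cycles G arev"] by force
  have "\<exists>P. nb_cycle P \<and> Z = edge_closure P" if "Z \<in> undirected_cycles G arev" for Z
    using that nb_cycle_of_cycle unfolding undirected_cycles_def edge_closure_def by blast
  then obtain P P' where P: "nb_cycle P" "Z = edge_closure P" and P': "nb_cycle P'" "Z' = edge_closure P'"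
    using Z by metis
  show ?thesis
  proof (cases "tail G ` P \<inter> tail G ` P' = {}")
    case True
    then show ?thesis using branching_of_disjoint_cycles[OF P(1) P'(1)] conn by blast
  next
    case False
    have sub: "edge_closure X \<subseteq> edge_closure Y" if "nb_cycle Y" "X \<subseteq> edge_closure Y" for X Y
      using that edge_closure_props(3)[OF that(1)] by (auto simp: edge_closure_def[of X])
    have "\<not> P \<subseteq> edge_closure P' \<or> \<not> P' \<subseteq> edge_closure P"
      using sub[OF P(1)] sub[OF P'(1)] Z(3) P(2) P'(2) by blast
    then show ?thesis
      using branching_of_touching_cycles[OF P(1) P'(1)] branching_of_touching_cycles[OF P'(1) P(1)] False
      by (metis Int_commute)
  qed
qed

section \<open>Green's functions at the edge\<close>

lemma edge_row_bound:
  assumes top: "\<And>x::real. complex_of_real x \<in> ell2_spectrum T J \<Longrightarrow> x \<le> \<rho>"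
    and lift: "\<And>u. u \<in> verts G \<Longrightarrow> \<exists>w\<in>T. \<pi> w = u"
    and u: "u \<in> verts G"
  shows "(\<Sum>g\<in>out_arcs G u. (a g)\<^sup>2 * iter \<rho> n g) \<le> \<rho> - b u"
proof (rule tendsto_le)
  have cont: "isCont (\<lambda>x. iter x n g) \<rho>" if "g \<in> arcs G" for g
    by (rule conjunct1[OF bspec[OF iter_at_edge[OF top lift] that]])
  have "isCont (\<lambda>x. \<Sum>g\<in>out_arcs G u. (a g)\<^sup>2 * iter x n g) \<rho>"
    by (intro continuous_intros cont) auto
  then show "((\<lambda>x. \<Sum>g\<in>out_arcs G u. (a g)\<^sup>2 * iter x n g) \<longlongrightarrow> (\<Sum>g\<in>out_arcs G u. (a g)\<^sup>2 * iter \<rho> n g)) (at_right \<rho>)"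
    unfolding isCont_def by (rule tendsto_within_subset) simp
  show "((\<lambda>x. x - b u) \<longlongrightarrow> \<rho> - b u) (at_right \<rho>)" by (intro tendsto_intros)
  have "\<forall>\<^sub>F x in at_right \<rho>. \<rho> < x" by (simp add: eventually_at_filter)
  then show "\<forall>\<^sub>F x in at_right \<rho>. (\<Sum>g\<in>out_arcs G u. (a g)\<^sup>2 * iter x n g) \<le> x - b u"
    by eventually_elim (rule iter_bounds_above(2)[OF top lift _ u])
qed simp

lemma branch_recursion_at_edge:
  assumes top: "\<And>x::real. complex_of_real x \<in> ell2_spectrum T J \<Longrightarrow> x \<le> \<rho>"
    and lift: "\<And>u. u \<in> verts G \<Longrightarrow> \<exists>w\<in>T. \<pi> w = u"
  shows "branch_recursion (arcs G) nsucc (\<lambda>g. (a g)\<^sup>2) (\<lambda>f. b (head G f)) \<rho>"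
proof
  show "finite (arcs G)" by simp
  show "nsucc f \<subseteq> arcs G" for f by (rule nsucc_subset)
  show "0 < (a g)\<^sup>2" if "g \<in> arcs G" for g using a_pos[OF that] by simp
  have den: "0 < den \<rho> (iter \<rho> n) f" if "f \<in> arcs G" for f n
    by (rule conjunct2[OF bspec[OF iter_at_edge[OF top lift] that]])
  then show "0 < den \<rho> (iter \<rho> n) f" if "f \<in> arcs G" for f n using that .
  have nonneg: "0 \<le> iter \<rho> n g" if "g \<in> arcs G" for g n
    using den[OF that] by (cases n) (auto intro: less_imp_le)
  show "\<exists>K. \<forall>n. iter \<rho> n f \<le> K" if f: "f \<in> arcs G" for f
  proof (intro exI allI)
    fix n
    have "(a f)\<^sup>2 * iter \<rho> n f \<le> (\<Sum>g\<in>out_arcs G (tail G f). (a g)\<^sup>2 * iter \<rho> n g)"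
      using f nonneg by (intro member_le_sum) (auto simp: finite_out_arcs)
    also have "\<dots> \<le> \<rho> - b (tail G f)" using f by (intro edge_row_bound[OF top lift]) auto
    finally show "iter \<rho> n f \<le> (\<rho> - b (tail G f)) / (a f)\<^sup>2"
      using a_pos[OF f] by (simp add: le_divide_eq mult.commute)
  qed
qed

text \<open>
Let \<open>Gd u\<close> be the quantity in question. The recursion at \<open>g\<close> and at \<open>arev g\<close> gives
\<open>m g * Gd (head g) = 1 - (a g)\<^sup>2 * m g * m (arev g) = m (arev g) * Gd (tail g)\<close>, so in a connected
graph \<open>Gd\<close> vanishes everywhere or nowhere. If it vanishes, then
\<open>Q e k * Q (arev k) (arev e) = 1\<close> for consecutive arcs. For supersolutions \<open>v\<close> on the class of the
branching arc \<open>f\<close> and \<open>w\<close> on the class of \<open>arev f\<close>, the quotient \<open>v e / w (arev e)\<close> does not increase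
along the walk from \<open>g\<close> back to \<open>f\<close>, whereas the second successor \<open>g'\<close> makes it drop strictly from
\<open>f\<close> to \<open>g\<close>. In probabilistic terms, the tree over two cycles is transient at the spectral edge.
\<close>

lemma vertex_denom_pos:
  assumes top: "\<And>x::real. complex_of_real x \<in> ell2_spectrum T J \<Longrightarrow> x \<le> \<rho>"
    and lift: "\<And>u. u \<in> verts G \<Longrightarrow> \<exists>w\<in>T. \<pi> w = u"
    and conn: "\<And>u v. u \<in> verts G \<Longrightarrow> v \<in> verts G \<Longrightarrow> u \<rightarrow>\<^sup>*\<^bsub>G\<^esub> v"
    and two: "card (undirected_cycles G arev) \<ge> 2"
    and u: "u \<in> verts G"
  shows "0 < \<rho> - b u - (\<Sum>g\<in>out_arcs G u. (a g)\<^sup>2 *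
    branch_recursion.m nsucc (\<lambda>g. (a g)\<^sup>2) (\<lambda>f. b (head G f)) \<rho> g)"
proof -
  interpret BR: branch_recursion "arcs G" nsucc "\<lambda>g. (a g)\<^sup>2" "\<lambda>f. b (head G f)" \<rho>
    by (rule branch_recursion_at_edge[OF top lift])
  define Gd where "Gd u = \<rho> - b u - (\<Sum>g\<in>out_arcs G u. (a g)\<^sup>2 * BR.m g)" for u
  have Gd_nonneg: "0 \<le> Gd u" if "u \<in> verts G" for u
  proof -
    have "(\<lambda>n. \<Sum>g\<in>out_arcs G u. (a g)\<^sup>2 * iter \<rho> n g) \<longlonglongrightarrow> (\<Sum>g\<in>out_arcs G u. (a g)\<^sup>2 * BR.m g)"
      by (intro tendsto_intros BR.it_tendsto) auto
    then have "(\<Sum>g\<in>out_arcs G u. (a g)\<^sup>2 * BR.m g) \<le> \<rho> - b u"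
      by (rule LIMSEQ_le_const2) (use edge_row_bound[OF top lift that] in blast)
    then show ?thesis by (simp add: Gd_def)
  qed
  have Gd_head: "BR.m g * Gd (head G g) = 1 - (a g)\<^sup>2 * BR.m g * BR.m (arev g)" if g: "g \<in> arcs G" for g
  proof -
    have "Gd (head G g) = den \<rho> BR.m g - (a g)\<^sup>2 * BR.m (arev g)"
      using out_arcs_split[OF g, of "\<lambda>g. (a g)\<^sup>2 * BR.m g"] a_arev[OF g]
      by (simp add: Gd_def branch_denom_def)
    then show ?thesis using BR.m_fixed[OF g] by (simp add: right_diff_distrib mult_ac)
  qed
  have Gd_tail: "BR.m (arev g) * Gd (tail G g) = 1 - (a g)\<^sup>2 * BR.m g * BR.m (arev g)" if g: "g \<in> arcs G" for g
    using Gd_head[of "arev g"] g a_arev[OF g] by (simp add: mult_ac)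
  have m0: "BR.m g \<noteq> 0" if "g \<in> arcs G" for g using BR.m_pos[OF that] by simp
  have "Gd u \<noteq> 0"
  proof
    assume zero: "Gd u = 0"
    have all_zero: "Gd v = 0" if v: "v \<in> verts G" for v
      using conn[OF u v]
    proof (induction rule: reachable_induct)
      case base
      then show ?case using zero by simp
    next
      case (step x y)
      then obtain g where g: "g \<in> arcs G" "tail G g = x" "head G g = y" by (auto simp: arcs_ends_conv)
      then have "BR.m g * Gd y = 0" using Gd_head[OF g(1)] Gd_tail[OF g(1)] step.IH by simp
      then show ?case using m0[OF g(1)] by simp
    qed
    have recip: "(a g)\<^sup>2 * BR.m g * BR.m (arev g) = 1" if g: "g \<in> arcs G" for g
      using Gd_head[OF g] all_zero[of "head G g"] g by simp
    have R_eq: "BR.R = nbR" by (simp add: BR.R_def nbR_def)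
    obtain f g g' where fg: "g \<noteq> g'" "(f, g) \<in> nbR" "(f, g') \<in> nbR" "(g, f) \<in> nbR\<^sup>*" "(g', f) \<in> nbR\<^sup>*"
      using two_cycles_branching[OF conn two] by blast
    have fA: "f \<in> arcs G" using fg by (auto simp: nbR_iff)
    then have rfA: "arev f \<in> arcs G" by simp
    define C where "C = BR.scc f"
    define C' where "C' = BR.scc (arev f)"
    have C_rev: "arev e \<in> C'" if "e \<in> C" for e
      using that nbR_rtrancl_arev by (auto simp: C_def C'_def BR.scc_def R_eq)
    have gC: "g \<in> C" "g' \<in> C" "f \<in> C"
      using fg by (auto simp: C_def BR.scc_def R_eq)
    have CA: "C \<subseteq> arcs G" using BR.scc_subset[OF fA] by (simp add: C_def)
    have C'A: "C' \<subseteq> arcs G" using BR.scc_subset[OF rfA] by (simp add: C'_def)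
    obtain v where v: "\<And>e. e \<in> C \<Longrightarrow> 0 < v e"
      "\<And>e. e \<in> C \<Longrightarrow> (\<Sum>k\<in>nsucc e \<inter> C. BR.Q e k * v k) \<le> v e"
      using BR.scc_supersolution[OF fA] unfolding C_def by blast
    obtain w where w: "\<And>e. e \<in> C' \<Longrightarrow> 0 < w e"
      "\<And>e. e \<in> C' \<Longrightarrow> (\<Sum>k\<in>nsucc e \<inter> C'. BR.Q e k * w k) \<le> w e"
      using BR.scc_supersolution[OF rfA] unfolding C'_def by blast
    have Qpos: "0 < BR.Q e k" if "e \<in> arcs G" "k \<in> arcs G" for e k using BR.Q_pos that .
    have v_step: "BR.Q e k * v k \<le> v e" if e: "e \<in> C" "k \<in> C" "(e, k) \<in> nbR" for e k
    proof -
      have "BR.Q e k * v k \<le> (\<Sum>k\<in>nsucc e \<inter> C. BR.Q e k * v k)"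
        using e finite_nsucc CA v(1) Qpos
        by (intro member_le_sum) (auto simp: nbR_def less_imp_le subset_iff)
      then show ?thesis using v(2)[OF e(1)] by linarith
    qed
    have w_step: "w (arev e) \<le> BR.Q e k * w (arev k)" if e: "e \<in> C" "k \<in> C" "(e, k) \<in> nbR" for e k
    proof -
      have eA: "e \<in> arcs G" "k \<in> arcs G" using e CA by auto
      have "BR.Q (arev k) (arev e) * w (arev e) \<le> (\<Sum>k'\<in>nsucc (arev k) \<inter> C'. BR.Q (arev k) k' * w k')"
        using nbR_arev[OF e(3)] C_rev[OF e(1)] finite_nsucc C'A w(1) Qpos eA
        by (intro member_le_sum) (auto simp: nbR_def less_imp_le subset_iff)
      also have "\<dots> \<le> w (arev k)" using w(2)[OF C_rev[OF e(2)]] .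
      finally have le: "BR.Q (arev k) (arev e) * w (arev e) \<le> w (arev k)" .
      have "BR.Q e k * BR.Q (arev k) (arev e)
          = ((a e)\<^sup>2 * BR.m e * BR.m (arev e)) * ((a k)\<^sup>2 * BR.m k * BR.m (arev k))"
        using a_arev[OF eA(1)] by (simp add: BR.Q_def)
      then have inv: "BR.Q e k * BR.Q (arev k) (arev e) = 1" using recip eA by simp
      have "BR.Q e k * (BR.Q (arev k) (arev e) * w (arev e)) \<le> BR.Q e k * w (arev k)"
        using le Qpos[OF eA] by (intro mult_left_mono) auto
      then show ?thesis using inv by (simp add: mult.assoc[symmetric])
    qed
    define F where "F e = v e / w (arev e)" for e
    have wpos: "0 < w (arev e)" if "e \<in> C" for e using w(1) C_rev[OF that] by blast
    have F_step: "F k \<le> F e" if e: "e \<in> C" "k \<in> C" "(e, k) \<in> nbR" for e k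
    proof -
      have Qe: "0 < BR.Q e k" using Qpos e CA by auto
      have "F k = BR.Q e k * v k / (BR.Q e k * w (arev k))" using Qe by (simp add: F_def)
      also have "\<dots> \<le> v e / w (arev e)"
        using v_step[OF e] w_step[OF e] wpos[OF e(1)] v(1)[OF e(1)] v(1)[OF e(2)] Qe
        by (intro frac_le) (auto simp: less_imp_le)
      finally show ?thesis by (simp add: F_def)
    qed
    have F_path: "F f \<le> F g"
    proof -
      have "g \<in> C \<longrightarrow> F f \<le> F g" using fg(4)
      proof (induction rule: converse_rtrancl_induct)
        case (step e k)
        show ?case
        proof
          assume eC: "e \<in> C"
          have "k \<in> C"
            using BR.scc_between[of e f k f] eC step.hyps gC(3) by (auto simp: C_def R_eq)
          then show "F f \<le> F e" using step.IH F_step[OF eC _ step.hyps(1)] by force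
        qed
      qed simp
      then show ?thesis using gC by blast
    qed
    have Qf: "0 < BR.Q f g" "0 < BR.Q f g'" using Qpos CA gC by auto
    have "BR.Q f g * v g + BR.Q f g' * v g' \<le> (\<Sum>k\<in>nsucc f \<inter> C. BR.Q f k * v k)"
    proof -
      have "(\<Sum>k\<in>{g, g'}. BR.Q f k * v k) \<le> (\<Sum>k\<in>nsucc f \<inter> C. BR.Q f k * v k)"
        using fg gC CA v(1) Qpos fA finite_nsucc
        by (intro sum_mono2) (auto simp: nbR_def less_imp_le subset_iff)
      then show ?thesis using fg(1) by simp
    qed
    then have "BR.Q f g * v g < v f" using v(2)[OF gC(3)] Qf v(1)[OF gC(2)] by (smt (verit) mult_pos_pos)
    then have "BR.Q f g * v g / w (arev f) < F f"
      using wpos[OF gC(3)] by (simp add: F_def divide_strict_right_mono)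
    moreover have "F g \<le> BR.Q f g * v g / w (arev f)"
    proof -
      have "F g = BR.Q f g * v g / (BR.Q f g * w (arev g))" using Qf by (simp add: F_def)
      also have "\<dots> \<le> BR.Q f g * v g / w (arev f)"
        using w_step[OF gC(3) gC(1) fg(2)] wpos[OF gC(3)] v(1)[OF gC(1)] Qf
        by (intro frac_le) (auto simp: less_imp_le)
      finally show ?thesis .
    qed
    ultimately show False using F_path by linarith
  qed
  then show ?thesis using Gd_nonneg[OF u] by (simp add: Gd_def)
qed

text \<open>
The limit of the Stieltjes transform at \<open>\<rho>\<close> is the inverse of a positive real number.
\<close>

lemma Im_stieltjes_tendsto:
  assumes top: "\<And>x::real. complex_of_real x \<in> ell2_spectrum T J \<Longrightarrow> x \<le> \<rho>"
    and lift: "\<And>u. u \<in> verts G \<Longrightarrow> \<exists>w\<in>T. \<pi> w = u"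
    and conn: "\<And>u v. u \<in> verts G \<Longrightarrow> v \<in> verts G \<Longrightarrow> u \<rightarrow>\<^sup>*\<^bsub>G\<^esub> v"
    and two: "card (undirected_cycles G arev) \<ge> 2"
    and r: "r \<in> T" and M: "is_spectral_measure T J r M"
  shows "((\<lambda>z. Im (stieltjes M z)) \<longlongrightarrow> 0) (at (complex_of_real \<rho>) within {z. 0 < Im z})"
proof -
  interpret BR: branch_recursion "arcs G" nsucc "\<lambda>g. (a g)\<^sup>2" "\<lambda>f. b (head G f)" \<rho>
    by (rule branch_recursion_at_edge[OF top lift])
  obtain h where h: "BR.branch_solution h" by (rule BR.branch_solution_exists)
  define Gd where "Gd z = z - of_real (b (\<pi> r)) - (\<Sum>g\<in>out_arcs G (\<pi> r). of_real ((a g)\<^sup>2) * h g z)" for z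
  define c where "c = \<rho> - b (\<pi> r) - (\<Sum>g\<in>out_arcs G (\<pi> r). (a g)\<^sup>2 * BR.m g)"
  have c: "0 < c" unfolding c_def by (rule vertex_denom_pos[OF top lift conn two \<pi>_verts[OF r]])
  have st: "stieltjes M z * Gd z = 1" if "0 < Im z" for z
    unfolding Gd_def
    by (rule stieltjes_eq[OF r M _ _ _ that])
      (use h in \<open>auto simp: BR.branch_solution_def branch_denom_def\<close>)
  have "(Gd \<longlongrightarrow> of_real \<rho> - of_real (b (\<pi> r)) - (\<Sum>g\<in>out_arcs G (\<pi> r). of_real ((a g)\<^sup>2) * of_real (BR.m g)))
      (at (complex_of_real \<rho>) within {z. 0 < Im z})"
    unfolding Gd_def by (intro tendsto_intros BR.branch_solution_tendsto[OF h]) auto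
  then have "(Gd \<longlongrightarrow> of_real c) (at (complex_of_real \<rho>) within {z. 0 < Im z})"
    by (simp add: c_def)
  then have lim: "((\<lambda>z. Im (inverse (Gd z))) \<longlongrightarrow> Im (inverse (of_real c))) (at (complex_of_real \<rho>) within {z. 0 < Im z})"
    using c by (intro tendsto_intros) auto
  have ev: "\<forall>\<^sub>F z in at (complex_of_real \<rho>) within {z. 0 < Im z}. Im (inverse (Gd z)) = Im (stieltjes M z)"
    unfolding eventually_at_filter
    by (intro always_eventually allI impI) (metis st inverse_unique mem_Collect_eq mult.commute)
  have "Im (inverse (complex_of_real c)) = 0" by (simp flip: of_real_inverse)
  then show ?thesis using Lim_transform_eventually[OF lim ev] by (simp only:)
qed

end

section \<open>Absolute continuity at the edge\<close>

theorem theorem1p7: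
  fixes G :: "('v, 'e) pre_digraph"
    and arev :: "'e \<Rightarrow> 'e"
    and a :: "'e \<Rightarrow> real"
    and b :: "'v \<Rightarrow> real"
    and v0 :: 'v
    and lft :: "'v \<Rightarrow> 'e list"
    and \<mu> :: "'v \<Rightarrow> real measure"
    and \<rho> :: real
  assumes "fin_digraph G"
    and "bidirected_digraph G arev"
    and "Digraph_Component.connected G"
    and "card (undirected_cycles G arev) \<ge> 2"
    and "\<And>f. f \<in> arcs G \<Longrightarrow> a (arev f) = a f"
    and "\<And>f. f \<in> arcs G \<Longrightarrow> a f > 0"
    and "v0 \<in> verts G"
    and "\<And>u. u \<in> verts G \<Longrightarrow>
           lft u \<in> verts (universal_cover G arev v0) \<and> cover_map G v0 (lft u) = u"
    and "\<And>u. u \<in> verts G \<Longrightarrow>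
           is_spectral_measure (verts (universal_cover G arev v0)) (cover_jacobi G arev v0 a b)
             (lft u) (\<mu> u)"
    and "complex_of_real \<rho> \<in>
           ell2_spectrum (verts (universal_cover G arev v0)) (cover_jacobi G arev v0 a b)"
    and "\<And>x::real. complex_of_real x \<in>
           ell2_spectrum (verts (universal_cover G arev v0)) (cover_jacobi G arev v0 a b) \<Longrightarrow> x \<le> \<rho>"
  shows "\<exists>U. open U \<and> \<rho> \<in> U \<and>
           absolutely_continuous lborel (cut_measure (density_of_states G \<mu>) U) \<and>
           (\<exists>g :: real \<Rightarrow> ennreal.
              (AE x in lborel. RN_deriv lborel (cut_measure (density_of_states G \<mu>) U) x = g x) \<and>
              (g \<longlongrightarrow> 0) (at \<rho>))"
proof -
  interpret fin_digraph G by (fact assms(1))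
  interpret bidirected_digraph G arev by (fact assms(2))
  interpret periodic_tree G arev a b v0
    by unfold_locales (use assms(5-7) in auto)
  have cover: "verts (universal_cover G arev v0) = T" by (simp add: universal_cover_def)
  note top = assms(11)[unfolded cover]
  have lift: "\<exists>w\<in>T. \<pi> w = u" if "u \<in> verts G" for u
    using assms(8)[OF that] cover by auto
  have conn: "u \<rightarrow>\<^sup>*\<^bsub>G\<^esub> v" if "u \<in> verts G" "v \<in> verts G" for u v
    using assms(3) that reachable_mk_symmetric_eq[OF sym_arcs]
    by (auto simp: Digraph_Component.connected_def strongly_connected_def)
  have lft: "lft u \<in> T" and spec: "is_spectral_measure T J (lft u) (\<mu> u)" if "u \<in> verts G" for u
    using assms(8,9)[OF that] cover by auto
  have fin: "finite_measure (\<mu> u)" and sets_\<mu>: "sets (\<mu> u) = sets borel" if "u \<in> verts G" for u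
    using spec[OF that] by (auto simp: is_spectral_measure_def prob_space_def)
  show ?thesis
  proof (rule vanishing_density[OF sets_density_of_states])
    fix e :: real assume e: "0 < e"
    have "\<forall>\<^sub>F z in at (complex_of_real \<rho>) within {z. 0 < Im z}. \<forall>u\<in>verts G. \<bar>Im (stieltjes (\<mu> u) z)\<bar> < e"
    proof (intro eventually_ball_finite ballI)
      fix u assume u: "u \<in> verts G"
      show "\<forall>\<^sub>F z in at (complex_of_real \<rho>) within {z. 0 < Im z}. \<bar>Im (stieltjes (\<mu> u) z)\<bar> < e"
        using tendstoD[OF Im_stieltjes_tendsto[OF top lift conn assms(4) lft[OF u] spec[OF u]] e] by simp
    qed simp
    then obtain \<delta> where \<delta>: "0 < \<delta>" and small: "\<And>z u. 0 < Im z \<Longrightarrow> dist z (complex_of_real \<rho>) < \<delta> \<Longrightarrow>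
        u \<in> verts G \<Longrightarrow> \<bar>Im (stieltjes (\<mu> u) z)\<bar> < e"
      unfolding eventually_at by force
    have "emeasure (density_of_states G \<mu>) {s..t} \<le> ennreal (e * (t - s))"
      if st: "s < t" "{s..t} \<subseteq> {\<rho> - \<delta> / 2<..<\<rho> + \<delta> / 2}" for s t
    proof -
      \<comment> \<open>The interval is centred at \<open>x\<close>, and \<open>x + \<i> \<eta>\<close> lies in the half-disc where the transforms are controlled.\<close>
      define x where "x = (s + t) / 2"
      define \<eta> where "\<eta> = (t - s) / 2"
      have \<eta>: "0 < \<eta>" "\<eta> < \<delta> / 2" "\<bar>x - \<rho>\<bar> < \<delta> / 2" and ends: "x - \<eta> = s" "x + \<eta> = t"
      proof -
        have "s \<in> {s..t}" "t \<in> {s..t}" using st(1) by auto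
        then have "\<rho> - \<delta> / 2 < s" "t < \<rho> + \<delta> / 2" using st(2) by auto
        then have bnds: "\<rho> - \<delta> / 2 < x" "x < \<rho> + \<delta> / 2" and "0 < \<eta>" "\<eta> < \<delta> / 2"
          using st(1) by (simp_all add: x_def \<eta>_def)
        then show "0 < \<eta>" "\<eta> < \<delta> / 2" by simp_all
        show "\<bar>x - \<rho>\<bar> < \<delta> / 2" using bnds by linarith
        show "x - \<eta> = s" "x + \<eta> = t" by (auto simp: x_def \<eta>_def field_simps)
      qed
      have "dist (Complex x \<eta>) (complex_of_real \<rho>) \<le> \<bar>x - \<rho>\<bar> + \<bar>\<eta>\<bar>"
        using cmod_le[of "Complex x \<eta> - complex_of_real \<rho>"] by (simp add: dist_norm)
      then have near: "dist (Complex x \<eta>) (complex_of_real \<rho>) < \<delta>" using \<eta> by linarith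
      have "emeasure (\<mu> u) {s..t} \<le> ennreal (e * (t - s))" if u: "u \<in> verts G" for u
      proof -
        have "measure (\<mu> u) {s..t} \<le> 2 * \<eta> * (- Im (stieltjes (\<mu> u) (Complex x \<eta>)))"
          using interval_measure_le_Im_stieltjes[OF fin[OF u] sets_\<mu>[OF u] \<eta>(1), of x] by (simp add: ends)
        also have "\<dots> \<le> 2 * \<eta> * e"
          using small[OF _ near u] \<eta>(1) by (intro mult_left_mono) (auto simp: abs_less_iff)
        also have "\<dots> = e * (t - s)" by (simp add: \<eta>_def)
        finally show ?thesis
          using finite_measure.emeasure_eq_measure[OF fin[OF u]] by (simp add: ennreal_leI)
      qed
      then have "(\<Sum>u\<in>verts G. emeasure (\<mu> u) {s..t}) \<le> of_nat (card (verts G)) * ennreal (e * (t - s))"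
        by (rule sum_bounded_above)
      then have "(\<Sum>u\<in>verts G. emeasure (\<mu> u) {s..t}) / of_nat (card (verts G))
          \<le> of_nat (card (verts G)) * ennreal (e * (t - s)) / of_nat (card (verts G))"
        by (rule divide_right_mono_ennreal)
      also have "\<dots> = ennreal (e * (t - s))"
        using assms(7) by (subst mult.commute, subst mult_divide_eq_ennreal) auto
      finally show ?thesis
        using emeasure_density_of_states[OF finite_verts sets_\<mu>, where A = "{s..t}"] by simp
    qed
    then show "\<exists>\<delta>>0. \<forall>s t. s < t \<longrightarrow> {s..t} \<subseteq> {\<rho> - \<delta><..<\<rho> + \<delta>} \<longrightarrow>
        emeasure (density_of_states G \<mu>) {s..t} \<le> ennreal (e * (t - s))"
      using \<delta> by (intro exI[of _ "\<delta> / 2"]) auto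
  qed
qed

end
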